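(* Let $n\ge1$, let $\gamma\subset\mathbb R^{n+1}$ be a local $C^\infty$-smooth hypersurface (a small contractible representative of a germ of hypersurface, not necessarily convex), and let $\Pi_\gamma$ be a corresponding domain in the space of oriented lines. Then the Lie algebra of vector fields on $\Pi_\gamma$ generated by the fields $v_f$, $f\in C^\infty(\gamma)$, is $C^\infty$-dense (i.e. dense in the topology of uniform convergence with all derivatives on compact subsets) in the Lie algebra of Hamiltonian vector fields on $\Pi_\gamma$.
   Context: Setting. $\gamma$ is an arbitrarily small contractible neighborhood of a point $x_0$ in a $C^\infty$-smooth hypersurface of $\mathbb R^{n+1}$, parametrized by a contractible domain in $\mathbb R^n$. $\Pi=\Pi_\gamma$ is a fixed domain in the space of oriented lines in $\mathbb R^{n+1}$ such that each $L\in\Pi$ intersects $\gamma$ transversally at one point $x=x(L)$. Let $w=w(L)\in T_x\gamma$ be the orthogonal projection to $T_x\gamma$ of the unit directing vector of $L$ at $x$. All the tangent spaces $T_x\gamma$ are identified by projecting them orthogonally to an appropriate coordinate subspace $\mathbb R^n\subset\mathbb R^{n+1}$, and $\Pi$ is chosen so that $L\mapsto(x,w)$ is a diffeomorphism of $\Pi$ onto a contractible domain in $\mathbb R^{2n}$. The canonical symplectic form of the space of oriented lines is, on $\Pi$, the pullback under $L\mapsto(x(L),w(L))\in T_{<1}\gamma=\{(x,w)\in T\gamma:\|w\|<1\}$ of $\omega=d\alpha$, where $\alpha(v)=\langle w,\pi_*v\rangle$ for $v\in T_{(x,w)}(T\gamma)$ and $\pi:T\gamma\to\gamma$ is the projection.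 Reflection and deformations. Let $\vec N$ be the unit normal field on $\gamma$ with $\langle u,\vec N\rangle>0$ for the directing vectors $u$ of lines of $\Pi$. The reflection $\mathcal T_\gamma$ sends an oriented line $L$ crossing $\gamma$ transversally at $x$ with unit directing vector $u$ to the line through $x$ with directing vector $u-2\langle u,\vec N(x)\rangle\vec N(x)$. For $f\in C^\infty(\gamma)$ set $\gamma_{\varepsilon,f}=\{x+\varepsilon f(x)\vec N(x):x\in\gamma\}$, $\Delta\mathcal T_{\varepsilon,f}=\mathcal T_{\gamma_{\varepsilon,f}}^{-1}\circ\mathcal T_\gamma$ (reflection at intersection points close to $x(L)$, so that $\Delta\mathcal T_{0,f}=\mathrm{Id}$), $v_f=\frac{d}{d\varepsilon}\Delta\mathcal T_{\varepsilon,f}|_{\varepsilon=0}$. On each compact subset of $\Pi$, $\Delta\mathcal T_{\varepsilon,f}$ is well-defined for all small $\varepsilon$, so $v_f$ is a vector field on $\Pi$. A vector field $X$ is Hamiltonian if $i_X\omega=dH$ for some globally defined $C^\infty$ function $H$. *)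

theory Defs
  imports "HOL-Analysis.Analysis"
begin

section \<open>Smooth maps, vector fields and one-forms on open subsets of Euclidean spaces\<close>

primrec iter_deriv :: "'a list \<Rightarrow> ('a::euclidean_space \<Rightarrow> 'b::euclidean_space) \<Rightarrow> 'a \<Rightarrow> 'b" where
  "iter_deriv [] F = F"
| "iter_deriv (v # vs) F = (\<lambda>x. frechet_derivative (iter_deriv vs F) (at x) v)"

text \<open>Only used for open \<open>U\<close>: all iterated directional derivatives exist and are (totally)
  differentiable, hence continuous. Values of \<open>F\<close> outside \<open>U\<close> are irrelevant.\<close>

definition smooth_on :: "'a::euclidean_space set \<Rightarrow> ('a \<Rightarrow> 'b::euclidean_space) \<Rightarrow> bool" where
  "smooth_on U F \<longleftrightarrow> (\<forall>vs. \<forall>x\<in>U. iter_deriv vs F differentiable (at x))"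

definition contractible_domain :: "'a::euclidean_space set \<Rightarrow> bool" where
  "contractible_domain U \<longleftrightarrow> open U \<and> connected U \<and> U \<noteq> {} \<and> contractible U"

definition lie_bracket :: "('a::euclidean_space \<Rightarrow> 'a) \<Rightarrow> ('a \<Rightarrow> 'a) \<Rightarrow> 'a \<Rightarrow> 'a" where
  "lie_bracket X Y = (\<lambda>z. frechet_derivative Y (at z) (X z) - frechet_derivative X (at z) (Y z))"

inductive_set lie_algebra_generated ::
    "('a::euclidean_space \<Rightarrow> 'a) set \<Rightarrow> ('a \<Rightarrow> 'a) set" for G where
  gen: "X \<in> G \<Longrightarrow> X \<in> lie_algebra_generated G"
| zero: "(\<lambda>z. 0) \<in> lie_algebra_generated G"
| add: "X \<in> lie_algebra_generated G \<Longrightarrow> Y \<in> lie_algebra_generated G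
    \<Longrightarrow> (\<lambda>z. X z + Y z) \<in> lie_algebra_generated G"
| scale: "X \<in> lie_algebra_generated G \<Longrightarrow> (\<lambda>z. c *\<^sub>R X z) \<in> lie_algebra_generated G"
| bracket: "X \<in> lie_algebra_generated G \<Longrightarrow> Y \<in> lie_algebra_generated G
    \<Longrightarrow> lie_bracket X Y \<in> lie_algebra_generated G"

text \<open>The exterior derivative of a one-form \<open>a\<close> (with \<open>a z \<xi>\<close> the value at the point \<open>z\<close> on the
  tangent vector \<open>\<xi>\<close>): the usual formula \<open>da(\<xi>, \<eta>) = \<xi>(a(\<eta>)) - \<eta>(a(\<xi>)) - a([\<xi>, \<eta>])\<close> for constant
  fields \<open>\<xi>\<close>, \<open>\<eta>\<close>.\<close>

definition ext_deriv :: "('a::euclidean_space \<Rightarrow> 'a \<Rightarrow> real) \<Rightarrow> 'a \<Rightarrow> 'a \<Rightarrow> 'a \<Rightarrow> real" where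
  "ext_deriv a z \<xi> \<eta> =
     frechet_derivative (\<lambda>y. a y \<eta>) (at z) \<xi> - frechet_derivative (\<lambda>y. a y \<xi>) (at z) \<eta>"

definition hamiltonian_fields ::
    "'a::euclidean_space set \<Rightarrow> ('a \<Rightarrow> 'a \<Rightarrow> 'a \<Rightarrow> real) \<Rightarrow> ('a \<Rightarrow> 'a) set" where
  "hamiltonian_fields U \<omega> = {X. smooth_on U X \<and>
     (\<exists>H. smooth_on U H \<and> (\<forall>z\<in>U. \<forall>\<eta>. \<omega> z (X z) \<eta> = frechet_derivative H (at z) \<eta>))}"

text \<open>\<open>A\<close> is a dense subset of \<open>B\<close> in the topology of uniform convergence with all derivatives
  on compact subsets of \<open>U\<close>; a basis of neighbourhoods of \<open>X\<close> is given by a compact \<open>K\<close>,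
  a maximal order \<open>k\<close> of derivatives and \<open>e > 0\<close>.\<close>

definition C_infinity_dense ::
    "'a::euclidean_space set \<Rightarrow> ('a \<Rightarrow> 'b::euclidean_space) set \<Rightarrow> ('a \<Rightarrow> 'b) set \<Rightarrow> bool" where
  "C_infinity_dense U A B \<longleftrightarrow> A \<subseteq> B \<and>
     (\<forall>X\<in>B. \<forall>K k e. compact K \<and> K \<subseteq> U \<and> (e::real) > 0 \<longrightarrow>
        (\<exists>Y\<in>A. \<forall>z\<in>K. \<forall>vs. set vs \<subseteq> Basis \<and> length vs \<le> k \<longrightarrow>
           norm (iter_deriv vs Y z - iter_deriv vs X z) < e))"

section \<open>Oriented lines and reflections\<close>

text \<open>An oriented line is the pair of its set of points and its unit directing vector.\<close>

type_synonym 'e oriented_line = "'e set \<times> 'e"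

definition oline :: "'e::euclidean_space \<Rightarrow> 'e \<Rightarrow> 'e oriented_line" where
  "oline p u = (range (\<lambda>t. p + t *\<^sub>R u), u)"

definition lines_through :: "'e::euclidean_space \<Rightarrow> 'e oriented_line set" where
  "lines_through p = {oline p u | u. norm u = 1}"

definition unit_normal ::
    "('d::euclidean_space \<Rightarrow> 'e::euclidean_space) \<Rightarrow> 'd \<Rightarrow> 'e \<Rightarrow> bool" where
  "unit_normal \<psi> s n \<longleftrightarrow> norm n = 1 \<and> (\<forall>a. frechet_derivative \<psi> (at s) a \<bullet> n = 0)"

text \<open>Reflection of a line through \<open>\<psi> s\<close> from the hypersurface parametrized by \<open>\<psi>\<close>. The formula
  does not depend on which of the two unit normals is selected.\<close>

definition reflect_at ::
    "('d::euclidean_space \<Rightarrow> 'e::euclidean_space) \<Rightarrow> 'd \<Rightarrow> 'e oriented_line \<Rightarrow> 'e oriented_line" where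
  "reflect_at \<psi> s L = (let u = snd L; n = (SOME n. unit_normal \<psi> s n) in
     oline (\<psi> s) (u - (2 * (u \<bullet> n)) *\<^sub>R n))"

section \<open>Hypersurfaces and their deformations\<close>

text \<open>\<open>\<phi>\<close> parametrizes \<open>\<gamma>\<close> by the domain \<open>D\<close>; \<open>N\<close> is a unit normal field, used at points of \<open>\<gamma>\<close>
  only; \<open>\<iota>\<close> selects the coordinates spanning the coordinate subspace to which all tangent
  spaces of \<open>\<gamma>\<close> are projected.\<close>

locale parametrized_hypersurface =
  fixes D :: "(real^'n) set"
    and \<phi> :: "real^'n \<Rightarrow> real^'m"
    and N :: "real^'m \<Rightarrow> real^'m"
    and \<iota> :: "'n \<Rightarrow> 'm"
  assumes codim_one: "CARD('m) = CARD('n) + 1"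
    and domain: "contractible_domain D"
    and smooth_param: "smooth_on D \<phi>"
    and immersion: "\<And>s. s \<in> D \<Longrightarrow> inj (frechet_derivative \<phi> (at s))"
    and embedding: "\<exists>g. homeomorphism D (\<phi> ` D) \<phi> g"
    and smooth_normal: "smooth_on D (\<lambda>s. N (\<phi> s))"
    and normal: "\<And>s. s \<in> D \<Longrightarrow> unit_normal \<phi> s (N (\<phi> s))"
    and inj_coords: "inj \<iota>"
    and tangent_proj: "\<And>s. s \<in> D \<Longrightarrow>
      inj_on (\<lambda>v. \<chi> i. v $ \<iota> i) (range (frechet_derivative \<phi> (at s)))"
begin

definition \<gamma> :: "(real^'m) set" where
  "\<gamma> = \<phi> ` D"

definition smooth_functions :: "(real^'m \<Rightarrow> real) set" where
  "smooth_functions = {f. smooth_on D (\<lambda>s. f (\<phi> s))}"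

definition param :: "real^'m \<Rightarrow> real^'n" where
  "param = the_inv_into D \<phi>"

definition base_point :: "(real^'m) oriented_line \<Rightarrow> real^'m" where
  "base_point L = (THE x. x \<in> \<gamma> \<inter> fst L)"

definition tangential_part :: "(real^'m) oriented_line \<Rightarrow> real^'m" where
  "tangential_part L = snd L - (snd L \<bullet> N (base_point L)) *\<^sub>R N (base_point L)"

text \<open>The map \<open>L \<mapsto> (x, w)\<close>, with \<open>x \<in> \<gamma>\<close> read in the parametrization and \<open>w \<in> T\<^sub>x\<gamma>\<close> projected
  to the coordinate subspace.\<close>

definition coords :: "(real^'m) oriented_line \<Rightarrow> (real^'n) \<times> (real^'n)" where
  "coords L = (param (base_point L), \<chi> i. tangential_part L $ \<iota> i)"

definition deform :: "(real^'m \<Rightarrow> real) \<Rightarrow> real \<Rightarrow> real^'n \<Rightarrow> real^'m" where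
  "deform f \<epsilon> s = \<phi> s + (\<epsilon> * f (\<phi> s)) *\<^sub>R N (\<phi> s)"

definition reflection :: "(real^'m) oriented_line \<Rightarrow> (real^'m) oriented_line" where
  "reflection L = reflect_at \<phi> (param (base_point L)) L"

text \<open>The parameter of the intersection point of a line \<open>M\<close> with the deformed hypersurface
  that is close to \<open>x \<in> \<gamma>\<close>. Closeness is measured on \<open>\<gamma>\<close>, that is, by the point which is displaced
  by the deformation: \<open>f\<close> may be unbounded, so that parts of the deformed hypersurface coming
  from far away points of \<open>\<gamma>\<close> may pass near \<open>x\<close> for every \<open>\<epsilon> \<noteq> 0\<close>. For transversal \<open>M\<close> through \<open>x\<close>
  and small \<open>\<epsilon>\<close> the minimizer exists and is unique.\<close>

definition near_hit ::
    "(real^'m \<Rightarrow> real) \<Rightarrow> real \<Rightarrow> real^'m \<Rightarrow> (real^'m) oriented_line \<Rightarrow> real^'n" where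
  "near_hit f \<epsilon> x M = (ARG_MIN (\<lambda>s. dist (\<phi> s) x) s. s \<in> D \<and> deform f \<epsilon> s \<in> fst M)"

text \<open>The inverse of the reflection from the deformed hypersurface, composed with the
  reflection from \<open>\<gamma>\<close>.\<close>

definition \<Delta>T ::
    "(real^'m \<Rightarrow> real) \<Rightarrow> real \<Rightarrow> (real^'m) oriented_line \<Rightarrow> (real^'m) oriented_line" where
  "\<Delta>T f \<epsilon> L = (let M = reflection L; s = near_hit f \<epsilon> (base_point L) M in
     the_inv_into (lines_through (deform f \<epsilon> s)) (reflect_at (deform f \<epsilon>) s) M)"

end

section \<open>Domains in the space of oriented lines\<close>

text \<open>Positivity of the scalar products with \<open>N\<close> includes transversality of the intersections.
  By transversality, \<open>(x, w) \<mapsto> L\<close> is a local diffeomorphism, and it is injective on the lines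
  of \<open>P\<close>. Thus, if the set of coordinates of the lines of \<open>P\<close> is open, then \<open>P\<close> is open in the
  space of oriented lines and \<open>coords\<close> is a diffeomorphism on \<open>P\<close>. Vector fields
  and forms on \<open>P\<close> are represented in the global chart \<open>coords\<close>.\<close>

locale line_domain = parametrized_hypersurface D \<phi> N \<iota>
  for D :: "(real^'n) set"
    and \<phi> :: "real^'n \<Rightarrow> real^'m"
    and N :: "real^'m \<Rightarrow> real^'m"
    and \<iota> :: "'n \<Rightarrow> 'm" +
  fixes P :: "(real^'m) oriented_line set"
  assumes lines: "P \<subseteq> {oline p u | p u. norm u = 1}"
    and one_point: "\<And>L. L \<in> P \<Longrightarrow> \<exists>!x. x \<in> \<gamma> \<inter> fst L"
    and transversal: "\<And>L. L \<in> P \<Longrightarrow> snd L \<bullet> N (base_point L) > 0"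
    and chart_domain: "contractible_domain (coords ` P)"
begin

definition line_of :: "(real^'n) \<times> (real^'n) \<Rightarrow> (real^'m) oriented_line" where
  "line_of = the_inv_into P coords"

text \<open>\<open>\<alpha>(v) = \<langle>w, \<pi>\<^sub>*v\<rangle>\<close>; in the chart, \<open>\<pi>\<close> is \<open>z \<mapsto> \<phi> (fst z)\<close>.\<close>

definition \<alpha> :: "(real^'n) \<times> (real^'n) \<Rightarrow> (real^'n) \<times> (real^'n) \<Rightarrow> real" where
  "\<alpha> z v = tangential_part (line_of z) \<bullet> frechet_derivative \<phi> (at (fst z)) (fst v)"

definition \<omega> ::
    "(real^'n) \<times> (real^'n) \<Rightarrow> (real^'n) \<times> (real^'n) \<Rightarrow> (real^'n) \<times> (real^'n) \<Rightarrow> real" where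
  "\<omega> = ext_deriv \<alpha>"

definition v :: "(real^'m \<Rightarrow> real) \<Rightarrow> (real^'n) \<times> (real^'n) \<Rightarrow> (real^'n) \<times> (real^'n)" where
  "v f z = vector_derivative (\<lambda>\<epsilon>. coords (\<Delta>T f \<epsilon> (line_of z))) (at 0)"

definition chart_image :: "((real^'n) \<times> (real^'n)) set" where
  "chart_image = coords ` P"

end

end

theory Submission
  imports Defs
begin

text \<open>
  In the chart \<open>z = (s, w)\<close> the form is \<open>\<omega> = d\<langle>W, d\<phi>\<rangle>\<close>, where \<open>W\<close> is the tangential part of the unit
  direction, and \<open>v f\<close> is the Hamiltonian field of \<open>- 2 f R\<close> with \<open>R = sqrt (1 - \<bar>W\<bar>\<^sup>2)\<close>, the normal
  component of the direction (\<open>v_hamiltonian\<close>). This is a pointwise computation at \<open>\<epsilon> = 0\<close>: the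
  implicit function theorem gives the intersection points and their rates, and a linear system
  gives the normals of the deformed hypersurfaces (\<open>reflected_curve\<close>).

  The bracket of the Hamiltonian fields of \<open>F\<close> and \<open>G\<close> has the Hamiltonian \<open>{F, G} = dG(X\<^sub>F)\<close>
  (\<open>lie_bracket_hamiltonian\<close>), and \<open>F \<mapsto> X\<^sub>F\<close> is a differential operator of first order. Therefore it
  is enough to approximate every smooth function on every compact set, with all derivatives, by
  functions from the Poisson algebra generated by the products \<open>b R\<close> with \<open>b\<close> a function of \<open>s\<close>.

  Let \<open>\<M>\<close> consist of the functions \<open>X\<close> all of whose multiples \<open>b X\<close> are limits of elements of this
  algebra. Functions of \<open>s\<close> commute and their Hamiltonian fields span the fibre directions, so the
  identity \<open>a {b, X Y} = {a b X, Y} - {a X, b Y}\<close> yields the one rule that drives the proof: if \<open>X\<close> and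
  \<open>Y\<close> belong to \<open>\<M>\<close>, then so do the fibre derivatives \<open>d\<^sub>j (X Y)\<close>. Write \<open>Q = R\<^sup>2\<close>, a quadratic
  polynomial on each fibre, and \<open>y\<^sub>l\<close> for the fibre coordinates.
  \<^item> \<open>d\<^sub>j (R R)\<close> is linear on the fibres, hence \<open>y\<^sub>l \<in> \<M>\<close>, and then \<open>y\<^sub>l d\<^sub>j X \<in> \<M>\<close> for \<open>X \<in> \<M>\<close>.
  \<^item> Applied to powers of \<open>R\<close>, this puts all odd powers \<open>R, 1/R, 1/R\<^sup>3, ...\<close> and the products
    \<open>y\<^sub>l y\<^sub>m / R, y\<^sub>l y\<^sub>m / R\<^sup>3, ...\<close> into \<open>\<M>\<close> (\<open>Qp_\<M>\<close>).
  \<^item> Real powers of \<open>Q\<close> are limits of polynomials in \<open>1 / Q\<close>, so \<open>1\<close> and \<open>y\<^sub>l y\<^sub>m\<close> belong to \<open>\<M>\<close>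
    (\<open>\<M>_powr_limit\<close>).
  \<^item> By Euler's identity \<open>\<Sum>j. d\<^sub>j (y\<^sub>j y\<^sub>l m)\<close> is a nonzero multiple of \<open>y\<^sub>l m\<close> for a monomial \<open>m\<close>, and all
    monomials follow (\<open>monomial_\<M>\<close>).

  Thus all polynomials in \<open>(s, w)\<close> are limits, and polynomials are dense in the smooth functions
  together with all derivatives (\<open>smooth_polynomial_approximation\<close>: multiply with a cutoff and
  convolve with polynomial kernels).
\<close>

section \<open>Calculus of smooth maps\<close>

text \<open>Finite orders of smoothness make induction on the order available.\<close>

definition smooth_upto :: "nat \<Rightarrow> 'a::euclidean_space set \<Rightarrow> ('a \<Rightarrow> 'b::euclidean_space) \<Rightarrow> bool" where
  "smooth_upto k U F \<longleftrightarrow> (\<forall>vs. length vs \<le> k \<longrightarrow> (\<forall>x\<in>U. iter_deriv vs F differentiable (at x)))"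

lemma smooth_on_iff_upto: "smooth_on U F \<longleftrightarrow> (\<forall>k. smooth_upto k U F)"
  unfolding smooth_on_def smooth_upto_def by blast

lemma iter_deriv_append: "iter_deriv (vs @ ws) F = iter_deriv vs (iter_deriv ws F)"
  by (induction vs) auto

lemma frechet_derivative_eqI: "(F has_derivative F') (at x) \<Longrightarrow> frechet_derivative F (at x) = F'"
  by (metis frechet_derivative_at)

lemma differentiable_has_frechet:
  "F differentiable (at x) \<Longrightarrow> (F has_derivative frechet_derivative F (at x)) (at x)"
  by (simp add: frechet_derivative_works)

lemma frechet_derivative_cong_open:
  fixes F G :: "'a::euclidean_space \<Rightarrow> 'b::real_normed_vector"
  assumes "open U" "x \<in> U" "\<And>y. y \<in> U \<Longrightarrow> F y = G y"
  shows "frechet_derivative F (at x) = frechet_derivative G (at x)"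
proof -
  have "(F has_derivative D) (at x) \<longleftrightarrow> (G has_derivative D) (at x)" for D
    using assms has_derivative_transform_within_open[of F D x UNIV U G]
      has_derivative_transform_within_open[of G D x UNIV U F] by auto
  then show ?thesis by (simp add: frechet_derivative_def)
qed

lemma differentiable_cong_open:
  fixes F G :: "'a::euclidean_space \<Rightarrow> 'b::real_normed_vector"
  assumes "open U" "x \<in> U" "\<And>y. y \<in> U \<Longrightarrow> F y = G y" "F differentiable (at x)"
  shows "G differentiable (at x)"
  using assms has_derivative_transform_within_open[of F _ x UNIV U G]
  unfolding differentiable_def by blast

lemma iter_deriv_cong_open:
  assumes "open U" "\<And>y. y \<in> U \<Longrightarrow> F y = G y" "x \<in> U"
  shows "iter_deriv vs F x = iter_deriv vs G x"
  using assms(3)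
proof (induction vs arbitrary: x)
  case (Cons v vs)
  then show ?case
    using frechet_derivative_cong_open[OF assms(1), of x "iter_deriv vs F" "iter_deriv vs G"] by simp
qed (use assms in auto)

lemma smooth_upto_cong:
  assumes "open U" "\<And>y. y \<in> U \<Longrightarrow> F y = G y" "smooth_upto k U F"
  shows "smooth_upto k U G"
  unfolding smooth_upto_def
proof (intro allI impI ballI)
  fix vs x assume *: "length (vs::'a list) \<le> k" "x \<in> U"
  show "iter_deriv vs G differentiable (at x)"
    by (rule differentiable_cong_open[OF assms(1) *(2), of "iter_deriv vs F"])
      (use * assms in \<open>auto simp: smooth_upto_def intro: iter_deriv_cong_open[OF assms(1,2)]\<close>)
qed

lemma smooth_upto_0: "smooth_upto 0 U F \<longleftrightarrow> (\<forall>x\<in>U. F differentiable (at x))"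
  by (simp add: smooth_upto_def)

text \<open>The recursion splits off the derivative that is taken first, the last element of the list, so an
  induction hypothesis about all maps applies to the partial derivatives.\<close>

lemma smooth_upto_Suc:
  "smooth_upto (Suc k) U F \<longleftrightarrow>
    (\<forall>x\<in>U. F differentiable (at x)) \<and> (\<forall>v. smooth_upto k U (\<lambda>x. frechet_derivative F (at x) v))"
    (is "?L \<longleftrightarrow> ?R")
proof
  assume L: ?L
  have "iter_deriv vs (\<lambda>x. frechet_derivative F (at x) v) = iter_deriv (vs @ [v]) F" for vs v
    by (simp add: iter_deriv_append)
  moreover from L have "length vs \<le> k \<Longrightarrow> x \<in> U \<Longrightarrow> iter_deriv (vs @ [v]) F differentiable (at x)" for vs v x
    unfolding smooth_upto_def by (metis Suc_le_mono length_append_singleton)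
  moreover have "\<forall>x\<in>U. F differentiable (at x)"
    using L unfolding smooth_upto_def by (metis iter_deriv.simps(1) list.size(3) zero_le)
  ultimately show ?R unfolding smooth_upto_def by simp
next
  assume R: ?R
  show ?L unfolding smooth_upto_def
  proof (intro allI impI ballI)
    fix vs x assume len: "length (vs::'a list) \<le> Suc k" and x: "x \<in> U"
    show "iter_deriv vs F differentiable (at x)"
    proof (cases vs rule: rev_cases)
      case Nil then show ?thesis using R x by simp
    next
      case (snoc ys y)
      then show ?thesis using R x len unfolding smooth_upto_def by (simp add: iter_deriv_append)
    qed
  qed
qed

lemma smooth_upto_mono: "smooth_upto l U F \<Longrightarrow> k \<le> l \<Longrightarrow> V \<subseteq> U \<Longrightarrow> smooth_upto k V F"
  unfolding smooth_upto_def by (meson in_mono order.trans)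

lemma smooth_upto_differentiable: "smooth_upto k U F \<Longrightarrow> x \<in> U \<Longrightarrow> F differentiable (at x)"
  by (metis smooth_upto_0 smooth_upto_mono le0 order_refl)

lemma smooth_upto_SucI:
  assumes "open U" "\<And>x. x \<in> U \<Longrightarrow> (F has_derivative F' x) (at x)"
    "\<And>v. smooth_upto k U (\<lambda>x. F' x v)"
  shows "smooth_upto (Suc k) U F"
  unfolding smooth_upto_Suc
proof safe
  show "x \<in> U \<Longrightarrow> F differentiable (at x)" for x using assms(2) differentiable_def by blast
  show "smooth_upto k U (\<lambda>x. frechet_derivative F (at x) v)" for v
    by (rule smooth_upto_cong[OF assms(1) _ assms(3)[of v]]) (simp add: frechet_derivative_eqI[OF assms(2)])
qed

lemma smooth_upto_const [simp]: "smooth_upto k U (\<lambda>x. c)"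
  by (induction k arbitrary: c) (auto simp: smooth_upto_0 smooth_upto_Suc)

lemma smooth_upto_bounded_linear:
  assumes "bounded_linear F" shows "smooth_upto k U F"
proof -
  have "smooth_upto k UNIV F"
  proof (cases k)
    case 0
    then show ?thesis using bounded_linear_imp_differentiable[OF assms] smooth_upto_0 by auto
  next
    case (Suc l)
    show ?thesis unfolding Suc
      by (rule smooth_upto_SucI[where F'="\<lambda>x. F"]) (auto intro: bounded_linear_imp_has_derivative[OF assms])
  qed
  then show ?thesis using smooth_upto_mono[of k UNIV F k U] by simp
qed

lemma smooth_upto_add:
  assumes "open U" "smooth_upto k U F" "smooth_upto k U G"
  shows "smooth_upto k U (\<lambda>x. F x + G x)"
  using assms(2,3)
proof (induction k arbitrary: F G)
  case (Suc k)
  then show ?case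
    by (intro smooth_upto_SucI[OF assms(1), where F'="\<lambda>x v. frechet_derivative F (at x) v + frechet_derivative G (at x) v"])
      (auto simp: smooth_upto_Suc intro!: has_derivative_add differentiable_has_frechet)
qed (auto simp: smooth_upto_0)

lemma smooth_upto_sum:
  assumes "open U" "\<And>i. i \<in> I \<Longrightarrow> smooth_upto k U (F i)"
  shows "smooth_upto k U (\<lambda>x. \<Sum>i\<in>I. F i x)"
  using assms(2) by (induction I rule: infinite_finite_induct) (auto intro: smooth_upto_add[OF assms(1)])

lemma smooth_upto_bilinear:
  assumes "bounded_bilinear p" "open U" "smooth_upto k U F" "smooth_upto k U G"
  shows "smooth_upto k U (\<lambda>x. p (F x) (G x))"
  using assms(3,4)
proof (induction k arbitrary: F G)
  case 0
  then show ?case using bounded_bilinear.FDERIV[OF assms(1)] 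
    unfolding smooth_upto_0 differentiable_def by blast
next
  case (Suc k)
  show ?case
  proof (rule smooth_upto_SucI[OF assms(2),
    where F'="\<lambda>x v. p (F x) (frechet_derivative G (at x) v) + p (frechet_derivative F (at x) v) (G x)"])
    show "((\<lambda>x. p (F x) (G x)) has_derivative
          (\<lambda>v. p (F x) (frechet_derivative G (at x) v) + p (frechet_derivative F (at x) v) (G x))) (at x)"
      if "x \<in> U" for x
      using Suc.prems that
      by (intro bounded_bilinear.FDERIV[OF assms(1)] differentiable_has_frechet) (auto simp: smooth_upto_Suc)
    have "smooth_upto k U F" "smooth_upto k U G"
      using Suc.prems smooth_upto_mono[OF _ le_SucI[OF order_refl] order_refl] by auto
    then show "smooth_upto k U (\<lambda>x. p (F x) (frechet_derivative G (at x) v) + p (frechet_derivative F (at x) v) (G x))" for v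
      using Suc.prems by (intro smooth_upto_add[OF assms(2)] Suc.IH) (auto simp: smooth_upto_Suc)
  qed
qed

lemma smooth_upto_linear_comp:
  assumes "bounded_linear L" "open U" "smooth_upto k U F"
  shows "smooth_upto k U (\<lambda>x. L (F x))"
  using assms(3)
proof (induction k arbitrary: F)
  case 0
  then show ?case
    using bounded_linear.has_derivative[OF assms(1)] unfolding smooth_upto_0 differentiable_def by blast
next
  case (Suc k)
  then show ?case
    by (intro smooth_upto_SucI[OF assms(2), where F'="\<lambda>x v. L (frechet_derivative F (at x) v)"])
      (auto simp: smooth_upto_Suc intro!: bounded_linear.has_derivative[OF assms(1)] differentiable_has_frechet)
qed

lemma linear_basis_expansion:
  fixes L :: "'a::euclidean_space \<Rightarrow> 'b::real_vector"
  assumes "linear L" shows "L v = (\<Sum>b\<in>Basis. (v \<bullet> b) *\<^sub>R L b)"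
proof -
  have "L v = L (\<Sum>b\<in>Basis. (v \<bullet> b) *\<^sub>R b)" by (simp add: euclidean_representation)
  also have "\<dots> = (\<Sum>b\<in>Basis. (v \<bullet> b) *\<^sub>R L b)"
    by (simp add: linear_sum[OF assms] linear_scale[OF assms])
  finally show ?thesis .
qed

lemma frechet_derivative_compose_pt:
  assumes "F differentiable (at (G x))" "G differentiable (at x)"
  shows "((\<lambda>x. F (G x)) has_derivative
    (\<lambda>v. frechet_derivative F (at (G x)) (frechet_derivative G (at x) v))) (at x)"
  by (metis assms differentiable_has_frechet has_derivative_compose)

text \<open>The chain rule expresses each derivative as a finite sum of products in which the outer map
  occurs as a composition of one order less.\<close>

lemma smooth_upto_compose:
  fixes F :: "'b::euclidean_space \<Rightarrow> 'c::euclidean_space" and G :: "'a::euclidean_space \<Rightarrow> 'b"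
  assumes "open U" "open V" "smooth_upto k V F" "smooth_upto k U G" "\<And>x. x \<in> U \<Longrightarrow> G x \<in> V"
  shows "smooth_upto k U (\<lambda>x. F (G x))"
  using assms(3,4)
proof (induction k arbitrary: F)
  case 0
  then show ?case
    using frechet_derivative_compose_pt assms(5) unfolding smooth_upto_0 differentiable_def by blast
next
  case (Suc k)
  have diff: "F differentiable (at (G x))" "G differentiable (at x)" if "x \<in> U" for x
    using Suc.prems assms(5) that by (auto simp: smooth_upto_Suc)
  let ?F' = "\<lambda>x v. \<Sum>b\<in>Basis. (frechet_derivative G (at x) v \<bullet> b) *\<^sub>R frechet_derivative F (at (G x)) b"
  show ?case
  proof (rule smooth_upto_SucI[OF assms(1), where F'="?F'"])
    show "((\<lambda>x. F (G x)) has_derivative ?F' x) (at x)" if "x \<in> U" for x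
    proof -
      have "frechet_derivative F (at (G x)) (frechet_derivative G (at x) v) = ?F' x v" for v
        by (rule linear_basis_expansion[OF linear_frechet_derivative[OF diff(1)[OF that]]])
      then show ?thesis using frechet_derivative_compose_pt[OF diff[OF that]] by simp
    qed
    have "smooth_upto k U G" using Suc.prems smooth_upto_mono[OF _ le_SucI[OF order_refl] order_refl] by auto
    then show "smooth_upto k U (\<lambda>x. ?F' x v)" for v
      using Suc.prems
      by (intro smooth_upto_sum smooth_upto_bilinear[OF bounded_bilinear_scaleR] assms(1)
          smooth_upto_linear_comp[OF bounded_linear_inner_left] Suc.IH) (auto simp: smooth_upto_Suc)
  qed
qed

lemma smooth_on_cong: "open U \<Longrightarrow> (\<And>y. y \<in> U \<Longrightarrow> F y = G y) \<Longrightarrow> smooth_on U F \<Longrightarrow> smooth_on U G"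
  unfolding smooth_on_iff_upto by (intro allI, rule smooth_upto_cong[of U F G]) auto

lemma smooth_on_differentiable: "smooth_on U F \<Longrightarrow> x \<in> U \<Longrightarrow> F differentiable (at x)"
  unfolding smooth_on_iff_upto using smooth_upto_differentiable by blast

lemma smooth_on_has_derivative:
  "smooth_on U F \<Longrightarrow> x \<in> U \<Longrightarrow> (F has_derivative frechet_derivative F (at x)) (at x)"
  using smooth_on_differentiable differentiable_has_frechet by blast

lemma smooth_on_subset: "smooth_on U F \<Longrightarrow> V \<subseteq> U \<Longrightarrow> smooth_on V F"
  unfolding smooth_on_def by blast

lemma smooth_on_deriv: "smooth_on U F \<Longrightarrow> smooth_on U (\<lambda>x. frechet_derivative F (at x) v)"
  unfolding smooth_on_iff_upto using smooth_upto_Suc by blast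

lemma smooth_on_const [simp]: "smooth_on U (\<lambda>x. c)"
  unfolding smooth_on_iff_upto by simp

lemma smooth_on_bounded_linear: "bounded_linear F \<Longrightarrow> smooth_on U F"
  unfolding smooth_on_iff_upto using smooth_upto_bounded_linear by blast

lemma smooth_on_add: "open U \<Longrightarrow> smooth_on U F \<Longrightarrow> smooth_on U G \<Longrightarrow> smooth_on U (\<lambda>x. F x + G x)"
  unfolding smooth_on_iff_upto by (simp add: smooth_upto_add)

lemma smooth_on_sum:
  "open U \<Longrightarrow> (\<And>i. i \<in> I \<Longrightarrow> smooth_on U (F i)) \<Longrightarrow> smooth_on U (\<lambda>x. \<Sum>i\<in>I. F i x)"
  unfolding smooth_on_iff_upto by (simp add: smooth_upto_sum)

lemma smooth_on_bilinear:
  "bounded_bilinear p \<Longrightarrow> open U \<Longrightarrow> smooth_on U F \<Longrightarrow> smooth_on U G \<Longrightarrow> smooth_on U (\<lambda>x. p (F x) (G x))"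
  unfolding smooth_on_iff_upto by (simp add: smooth_upto_bilinear)

lemmas smooth_on_mult = smooth_on_bilinear[OF bounded_bilinear_mult[where ?'a=real]]
lemmas smooth_on_scaleR = smooth_on_bilinear[OF bounded_bilinear_scaleR]
lemmas smooth_on_inner = smooth_on_bilinear[OF bounded_bilinear_inner]

lemma smooth_on_linear_comp:
  "bounded_linear L \<Longrightarrow> open U \<Longrightarrow> smooth_on U F \<Longrightarrow> smooth_on U (\<lambda>x. L (F x))"
  unfolding smooth_on_iff_upto by (simp add: smooth_upto_linear_comp)

lemma smooth_on_minus: "open U \<Longrightarrow> smooth_on U F \<Longrightarrow> smooth_on U (\<lambda>x. - F x)"
  by (rule smooth_on_linear_comp[OF bounded_linear_minus[OF bounded_linear_ident]])

lemma smooth_on_diff: "open U \<Longrightarrow> smooth_on U F \<Longrightarrow> smooth_on U G \<Longrightarrow> smooth_on U (\<lambda>x. F x - G x)"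
  using smooth_on_add[of U F "\<lambda>x. - G x"] smooth_on_minus[of U G] by simp

lemma smooth_on_compose:
  "open U \<Longrightarrow> open V \<Longrightarrow> smooth_on V F \<Longrightarrow> smooth_on U G \<Longrightarrow> (\<And>x. x \<in> U \<Longrightarrow> G x \<in> V)
    \<Longrightarrow> smooth_on U (\<lambda>x. F (G x))"
  unfolding smooth_on_iff_upto by (intro allI, rule smooth_upto_compose) auto

lemma smooth_on_Pair:
  assumes "open U" "smooth_on U F" "smooth_on U G" shows "smooth_on U (\<lambda>x. (F x, G x))"
proof -
  have "bounded_linear (\<lambda>x. (x, 0))" "bounded_linear (\<lambda>x. (0, x))"
    by (auto intro: bounded_linear_intros)
  from smooth_on_linear_comp[OF this(1) assms(1,2)] smooth_on_linear_comp[OF this(2) assms(1,3)]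
  have "smooth_on U (\<lambda>x. (F x, 0) + (0, G x))" by (rule smooth_on_add[OF assms(1)])
  then show ?thesis by simp
qed

lemma smooth_on_fst: "open U \<Longrightarrow> open V \<Longrightarrow> smooth_on V F \<Longrightarrow> fst ` U \<subseteq> V \<Longrightarrow> smooth_on U (\<lambda>z. F (fst z))"
  by (rule smooth_on_compose[OF _ _ _ smooth_on_bounded_linear[OF bounded_linear_fst]]) auto

text \<open>The total derivative along a moving direction is a finite sum over a basis of partial
  derivatives, so it stays smooth.\<close>

lemma smooth_on_deriv_along:
  assumes "open U" "smooth_on U F" "smooth_on U Y"
  shows "smooth_on U (\<lambda>x. frechet_derivative F (at x) (Y x))"
proof (rule smooth_on_cong[OF assms(1)])
  show "smooth_on U (\<lambda>x. \<Sum>b\<in>Basis. (Y x \<bullet> b) *\<^sub>R frechet_derivative F (at x) b)"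
    by (intro smooth_on_sum smooth_on_scaleR smooth_on_inner assms smooth_on_const smooth_on_deriv)
  show "x \<in> U \<Longrightarrow> (\<Sum>b\<in>Basis. (Y x \<bullet> b) *\<^sub>R frechet_derivative F (at x) b) = frechet_derivative F (at x) (Y x)" for x
    using linear_basis_expansion[OF linear_frechet_derivative[OF smooth_on_differentiable[OF assms(2)]]] by metis
qed

lemma smooth_upto_real_SucI:
  fixes F :: "real \<Rightarrow> real"
  assumes "open U" "\<And>x. x \<in> U \<Longrightarrow> (F has_real_derivative F' x) (at x)" "smooth_upto k U F'"
  shows "smooth_upto (Suc k) U F"
proof (rule smooth_upto_SucI[OF assms(1), where F'="\<lambda>x v. F' x * v"])
  show "x \<in> U \<Longrightarrow> (F has_derivative (*) (F' x)) (at x)" for x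
    using assms(2) by (simp add: has_field_derivative_def)
  show "smooth_upto k U (\<lambda>x. F' x * v)" for v
    by (rule smooth_upto_linear_comp[OF bounded_linear_mult_left assms(1,3)])
qed

lemma smooth_on_powr: "smooth_on {0<..} (\<lambda>u::real. u powr a)"
proof -
  have "smooth_upto k {0<..} (\<lambda>u::real. c * u powr a)" for k c a
  proof (induction k arbitrary: a c)
    case 0
    show ?case unfolding smooth_upto_0 differentiable_def
      by (auto intro!: exI derivative_eq_intros)
  next
    case (Suc k)
    show ?case
      by (rule smooth_upto_real_SucI[OF _ _ Suc.IH[of "c * a" "a - 1"]])
        (auto intro!: derivative_eq_intros simp: powr_diff field_simps)
  qed
  from this[of _ 1] show ?thesis unfolding smooth_on_iff_upto by simp
qed

section \<open>Solutions of smooth families of linear equations\<close>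

text \<open>Only continuity is known for the first factor; the second factor is \<open>O(\<bar>x - z\<bar>)\<close>, so the product is
  \<open>o(\<bar>x - z\<bar>)\<close>.\<close>

lemma null_times_differentiable_null:
  fixes f :: "'a::euclidean_space \<Rightarrow> real" and h :: "'a \<Rightarrow> 'b::euclidean_space"
  assumes f: "(f \<longlongrightarrow> 0) (at z)" and h: "h differentiable (at z)" "h z = 0"
  shows "((\<lambda>x. f x *\<^sub>R h x) has_derivative (\<lambda>x. 0)) (at z)"
proof -
  obtain h' where h': "(h has_derivative h') (at z)" using h(1) differentiable_def by blast
  then have "bounded_linear h'" by (rule has_derivative_bounded_linear)
  then obtain B where B: "B > 0" "\<And>x. norm (h' x) \<le> norm x * B" using bounded_linear.pos_bounded by blast
  show ?thesis unfolding has_derivative_at_alt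
  proof (intro conjI allI impI)
    fix e :: real assume e: "e > 0"
    have "\<exists>d>0. \<forall>y. norm (y - z) < d \<longrightarrow> norm (h y - h z - h' (y - z)) \<le> 1 * norm (y - z)"
      using h' unfolding has_derivative_at_alt by (metis zero_less_one)
    then obtain d1 where d1: "d1 > 0" "\<And>y. norm (y - z) < d1 \<Longrightarrow> norm (h y - h z - h' (y - z)) \<le> 1 * norm (y - z)"
      by blast
    have "eventually (\<lambda>x. \<bar>f x\<bar> < e / (B + 1)) (at z)"
      using tendstoD[OF f, of "e / (B + 1)"] e B by simp
    then obtain d2 where d2: "d2 > 0" "\<And>y. y \<noteq> z \<Longrightarrow> dist y z < d2 \<Longrightarrow> \<bar>f y\<bar> < e / (B + 1)"
      unfolding eventually_at by blast
    show "\<exists>d>0. \<forall>y. norm (y - z) < d \<longrightarrow> norm (f y *\<^sub>R h y - f z *\<^sub>R h z - 0) \<le> e * norm (y - z)"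
    proof (intro exI[of _ "min d1 d2"] conjI allI impI)
      fix y assume y: "norm (y - z) < min d1 d2"
      show "norm (f y *\<^sub>R h y - f z *\<^sub>R h z - 0) \<le> e * norm (y - z)"
      proof (cases "y = z")
        case False
        have "norm (h y) \<le> norm (h' (y - z)) + norm (y - z)"
          using d1(2)[of y] y h(2) norm_triangle_sub[of "h y" "h' (y - z)"] by simp
        also have "\<dots> \<le> (B + 1) * norm (y - z)" using B(2)[of "y - z"] by (simp add: algebra_simps)
        finally have 1: "norm (h y) \<le> (B + 1) * norm (y - z)" .
        have "norm (f y *\<^sub>R h y) \<le> e / (B + 1) * ((B + 1) * norm (y - z))"
          unfolding norm_scaleR using d2(2)[of y] y False 1
          by (intro mult_mono) (auto simp: dist_norm less_imp_le)
        then show ?thesis using h(2) B by simp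
      qed (use h in simp)
    qed (use d1 d2 in auto)
  qed simp
qed

text \<open>With a left inverse \<open>S\<close> of \<open>T z0\<close>, the solution satisfies \<open>x z = x z0 + S (G z - E z)\<close>, where \<open>G\<close> is
  differentiable and \<open>E z = (T z - T z0) (x z - x z0)\<close>. First \<open>\<bar>x z - x z0\<bar> \<le> C \<bar>G z\<bar>\<close> shows
  continuity of \<open>x\<close>, and then \<open>E\<close> has derivative zero as a product of null functions.\<close>

lemma linear_system_solution_differentiable:
  fixes T :: "'z::euclidean_space \<Rightarrow> 'a::euclidean_space \<Rightarrow> 'b::euclidean_space"
  assumes V: "open V" "z0 \<in> V"
    and lin: "\<And>z. z \<in> V \<Longrightarrow> linear (T z)" and inj: "inj (T z0)"
    and T: "\<And>b. b \<in> Basis \<Longrightarrow> (\<lambda>z. T z b) differentiable (at z0)"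
    and y: "y differentiable (at z0)"
    and eq: "\<And>z. z \<in> V \<Longrightarrow> T z (x z) = y z"
  shows "x differentiable (at z0)"
proof -
  obtain S where S: "linear S" "S \<circ> T z0 = id"
    using linear_injective_left_inverse[OF lin[OF V(2)] inj] by blast
  then have blS: "bounded_linear S" using linear_conv_bounded_linear by blast
  then obtain B where B: "B > 0" "\<And>x. norm (S x) \<le> norm x * B" using bounded_linear.pos_bounded by blast
  define G where "G z = y z - (\<Sum>b\<in>Basis. (x z0 \<bullet> b) *\<^sub>R T z b)" for z
  define E where "E z = (\<Sum>b\<in>Basis. ((x z - x z0) \<bullet> b) *\<^sub>R (T z b - T z0 b))" for z
  have x_eq: "x z = x z0 + S (G z - E z)" if "z \<in> V" for z
  proof -
    have 1: "G z = T z (x z) - T z (x z0)"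
      using eq[OF that] linear_basis_expansion[OF lin[OF that], of "x z0"] unfolding G_def by simp
    have 2: "E z = T z (x z - x z0) - T z0 (x z - x z0)"
      unfolding linear_basis_expansion[OF lin[OF that], of "x z - x z0"]
        linear_basis_expansion[OF lin[OF V(2)], of "x z - x z0"] E_def
      by (simp add: sum_subtractf scaleR_diff_right)
    have "G z - E z = T z0 (x z - x z0)" unfolding 1 2 by (simp add: linear_diff[OF lin[OF that]])
    then show ?thesis using S(2) by (metis add_diff_cancel_left' comp_apply diff_add_cancel id_apply add.commute)
  qed
  have Gd: "G differentiable (at z0)" unfolding G_def using y T
    by (intro differentiable_diff differentiable_sum) auto
  have G0: "G z0 = 0" unfolding G_def
    using eq[OF V(2)] linear_basis_expansion[OF lin[OF V(2)], of "x z0"] by simp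
  have "((\<lambda>z. \<Sum>b\<in>Basis. norm (T z b - T z0 b)) \<longlongrightarrow> (\<Sum>b\<in>(Basis::'a set). norm (T z0 b - T z0 b))) (at z0)"
    using T differentiable_imp_continuous_within
    by (intro tendsto_intros) (auto simp: continuous_within)
  then have T0: "((\<lambda>z. \<Sum>b\<in>Basis. norm (T z b - T z0 b)) \<longlongrightarrow> 0) (at z0)" by simp
  have ev: "eventually (\<lambda>z. norm (x z - x z0) \<le> 2 * B * norm (G z)) (at z0)"
  proof -
    have "eventually (\<lambda>z. (\<Sum>b\<in>Basis. norm (T z b - T z0 b)) < 1 / (2 * B)) (at z0)"
      using order_tendstoD(2)[OF T0, of "1 / (2 * B)"] B by simp
    moreover have "eventually (\<lambda>z. z \<in> V) (at z0)" using V eventually_at_topological by blast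
    ultimately show ?thesis
    proof eventually_elim
      case (elim z)
      have "norm (E z) \<le> (\<Sum>b\<in>Basis. norm (x z - x z0) * norm (T z b - T z0 b))"
        unfolding E_def by (rule sum_norm_le) (auto intro!: mult_right_mono Basis_le_norm)
      also have "\<dots> = norm (x z - x z0) * (\<Sum>b\<in>Basis. norm (T z b - T z0 b))" by (simp add: sum_distrib_left)
      also have "\<dots> \<le> norm (x z - x z0) * (1 / (2 * B))"
        using elim(1) by (intro mult_left_mono) auto
      finally have E: "norm (E z) \<le> norm (x z - x z0) / (2 * B)" by simp
      have "norm (x z - x z0) \<le> norm (G z - E z) * B" using x_eq[OF elim(2)] B(2) by (metis add_diff_cancel_left')
      also have "\<dots> \<le> (norm (G z) + norm (x z - x z0) / (2 * B)) * B"
        using E B(1) norm_triangle_ineq4[of "G z" "E z"] by (intro mult_right_mono) auto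
      also have "\<dots> = norm (G z) * B + norm (x z - x z0) / 2" using B(1) by (simp add: field_simps)
      finally show ?case by (simp add: algebra_simps)
    qed
  qed
  have G_lim: "((\<lambda>z. 2 * B * norm (G z)) \<longlongrightarrow> 0) (at z0)"
  proof -
    have "(G \<longlongrightarrow> 0) (at z0)" using differentiable_imp_continuous_within[OF Gd] G0 by (simp add: continuous_within)
    then show ?thesis by (auto intro!: tendsto_eq_intros)
  qed
  have x_lim: "((\<lambda>z. x z - x z0) \<longlongrightarrow> 0) (at z0)"
    by (rule Lim_null_comparison[OF _ G_lim]) (use ev in simp)
  have "(E has_derivative (\<lambda>_. \<Sum>b\<in>(Basis::'a set). 0)) (at z0)" unfolding E_def
  proof (intro has_derivative_sum null_times_differentiable_null)
    fix b :: 'a assume b: "b \<in> Basis"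
    show "((\<lambda>z. (x z - x z0) \<bullet> b) \<longlongrightarrow> 0) (at z0)" using tendsto_inner[OF x_lim tendsto_const, of b] by simp
    show "(\<lambda>z. T z b - T z0 b) differentiable (at z0)" using T[OF b] by simp
  qed simp
  then have "E differentiable (at z0)" unfolding differentiable_def by blast
  then have "(\<lambda>z. x z0 + S (G z - E z)) differentiable (at z0)"
  proof -
    assume "E differentiable (at z0)"
    then obtain E' G' where "(E has_derivative E') (at z0)" "(G has_derivative G') (at z0)"
      using Gd unfolding differentiable_def by blast
    then have "((\<lambda>z. x z0 + S (G z - E z)) has_derivative (\<lambda>v. 0 + S (G' v - E' v))) (at z0)"
      by (intro has_derivative_add has_derivative_const bounded_linear.has_derivative[OF blS] has_derivative_diff)
    then show ?thesis unfolding differentiable_def by blast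
  qed
  then show ?thesis by (rule differentiable_cong_open[OF V, rotated]) (simp add: x_eq)
qed

text \<open>A partial derivative of the solution solves a system with the same matrix, namely
  \<open>T (D x) = D y - (D T) x\<close>.\<close>

lemma smooth_upto_linear_system_solution:
  fixes T :: "'z::euclidean_space \<Rightarrow> 'a::euclidean_space \<Rightarrow> 'b::euclidean_space"
  assumes U: "open U"
    and lin: "\<And>z. z \<in> U \<Longrightarrow> linear (T z)" and inj: "\<And>z. z \<in> U \<Longrightarrow> inj (T z)"
    and T: "\<And>b. b \<in> Basis \<Longrightarrow> smooth_upto k U (\<lambda>z. T z b)"
    and y: "smooth_upto k U y"
    and eq: "\<And>z. z \<in> U \<Longrightarrow> T z (x z) = y z"
  shows "smooth_upto k U x"
  using T y eq
proof (induction k arbitrary: x y)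
  case 0
  then show ?case unfolding smooth_upto_0
    by (intro ballI linear_system_solution_differentiable[OF U _ lin inj, where y=y and x=x]) auto
next
  case (Suc k)
  have down: "smooth_upto k U F" if "smooth_upto (Suc k) U F" for F :: "'z \<Rightarrow> 'b"
    using that by (rule smooth_upto_mono) auto
  have sy: "smooth_upto k U (\<lambda>z. frechet_derivative y (at z) v)" for v
    using Suc.prems(2) smooth_upto_Suc by blast
  have xk: "smooth_upto k U x" using Suc.IH[OF down down Suc.prems(3)] Suc.prems by blast
  have diff: "x differentiable (at z)" if "z \<in> U" for z
    by (rule linear_system_solution_differentiable[OF U that lin inj, where y=y and x=x])
      (use that Suc.prems in \<open>auto intro: smooth_upto_differentiable\<close>)
  show ?case unfolding smooth_upto_Suc
  proof safe
    show "z \<in> U \<Longrightarrow> x differentiable (at z)" for z by (rule diff)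
    fix v
    let ?y = "\<lambda>z. frechet_derivative y (at z) v - (\<Sum>b\<in>Basis. (x z \<bullet> b) *\<^sub>R frechet_derivative (\<lambda>z. T z b) (at z) v)"
    have "smooth_upto k U (\<lambda>z. \<Sum>b\<in>Basis. (x z \<bullet> b) *\<^sub>R frechet_derivative (\<lambda>z. T z b) (at z) v)"
      using Suc.prems xk
      by (intro smooth_upto_sum smooth_upto_bilinear[OF bounded_bilinear_scaleR] U
          smooth_upto_linear_comp[OF bounded_linear_inner_left]) (auto simp: smooth_upto_Suc)
    then have sm: "smooth_upto k U ?y"
      using smooth_upto_add[OF U sy[of v] smooth_upto_linear_comp[OF bounded_linear_minus[OF bounded_linear_ident] U]]
      by simp
    show "smooth_upto k U (\<lambda>z. frechet_derivative x (at z) v)"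
    proof (rule Suc.IH[OF down sm])
      show "b \<in> Basis \<Longrightarrow> smooth_upto (Suc k) U (\<lambda>z. T z b)" for b using Suc.prems by blast
      fix z assume z: "z \<in> U"
      have 1: "((\<lambda>z. \<Sum>b\<in>Basis. (x z \<bullet> b) *\<^sub>R T z b) has_derivative
        (\<lambda>v. \<Sum>b\<in>Basis. (x z \<bullet> b) *\<^sub>R frechet_derivative (\<lambda>z. T z b) (at z) v
            + (frechet_derivative x (at z) v \<bullet> b) *\<^sub>R T z b)) (at z)"
        using diff[OF z] Suc.prems(1) z smooth_upto_differentiable
        by (intro has_derivative_sum has_derivative_scaleR has_derivative_inner_left differentiable_has_frechet) blast+
      have 2: "(\<Sum>b\<in>Basis. (x z \<bullet> b) *\<^sub>R T z b) = y z" if "z \<in> U" for z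
        using linear_basis_expansion[OF lin[OF that], of "x z"] Suc.prems(3)[OF that] by simp
      have "frechet_derivative y (at z) v = (\<Sum>b\<in>Basis. (x z \<bullet> b) *\<^sub>R frechet_derivative (\<lambda>z. T z b) (at z) v
            + (frechet_derivative x (at z) v \<bullet> b) *\<^sub>R T z b)"
        using frechet_derivative_eqI[OF 1] frechet_derivative_cong_open[OF U z 2] by simp
      then show "T z (frechet_derivative x (at z) v) = ?y z"
        using linear_basis_expansion[OF lin[OF z], of "frechet_derivative x (at z) v"]
        by (simp add: sum.distrib)
    qed
  qed
qed

lemma smooth_on_linear_system_solution:
  fixes T :: "'z::euclidean_space \<Rightarrow> 'a::euclidean_space \<Rightarrow> 'b::euclidean_space"
  assumes "open U" "\<And>z. z \<in> U \<Longrightarrow> linear (T z)" "\<And>z. z \<in> U \<Longrightarrow> inj (T z)"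
    and "\<And>b. b \<in> Basis \<Longrightarrow> smooth_on U (\<lambda>z. T z b)" "smooth_on U y"
    and "\<And>z. z \<in> U \<Longrightarrow> T z (x z) = y z"
  shows "smooth_on U x"
  unfolding smooth_on_iff_upto
proof
  show "smooth_upto k U x" for k
    by (rule smooth_upto_linear_system_solution[where T=T and y=y])
      (use assms in \<open>auto simp: smooth_on_iff_upto\<close>)
qed

section \<open>Cutoff functions\<close>

text \<open>Cutoffs of finite order suffice, so powers of the positive part serve instead of the
  usual \<open>exp (- 1 / t)\<close>.\<close>

definition ramp :: "nat \<Rightarrow> real \<Rightarrow> real" where
  "ramp m t = (max 0 t) ^ m"

lemma ramp_has_derivative:
  "(ramp (Suc (Suc m)) has_real_derivative real (Suc (Suc m)) * ramp (Suc m) t) (at t)"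
proof -
  consider "t < 0" | "t > 0" | "t = 0" by linarith
  then show ?thesis
  proof cases
    case 1
    have "((\<lambda>_. 0) has_real_derivative 0) (at t)" by simp
    then have "(ramp (Suc (Suc m)) has_real_derivative 0) (at t)"
      by (rule has_field_derivative_transform_within_open[of _ _ _ "{..<0}"]) (use 1 in \<open>auto simp: ramp_def max_def\<close>)
    then show ?thesis using 1 by (simp add: ramp_def max_def)
  next
    case 2
    have "((\<lambda>t. t ^ (Suc (Suc m))) has_real_derivative real (Suc (Suc m)) * t ^ Suc m) (at t)"
      using DERIV_pow[of "Suc (Suc m)" t UNIV] by (simp only: diff_Suc_Suc minus_nat.diff_0)
    then have "(ramp (Suc (Suc m)) has_real_derivative real (Suc (Suc m)) * t ^ Suc m) (at t)"
      by (rule has_field_derivative_transform_within_open[of _ _ _ "{0<..}"]) (use 2 in \<open>auto simp: ramp_def max_def\<close>)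
    then show ?thesis using 2 by (simp add: ramp_def max_def)
  next
    case 3
    have "((\<lambda>h. (ramp (Suc (Suc m)) (0 + h) - ramp (Suc (Suc m)) 0) / h) \<longlongrightarrow> 0) (at 0)"
    proof (rule Lim_null_comparison)
      show "eventually (\<lambda>h. norm ((ramp (Suc (Suc m)) (0 + h) - ramp (Suc (Suc m)) 0) / h) \<le> \<bar>h\<bar> ^ Suc m) (at 0)"
      proof (rule always_eventually, rule allI)
        fix h :: real
        have "norm (ramp (Suc (Suc m)) h) \<le> \<bar>h\<bar> ^ Suc (Suc m)"
          unfolding ramp_def norm_power by (rule power_mono) auto
        then have "norm (ramp (Suc (Suc m)) h) / \<bar>h\<bar> \<le> \<bar>h\<bar> ^ Suc (Suc m) / \<bar>h\<bar>"
          by (rule divide_right_mono) simp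
        then show "norm ((ramp (Suc (Suc m)) (0 + h) - ramp (Suc (Suc m)) 0) / h) \<le> \<bar>h\<bar> ^ Suc m"
          by (cases "h = 0") (simp_all add: ramp_def)
      qed
      show "((\<lambda>h::real. \<bar>h\<bar> ^ Suc m) \<longlongrightarrow> 0) (at 0)" by (auto intro!: tendsto_eq_intros)
    qed
    then show ?thesis unfolding 3 DERIV_def by (simp add: ramp_def)
  qed
qed

lemma smooth_upto_ramp: "smooth_upto k UNIV (ramp (k + 2))"
proof (induction k)
  case 0
  show ?case unfolding smooth_upto_0 differentiable_def
    using ramp_has_derivative[of 0] has_field_derivative_imp_has_derivative by (fastforce simp: numeral_2_eq_2)
next
  case (Suc k)
  show ?case
    by (rule smooth_upto_real_SucI[where F'="\<lambda>t. real (Suc (Suc (Suc k))) * ramp (k + 2) t"])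
      (use ramp_has_derivative[of "Suc k"] smooth_upto_linear_comp[OF bounded_linear_mult_right _ Suc] in \<open>auto simp: numeral_2_eq_2\<close>)
qed

text \<open>The function \<open>u = \<bar>z - x\<bar>\<^sup>2 / r\<^sup>2 - 1\<close> is nonpositive on the ball and at least \<open>3\<close> off the ball of
  twice the radius; \<open>ramp (1 - ramp u)\<close> is \<open>1\<close> where \<open>u \<le> 0\<close> and \<open>0\<close> where \<open>u \<ge> 1\<close>.\<close>

lemma smooth_upto_ball_bump:
  fixes x :: "'a::euclidean_space"
  assumes "r > 0"
  shows "\<exists>\<rho>. smooth_upto k UNIV \<rho> \<and> (\<forall>z\<in>ball x r. \<rho> z = (1::real)) \<and> (\<forall>z. z \<notin> cball x (2 * r) \<longrightarrow> \<rho> z = 0)"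
proof -
  define u where "u z = (1 / r\<^sup>2) * ((z - x) \<bullet> (z - x)) + (- 1)" for z
  define \<rho> where "\<rho> z = ramp (k + 2) (1 + (- 1) * ramp (k + 2) (u z))" for z
  have zx: "smooth_upto k UNIV (\<lambda>z. z + - x)"
    by (intro smooth_upto_add smooth_upto_const smooth_upto_bounded_linear) (auto intro: bounded_linear_intros)
  have "smooth_upto k UNIV u" unfolding u_def
    using smooth_upto_bilinear[OF bounded_bilinear_inner open_UNIV zx zx]
    by (intro smooth_upto_add smooth_upto_linear_comp[OF bounded_linear_mult_right]) auto
  then have "smooth_upto k UNIV (\<lambda>z. ramp (k + 2) (u z))"
    by (rule smooth_upto_compose[OF open_UNIV open_UNIV smooth_upto_ramp]) auto
  then have "smooth_upto k UNIV (\<lambda>z. 1 + (- 1) * ramp (k + 2) (u z))"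
    by (intro smooth_upto_add smooth_upto_const smooth_upto_linear_comp[OF bounded_linear_mult_right] open_UNIV)
  then have "smooth_upto k UNIV \<rho>" unfolding \<rho>_def
    by (rule smooth_upto_compose[OF open_UNIV open_UNIV smooth_upto_ramp]) auto
  moreover have u: "u z = (norm (z - x) / r)\<^sup>2 - 1" for z
    by (simp add: u_def power_divide power2_norm_eq_inner)
  have "\<rho> z = 1" if "z \<in> ball x r" for z
  proof -
    have "norm (z - x) / r \<le> 1" using that assms by (simp add: dist_norm norm_minus_commute)
    then have "u z \<le> 0" unfolding u using assms by (simp add: power_le_one)
    then show ?thesis by (simp add: \<rho>_def ramp_def max_def)
  qed
  moreover have "\<rho> z = 0" if "z \<notin> cball x (2 * r)" for z
  proof -
    have "norm (z - x) / r \<ge> 2" using that assms by (simp add: dist_norm norm_minus_commute field_simps)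
    then have "(norm (z - x) / r)\<^sup>2 \<ge> 2\<^sup>2" by (intro power_mono) auto
    then have "u z \<ge> 1" unfolding u by simp
    then have "1 \<le> ramp (k + 2) (u z)" unfolding ramp_def by (intro one_le_power) auto
    then show ?thesis by (simp add: \<rho>_def ramp_def max_def)
  qed
  ultimately show ?thesis by blast
qed

text \<open>A finite cover by balls reduces the claim to the bumps above, which are combined by
  \<open>1 - (1 - \<theta>) (1 - \<rho>)\<close>.\<close>

lemma smooth_upto_cutoff:
  fixes U :: "'a::euclidean_space set"
  assumes "open U" "compact K" "K \<subseteq> U"
  obtains \<theta> V C where "smooth_upto k UNIV \<theta>" "open V" "K \<subseteq> V" "V \<subseteq> U" "compact C" "C \<subseteq> U"
    "\<And>z. z \<in> V \<Longrightarrow> \<theta> z = (1::real)" "\<And>z. z \<notin> C \<Longrightarrow> \<theta> z = 0"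
proof -
  have "\<exists>r>0. cball x (2 * r) \<subseteq> U" if x: "x \<in> K" for x
  proof -
    have "x \<in> U" using x assms by blast
    then obtain e where "e > 0" "cball x e \<subseteq> U" using assms(1) open_contains_cball by blast
    then show ?thesis by (intro exI[of _ "e / 2"]) auto
  qed
  then obtain r where r: "\<And>x. x \<in> K \<Longrightarrow> r x > 0 \<and> cball x (2 * r x) \<subseteq> U" by metis
  have "K \<subseteq> (\<Union>x\<in>K. ball x (r x))" using r by force
  then obtain F where F: "F \<subseteq> K" "finite F" "K \<subseteq> (\<Union>x\<in>F. ball x (r x))"
    using compactE_image[OF assms(2), of K "\<lambda>x. ball x (r x)"] by (metis open_ball)
  have "\<exists>\<theta>. smooth_upto k UNIV \<theta> \<and> (\<forall>z\<in>(\<Union>x\<in>F. ball x (r x)). \<theta> z = (1::real)) \<and>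
      (\<forall>z. z \<notin> (\<Union>x\<in>F. cball x (2 * r x)) \<longrightarrow> \<theta> z = 0)"
    using F(2,1)
  proof (induction F)
    case empty
    show ?case by (intro exI[of _ "\<lambda>_. 0"]) auto
  next
    case (insert x F)
    then obtain \<theta> where \<theta>: "smooth_upto k UNIV \<theta>" "\<And>z. z\<in>(\<Union>x\<in>F. ball x (r x)) \<Longrightarrow> \<theta> z = (1::real)"
      "\<And>z. z \<notin> (\<Union>x\<in>F. cball x (2 * r x)) \<Longrightarrow> \<theta> z = 0" by (metis insert_subset)
    obtain \<rho> where \<rho>: "smooth_upto k UNIV \<rho>" "\<And>z. z\<in>ball x (r x) \<Longrightarrow> \<rho> z = (1::real)"
      "\<And>z. z \<notin> cball x (2 * r x) \<Longrightarrow> \<rho> z = 0" using smooth_upto_ball_bump[of "r x" k x] r insert.prems by auto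
    have "smooth_upto k UNIV (\<lambda>z. \<theta> z + (\<rho> z + (- 1) * (\<theta> z * \<rho> z)))"
      by (intro smooth_upto_add \<theta> \<rho> smooth_upto_linear_comp[OF bounded_linear_mult_right]
          smooth_upto_bilinear[OF bounded_bilinear_mult]) auto
    then show ?case
      by (rule exI[of _ "\<lambda>z. \<theta> z + (\<rho> z + (- 1) * (\<theta> z * \<rho> z))", OF conjI])
        (use \<theta>(2,3) \<rho>(2,3) in fastforce)
  qed
  then obtain \<theta> where \<theta>: "smooth_upto k UNIV \<theta>" "\<And>z. z\<in>(\<Union>x\<in>F. ball x (r x)) \<Longrightarrow> \<theta> z = (1::real)"
      "\<And>z. z \<notin> (\<Union>x\<in>F. cball x (2 * r x)) \<Longrightarrow> \<theta> z = 0" by metis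
  show thesis
  proof (rule that[OF \<theta>(1)])
    show "compact (\<Union>x\<in>F. cball x (2 * r x))" using F(2) by (intro compact_UN) auto
    show "(\<Union>x\<in>F. ball x (r x)) \<subseteq> U"
    proof (intro UN_least)
      fix x assume "x \<in> F"
      then have "r x > 0" "cball x (2 * r x) \<subseteq> U" using r F(1) by auto
      moreover from this have "ball x (r x) \<subseteq> cball x (2 * r x)" by auto
      ultimately show "ball x (r x) \<subseteq> U" by blast
    qed
    show "(\<Union>x\<in>F. cball x (2 * r x)) \<subseteq> U" using F(1) r by blast
  qed (use \<theta> F in auto)
qed

section \<open>Polynomial approximation together with derivatives\<close>

text \<open>For a polynomial \<open>p\<close> the kernel \<open>p (x - y)\<close> is a finite sum of products, polynomial in \<open>x\<close> and
  continuous in \<open>y\<close>; integration against any function of \<open>y\<close> therefore gives a polynomial in \<open>x\<close>.\<close>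

inductive separable :: "('a::euclidean_space \<Rightarrow> 'a \<Rightarrow> real) \<Rightarrow> bool" where
  product: "real_polynomial_function A \<Longrightarrow> continuous_on UNIV B \<Longrightarrow> separable (\<lambda>x y. A x * B y)"
| add: "separable f \<Longrightarrow> separable g \<Longrightarrow> separable (\<lambda>x y. f x y + g x y)"

lemma separable_mult_product:
  assumes "separable g" "real_polynomial_function A" "continuous_on UNIV B"
  shows "separable (\<lambda>x y. A x * B y * g x y)"
  using assms(1)
proof induction
  case (product A' B')
  have "separable (\<lambda>x y. (A x * A' x) * (B y * B' y))"
    by (intro separable.product continuous_intros real_polynomial_function.intros(4)) (use assms product in auto)
  then show ?case by (simp add: mult_ac)
next
  case (add f g)
  from separable.add[OF add.IH] show ?case by (simp add: algebra_simps)
qed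

lemma separable_mult:
  assumes "separable f" "separable g"
  shows "separable (\<lambda>x y. f x y * g x y)"
  using assms(1)
proof induction
  case (product A B)
  then show ?case using separable_mult_product[OF assms(2)] by blast
next
  case (add f1 f2)
  from separable.add[OF add.IH] show ?case by (simp add: algebra_simps)
qed

lemma separable_polynomial_difference:
  assumes "real_polynomial_function p" shows "separable (\<lambda>x y. p (x - y))"
  using assms
proof induction
  case (linear f)
  have "separable (\<lambda>x y. f x * 1 + 1 * (- f y))"
    by (intro separable.add separable.product continuous_intros linear_continuous_on)
      (use linear in \<open>auto simp: bounded_linear_minus\<close>)
  then show ?case using linear by (simp add: linear_simps)
next
  case (const c)
  have "separable (\<lambda>x y. c * 1)" by (rule separable.product) auto
  then show ?case by simp
qed (auto intro: separable.add separable_mult)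

lemma separable_continuous: "separable f \<Longrightarrow> continuous_on UNIV (f x)"
  by (induction rule: separable.induct) (auto intro!: continuous_intros)

lemma separable_integral_polynomial:
  fixes a b :: "'a::euclidean_space"
  assumes "separable f" "continuous_on (cbox a b) g"
  shows "real_polynomial_function (\<lambda>x. integral (cbox a b) (\<lambda>y. f x y * g y))"
  using assms(1)
proof induction
  case (product A B)
  have "(\<lambda>x. integral (cbox a b) (\<lambda>y. A x * B y * g y)) = (\<lambda>x. A x * integral (cbox a b) (\<lambda>y. B y * g y))"
    by (simp add: mult.assoc)
  then show ?case using product by auto
next
  case (add f1 f2)
  have int: "(\<lambda>y. f x y * g y) integrable_on cbox a b" if "separable f" for f x
    by (intro integrable_continuous continuous_intros assms(2)
        continuous_on_subset[OF separable_continuous[OF that]]) auto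
  have "(\<lambda>x. integral (cbox a b) (\<lambda>y. (f1 x y + f2 x y) * g y)) =
      (\<lambda>x. integral (cbox a b) (\<lambda>y. f1 x y * g y) + integral (cbox a b) (\<lambda>y. f2 x y * g y))"
    by (rule ext) (simp add: distrib_right integral_add[OF int[OF add.hyps(1)] int[OF add.hyps(2)]])
  then show ?case using add.IH by auto
qed

text \<open>Convolution with a function that is supported in the box.\<close>

definition smear :: "'a::euclidean_space \<Rightarrow> 'a \<Rightarrow> ('a \<Rightarrow> real) \<Rightarrow> ('a \<Rightarrow> real) \<Rightarrow> 'a \<Rightarrow> real" where
  "smear a b p g x = integral (cbox a b) (\<lambda>y. p (x - y) * g y)"

lemma real_polynomial_smear:
  "real_polynomial_function p \<Longrightarrow> continuous_on (cbox a b) g \<Longrightarrow> real_polynomial_function (smear a b p g)"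
  using separable_integral_polynomial[OF separable_polynomial_difference] unfolding smear_def by blast

lemma continuous_on_UNIV_compose_diff:
  fixes p :: "'a::euclidean_space \<Rightarrow> real"
  shows "continuous_on UNIV p \<Longrightarrow> continuous_on S (\<lambda>y. p (x - y))"
  by (rule continuous_on_compose2[of UNIV p]) (auto intro!: continuous_intros)

text \<open>The substitution \<open>t = x - y\<close> moves the dependence on \<open>x\<close> from the kernel to the
  function.\<close>

lemma smear_reflect:
  fixes g :: "'a::euclidean_space \<Rightarrow> real"
  assumes p: "continuous_on UNIV p" and g: "continuous_on UNIV g"
    and supp: "\<And>y. y \<notin> cbox a b \<Longrightarrow> p (x - y) * g y = 0"
    and sub: "\<And>y. y \<in> cbox a b \<Longrightarrow> x - y \<in> cbox c d"
  shows "smear a b p g x = integral (cbox c d) (\<lambda>t. p t * g (x - t))"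
proof -
  define f where "f y = p (x - y) * g y" for y
  have "f integrable_on cbox a b" unfolding f_def
    by (intro integrable_continuous continuous_intros continuous_on_UNIV_compose_diff p continuous_on_subset[OF g]) auto
  then have "(f has_integral (smear a b p g x)) (cbox a b)"
    unfolding smear_def f_def by (rule integrable_integral)
  from has_integral_affinity[OF this, of "-1" x]
  have 1: "((\<lambda>t. f (x - t)) has_integral smear a b p g x) ((\<lambda>y. x - y) ` cbox a b)"
    by simp
  have "((\<lambda>t. f (x - t)) has_integral smear a b p g x) (cbox c d)"
  proof (rule has_integral_on_superset[OF 1])
    show "f (x - t) = 0" if "t \<notin> (\<lambda>y. x - y) ` cbox a b" for t
    proof -
      have "x - t \<notin> cbox a b" using that by (force simp: image_iff)
      then show ?thesis using supp unfolding f_def by blast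
    qed
  qed (use sub in auto)
  then have "integral (cbox c d) (\<lambda>t. f (x - t)) = smear a b p g x" by (rule integral_unique)
  then show ?thesis by (simp add: f_def)
qed

lemma bounded_difference_box:
  fixes A B :: "'a::euclidean_space set"
  assumes "bounded A" "bounded B"
  obtains c d where "\<And>x y. x \<in> A \<Longrightarrow> y \<in> B \<Longrightarrow> x - y \<in> cbox c d"
proof -
  have "bounded ((\<lambda>(x, y). x - y) ` (A \<times> B))" using assms bounded_minus[of A B]
    by (simp add: image_def)
  then obtain c where "(\<lambda>(x, y). x - y) ` (A \<times> B) \<subseteq> cbox (- c) c" using bounded_subset_cbox_symmetric by blast
  then show thesis using that[of "- c" c] by blast
qed

text \<open>After the substitution the derivative falls on the function. Thus smearing commutes with
  derivatives, and uniform convergence of the smeared functions carries over to all derivatives.\<close>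

lemma smear_has_derivative:
  fixes g :: "'a::euclidean_space \<Rightarrow> real"
  assumes p: "continuous_on UNIV p" and g: "smooth_upto 1 UNIV g"
    and supp: "\<And>y. y \<notin> cbox a b \<Longrightarrow> g y = 0"
  shows "(smear a b p g has_derivative (\<lambda>v. smear a b p (\<lambda>y. frechet_derivative g (at y) v) x0)) (at x0)"
    and "\<And>y. y \<notin> cbox a b \<Longrightarrow> frechet_derivative g (at y) v = 0"
proof -
  have gd: "g differentiable (at y)" for y
    using smooth_upto_differentiable[OF g] by blast
  have cont_diff: "continuous_on UNIV F" if "\<And>y. F differentiable (at y)" for F :: "'a \<Rightarrow> real"
    using that by (simp add: continuous_at_imp_continuous_on differentiable_imp_continuous_within)
  have g_cont: "continuous_on UNIV g" by (rule cont_diff) (rule gd)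
  have dg_cont: "continuous_on UNIV (\<lambda>y. frechet_derivative g (at y) v)" for v
    using g unfolding One_nat_def smooth_upto_Suc smooth_upto_0 by (intro cont_diff) blast
  show supp': "frechet_derivative g (at y) v = 0" if "y \<notin> cbox a b" for y v
  proof -
    have "frechet_derivative g (at y) = frechet_derivative (\<lambda>_. 0) (at y)"
      by (rule frechet_derivative_cong_open[of "- cbox a b"]) (use that supp in \<open>auto simp: open_Compl closed_cbox\<close>)
    then show ?thesis by simp
  qed
  define V where "V = ball x0 1"
  have V: "open V" "convex V" "x0 \<in> V" "bounded V" by (auto simp: V_def)
  obtain c d where cd: "\<And>x y. x \<in> V \<Longrightarrow> y \<in> cbox a b \<Longrightarrow> x - y \<in> cbox c d"
    using bounded_difference_box[OF V(4) bounded_cbox] by metis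
  define f' where "f' x t = p t *\<^sub>R Blinfun (frechet_derivative g (at (x - t)))" for x t
  have bl: "bounded_linear (frechet_derivative g (at y))" for y
    using differentiable_has_frechet[OF gd] has_derivative_bounded_linear by blast
  have f'_apply: "blinfun_apply (f' x t) v = p t * frechet_derivative g (at (x - t)) v" for x t v
    unfolding f'_def by (simp add: scaleR_blinfun.rep_eq bounded_linear_Blinfun_apply[OF bl])
  have der: "((\<lambda>x. integral (cbox c d) (\<lambda>t. p t * g (x - t))) has_derivative integral (cbox c d) (f' x0)) (at x0 within V)"
  proof (rule leibniz_rule[where fx = f'])
    show "((\<lambda>x. p t * g (x - t)) has_derivative blinfun_apply (f' x t)) (at x within V)" for x t
    proof -
      have 1: "((\<lambda>x. x - t) has_derivative (\<lambda>v. v)) (at x within V)" by (auto intro!: derivative_eq_intros)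
      have "((\<lambda>x. g (x - t)) has_derivative frechet_derivative g (at (x - t))) (at x within V)"
        using has_derivative_compose[OF 1 differentiable_has_frechet[OF gd]] by simp
      then have "((\<lambda>x. p t * g (x - t)) has_derivative (\<lambda>v. p t * frechet_derivative g (at (x - t)) v)) (at x within V)"
        by (rule has_derivative_mult_right)
      then show ?thesis by (simp add: f'_apply[abs_def])
    qed
    show "(\<lambda>t. p t * g (x - t)) integrable_on cbox c d" for x
      by (intro integrable_continuous continuous_intros continuous_on_UNIV_compose_diff g_cont continuous_on_subset[OF p]) auto
    show "continuous_on (V \<times> cbox c d) (\<lambda>(x, t). f' x t)"
      unfolding split_beta
    proof (rule continuous_on_blinfun_componentwise)
      fix v :: 'a
      have "continuous_on (V \<times> cbox c d) (\<lambda>z. p (snd z) * frechet_derivative g (at (fst z - snd z)) v)"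
        by (intro continuous_intros continuous_on_compose2[OF p] continuous_on_compose2[OF dg_cont]) auto
      then show "continuous_on (V \<times> cbox c d) (\<lambda>z. blinfun_apply (f' (fst z) (snd z)) v)"
        by (simp add: f'_apply)
    qed
  qed (use V in auto)
  have f'_int: "f' x0 integrable_on cbox c d"
  proof (intro integrable_continuous continuous_on_blinfun_componentwise)
    show "continuous_on (cbox c d) (\<lambda>t. blinfun_apply (f' x0 t) i)" for i
      unfolding f'_apply
      by (intro continuous_intros continuous_on_UNIV_compose_diff dg_cont continuous_on_subset[OF p]) auto
  qed
  have "blinfun_apply (integral (cbox c d) (f' x0)) v = smear a b p (\<lambda>y. frechet_derivative g (at y) v) x0" for v
  proof -
    have "blinfun_apply (integral (cbox c d) (f' x0)) v = integral (cbox c d) (\<lambda>t. blinfun_apply (f' x0 t) v)"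
      using integral_linear[OF f'_int blinfun.bounded_linear_left, of v] by (simp add: o_def)
    also have "\<dots> = smear a b p (\<lambda>y. frechet_derivative g (at y) v) x0"
      unfolding f'_apply by (rule smear_reflect[symmetric, OF p dg_cont]) (use supp' cd V in auto)
    finally show ?thesis .
  qed
  then have "blinfun_apply (integral (cbox c d) (f' x0)) = (\<lambda>v. smear a b p (\<lambda>y. frechet_derivative g (at y) v) x0)"
    by (rule ext)
  then have der': "((\<lambda>x. integral (cbox c d) (\<lambda>t. p t * g (x - t))) has_derivative
      (\<lambda>v. smear a b p (\<lambda>y. frechet_derivative g (at y) v) x0)) (at x0)"
    using der unfolding at_within_open[OF V(3,1)] by simp
  show "(smear a b p g has_derivative (\<lambda>v. smear a b p (\<lambda>y. frechet_derivative g (at y) v) x0)) (at x0)"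
    by (rule has_derivative_transform_within_open[OF der' V(1,3)])
      (rule smear_reflect[symmetric, OF p g_cont], use supp cd in auto)
qed

lemma iter_deriv_smear:
  fixes g :: "'a::euclidean_space \<Rightarrow> real"
  assumes p: "continuous_on UNIV p" and g: "smooth_upto k UNIV g"
    and supp: "\<And>y. y \<notin> cbox a b \<Longrightarrow> g y = 0" and len: "length vs \<le> k"
  shows "iter_deriv vs (smear a b p g) = smear a b p (iter_deriv vs g) \<and> (\<forall>y. y \<notin> cbox a b \<longrightarrow> iter_deriv vs g y = 0)"
  using len
proof (induction vs)
  case Nil
  then show ?case using supp by simp
next
  case (Cons v vs)
  then have IH: "iter_deriv vs (smear a b p g) = smear a b p (iter_deriv vs g)" "\<And>y. y \<notin> cbox a b \<Longrightarrow> iter_deriv vs g y = 0"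
    by auto
  have "smooth_upto 1 UNIV (iter_deriv vs g)"
    unfolding smooth_upto_def iter_deriv_append[symmetric]
    using g Cons.prems unfolding smooth_upto_def by simp
  note d = smear_has_derivative[OF p this IH(2)]
  have "iter_deriv (v # vs) (smear a b p g) = smear a b p (iter_deriv (v # vs) g)"
    using frechet_derivative_eqI[OF d(1)] by (simp add: IH(1) fun_eq_iff)
  then show ?case using d(2) by simp
qed

text \<open>Polynomials that converge to a Dirac sequence on the relevant compact set of differences;
  they come from the Stone--Weierstrass theorem applied to normalized tent functions.\<close>

lemma smear_polynomial_kernels:
  fixes K :: "'a::euclidean_space set" and a b :: 'a
  assumes K: "compact K" and ball: "\<And>x. x \<in> K \<Longrightarrow> ball x 1 \<subseteq> cbox a b"
  shows "\<exists>p. (\<forall>n. real_polynomial_function (p n)) \<and>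
    (\<forall>g. continuous_on UNIV g \<longrightarrow> uniform_limit K (\<lambda>n. smear a b (p n) g) g sequentially)"
proof -
  obtain c d where cd: "\<And>x y. x \<in> K \<Longrightarrow> y \<in> cbox a b \<Longrightarrow> x - y \<in> cbox c d"
    using bounded_difference_box[OF compact_imp_bounded[OF K] bounded_cbox] by metis
  define tent where "tent n t = max 0 (1 / real (Suc n) - norm t)" for n and t :: 'a
  define m where "m n = integral (cbox c d) (tent n)" for n
  define \<eta> where "\<eta> n t = tent n t / m n" for n t
  have tent_cont: "continuous_on S (tent n)" for S n unfolding tent_def by (intro continuous_intros)
  have "\<exists>p. real_polynomial_function p \<and> (\<forall>t\<in>cbox c d. \<bar>\<eta> n t - p t\<bar> < 1 / real (Suc n))" for n
  proof -
    have "continuous_on (cbox c d) (\<eta> n)" unfolding \<eta>_def divide_inverse by (intro continuous_intros tent_cont)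
    moreover have "0 < 1 / real (Suc n)" by simp
    ultimately show ?thesis
      by (metis Stone_Weierstrass_real_polynomial_function[OF compact_cbox])
  qed
  then obtain p where p: "\<And>n. real_polynomial_function (p n)"
    "\<And>n t. t \<in> cbox c d \<Longrightarrow> \<bar>\<eta> n t - p n t\<bar> < 1 / real (Suc n)" by metis
  have "uniform_limit K (\<lambda>n. smear a b (p n) g) g sequentially" if g: "continuous_on UNIV g" for g
  proof (cases "K = {}")
    case False
    then obtain x0 where x0: "x0 \<in> K" by blast
    have "ball x0 1 \<subseteq> cbox a b" using ball[OF x0] .
    then have x0ab: "x0 \<in> cbox a b" by (meson centre_in_ball subset_eq zero_less_one)
    have m_pos: "m n > 0" for n
    proof -
      have int: "tent n integrable_on cbox c d" by (intro integrable_continuous tent_cont)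
      have "m n \<noteq> 0"
      proof
        assume "m n = 0"
        then have hi: "(tent n has_integral 0) (cbox c d)" using int unfolding m_def by (metis integrable_integral)
        have "0 \<in> cbox c d" using cd[OF x0 x0ab] by simp
        moreover have "interior (cbox c d) \<noteq> {}"
        proof -
          have "(\<lambda>y. x0 - y) ` ball x0 1 \<subseteq> cbox c d" using cd[OF x0] ball[OF x0] by blast
          moreover have "(\<lambda>y. x0 - y) ` ball x0 1 = ball 0 1"
          proof -
            have "t \<in> (\<lambda>y. x0 - y) ` ball x0 1" if "norm t < 1" for t
              by (rule image_eqI[of _ _ "x0 - t"]) (use that in \<open>auto simp: dist_norm\<close>)
            then show ?thesis by (auto simp: dist_norm norm_minus_commute)
          qed
          ultimately have "ball 0 1 \<subseteq> interior (cbox c d)" by (metis interior_maximal open_ball)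
          moreover have "(0::'a) \<in> ball 0 1" by simp
          ultimately show ?thesis by blast
        qed
        ultimately have "tent n 0 = 0"
          by (intro has_integral_0_cbox_imp_0[OF tent_cont _ hi]) (auto simp: tent_def interior_cbox)
        then show False by (simp add: tent_def)
      qed
      moreover have "m n \<ge> 0" unfolding m_def by (rule integral_nonneg[OF int]) (simp add: tent_def)
      ultimately show ?thesis by simp
    qed
    have \<eta>_cont: "continuous_on UNIV (\<eta> n)" for n unfolding \<eta>_def divide_inverse by (intro continuous_intros tent_cont)
    have \<eta>_nonneg: "\<eta> n t \<ge> 0" for n t using m_pos[of n] by (simp add: \<eta>_def tent_def)
    have \<eta>_zero: "\<eta> n t = 0" if "norm t \<ge> 1 / real (Suc n)" for n t using that by (simp add: \<eta>_def tent_def)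
    have mass: "integral (cbox a b) (\<lambda>y. \<eta> n (x - y)) = 1" if x: "x \<in> K" for x n
    proof -
      have "smear a b (\<eta> n) (\<lambda>_. 1) x = integral (cbox c d) (\<lambda>t. \<eta> n t * 1)"
      proof (rule smear_reflect[OF \<eta>_cont])
        fix y assume "y \<notin> cbox a b"
        then have "y \<notin> ball x 1" using ball[OF x] by blast
        then have "norm (x - y) \<ge> 1" by (simp add: dist_norm)
        moreover have "1 / real (Suc n) \<le> 1" by simp
        ultimately show "\<eta> n (x - y) * 1 = 0" using \<eta>_zero[of n "x - y"] by linarith
      qed (use cd[OF x] in auto)
      also have "\<dots> = 1" unfolding \<eta>_def mult_1_right
        using m_pos[of n] by (simp add: m_def)
      finally show ?thesis by (simp add: smear_def)
    qed
    have "compact (cbox a b)" by simp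
    then have ug: "uniformly_continuous_on (cbox a b) g"
      using compact_uniformly_continuous continuous_on_subset[OF g] by blast
    obtain M where M: "M > 0" "\<And>y. y \<in> cbox a b \<Longrightarrow> \<bar>g y\<bar> \<le> M"
      using compact_imp_bounded[OF compact_continuous_image[OF continuous_on_subset[OF g] \<open>compact (cbox a b)\<close>]]
      unfolding bounded_pos by auto
    define A where "A = measure lborel (cbox a b)"
    have A: "A \<ge> 0" by (simp add: A_def)
    have pcont: "continuous_on UNIV (p n)" for n using p(1)[of n] by (simp add: continuous_on_polymonial_function real_polynomial_function_eq)
    have gc: "continuous_on (cbox a b) g" by (rule continuous_on_subset[OF g]) simp
    show ?thesis
    proof (rule uniform_limitI)
      fix e :: real assume e: "e > 0"
      obtain \<delta> where \<delta>: "\<delta> > 0" "\<And>x y. x \<in> cbox a b \<Longrightarrow> y \<in> cbox a b \<Longrightarrow> dist y x < \<delta> \<Longrightarrow> dist (g y) (g x) < e / 2"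
        using ug e unfolding uniformly_continuous_on_def by (metis half_gt_zero)
      have "eventually (\<lambda>n. 1 / real (Suc n) < min \<delta> (e / (2 * (M * A + 1)))) sequentially"
      proof -
        have "M * A + 1 > 0" using M A by (simp add: add_nonneg_pos)
        then have "min \<delta> (e / (2 * (M * A + 1))) > 0" using \<delta> e by simp
        then show ?thesis using order_tendstoD(2)[OF LIMSEQ_Suc[OF lim_1_over_n]] by blast
      qed
      then show "\<forall>\<^sub>F n in sequentially. \<forall>x\<in>K. dist (smear a b (p n) g x) (g x) < e"
      proof eventually_elim
        case (elim n)
        show ?case
        proof
          fix x assume x: "x \<in> K"
          have xab: "x \<in> cbox a b" using ball[OF x] by (meson centre_in_ball subset_eq zero_less_one)
          have i1: "(\<lambda>y. p n (x - y) * g y) integrable_on cbox a b"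
            by (intro integrable_continuous continuous_intros continuous_on_UNIV_compose_diff pcont gc)
          have i2: "(\<lambda>y. \<eta> n (x - y) * g y) integrable_on cbox a b"
            by (intro integrable_continuous continuous_intros continuous_on_UNIV_compose_diff \<eta>_cont gc)
          have i3: "(\<lambda>y. \<eta> n (x - y)) integrable_on cbox a b"
            by (intro integrable_continuous continuous_intros continuous_on_UNIV_compose_diff \<eta>_cont)
          have i4: "(\<lambda>y. \<eta> n (x - y) * g x) integrable_on cbox a b"
            using integrable_on_mult_left[OF i3] by simp
          have "norm (integral (cbox a b) (\<lambda>y. p n (x - y) * g y - \<eta> n (x - y) * g y)) \<le> (1 / real (Suc n) * M) * A"
            unfolding A_def
          proof (rule has_integral_bound[OF _ integrable_integral])
            show "0 \<le> 1 / real (Suc n) * M" using M by simp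
            show "(\<lambda>y. p n (x - y) * g y - \<eta> n (x - y) * g y) integrable_on cbox a b" by (rule integrable_diff[OF i1 i2])
            fix y assume y: "y \<in> cbox a b"
            have "norm (p n (x - y) * g y - \<eta> n (x - y) * g y) = \<bar>\<eta> n (x - y) - p n (x - y)\<bar> * \<bar>g y\<bar>"
              by (simp add: left_diff_distrib[symmetric] abs_mult abs_minus_commute)
            also have "\<dots> \<le> 1 / real (Suc n) * M"
              using p(2)[OF cd[OF x y], of n] M(2)[OF y] by (intro mult_mono) auto
            finally show "norm (p n (x - y) * g y - \<eta> n (x - y) * g y) \<le> 1 / real (Suc n) * M" .
          qed
          also have "\<dots> = 1 / real (Suc n) * (M * A)" by simp
          also have "\<dots> \<le> 1 / real (Suc n) * (M * A + 1)" by (intro mult_left_mono) auto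
          also have "\<dots> < e / (2 * (M * A + 1)) * (M * A + 1)"
            using elim M A by (intro mult_strict_right_mono) (auto simp: add_nonneg_pos)
          also have "\<dots> = e / 2"
          proof -
            have "M * A + 1 > 0" using M A by (simp add: add_nonneg_pos)
            moreover have "e / (2 * q) * q = e / 2" if "q > 0" for q :: real using that by (simp add: field_simps)
            ultimately show ?thesis by blast
          qed
          finally have 1: "\<bar>smear a b (p n) g x - integral (cbox a b) (\<lambda>y. \<eta> n (x - y) * g y)\<bar> < e / 2"
            unfolding smear_def integral_diff[OF i1 i2] by simp
          have "norm (integral (cbox a b) (\<lambda>y. \<eta> n (x - y) * g y - \<eta> n (x - y) * g x))
              \<le> integral (cbox a b) (\<lambda>y. \<eta> n (x - y) * (e / 2))"
          proof (rule integral_norm_bound_integral)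
            show "(\<lambda>y. \<eta> n (x - y) * g y - \<eta> n (x - y) * g x) integrable_on cbox a b" by (rule integrable_diff[OF i2 i4])
            show "(\<lambda>y. \<eta> n (x - y) * (e / 2)) integrable_on cbox a b" using integrable_on_mult_left[OF i3] by simp
            fix y assume y: "y \<in> cbox a b"
            show "norm (\<eta> n (x - y) * g y - \<eta> n (x - y) * g x) \<le> \<eta> n (x - y) * (e / 2)"
            proof (cases "norm (x - y) \<ge> 1 / real (Suc n)")
              case True then show ?thesis by (simp add: \<eta>_zero)
            next
              case False
              then have "dist y x < \<delta>" using elim by (simp add: dist_norm norm_minus_commute)
              from \<delta>(2)[OF xab y this] have "\<bar>g y - g x\<bar> \<le> e / 2" by (simp add: dist_real_def)
              then have "\<eta> n (x - y) * \<bar>g y - g x\<bar> \<le> \<eta> n (x - y) * (e / 2)" by (intro mult_left_mono \<eta>_nonneg)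
              then show ?thesis by (simp add: right_diff_distrib[symmetric] abs_mult \<eta>_nonneg)
            qed
          qed
          also have "\<dots> = e / 2" by (simp add: mass[OF x])
          finally have "\<bar>integral (cbox a b) (\<lambda>y. \<eta> n (x - y) * g y) - g x\<bar> \<le> e / 2"
            unfolding integral_diff[OF i2 i4] by (simp add: mass[OF x])
          with 1 show "dist (smear a b (p n) g x) (g x) < e" unfolding dist_real_def by argo
        qed
      qed
    qed
  qed (simp add: uniform_limit_iff)
  then show ?thesis using p(1) by blast
qed

text \<open>A cutoff to a neighbourhood of \<open>K\<close> extends the function to the whole space; convolution with
  polynomial kernels that tend to a Dirac sequence turns the extension into polynomials.\<close>

theorem smooth_polynomial_approximation:
  fixes H :: "'a::euclidean_space \<Rightarrow> real"
  assumes U: "open U" and H: "smooth_on U H" and K: "compact K" "K \<subseteq> U"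
  shows "\<exists>P. (\<forall>n. real_polynomial_function (P n)) \<and>
    (\<forall>vs. length vs \<le> k \<longrightarrow> uniform_limit K (\<lambda>n. iter_deriv vs (P n)) (iter_deriv vs H) sequentially)"
proof -
  obtain \<theta> V C where \<theta>: "smooth_upto k UNIV \<theta>" "open V" "K \<subseteq> V" "V \<subseteq> U" "compact C" "C \<subseteq> U"
    "\<And>z. z \<in> V \<Longrightarrow> \<theta> z = (1::real)" "\<And>z. z \<notin> C \<Longrightarrow> \<theta> z = 0"
    using smooth_upto_cutoff[OF U K] by blast
  define h where "h z = \<theta> z * H z" for z
  have h: "smooth_upto k UNIV h"
  proof -
    have "smooth_upto k U h" unfolding h_def
      using H smooth_upto_mono[OF \<theta>(1) order_refl, of U]
      by (intro smooth_upto_bilinear[OF bounded_bilinear_mult U]) (auto simp: smooth_on_iff_upto)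
    moreover have "smooth_upto k (- C) h"
      by (rule smooth_upto_cong[of _ "\<lambda>_. 0"]) (auto simp: h_def \<theta> compact_imp_closed open_Compl)
    ultimately show ?thesis using \<theta>(6) unfolding smooth_upto_def by blast
  qed
  have "bounded (C \<union> (\<Union>x\<in>K. ball x 1))"
  proof -
    obtain B where "\<And>x. x \<in> K \<Longrightarrow> norm x \<le> B" using compact_imp_bounded[OF K(1)] bounded_iff by blast
    then have "(\<Union>x\<in>K. ball x 1) \<subseteq> cball 0 (B + 1)"
    proof (intro UN_least subsetI)
      fix x y assume *: "\<And>x. x \<in> K \<Longrightarrow> norm x \<le> B" "x \<in> K" "y \<in> ball x 1"
      then show "y \<in> cball 0 (B + 1)" using norm_triangle_sub[of y x] by (fastforce simp: dist_norm norm_minus_commute)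
    qed
    then show ?thesis using compact_imp_bounded[OF \<theta>(5)] bounded_subset[OF bounded_cball] by auto
  qed
  then obtain b where b: "C \<union> (\<Union>x\<in>K. ball x 1) \<subseteq> cbox (- b) b" using bounded_subset_cbox_symmetric by blast
  obtain p where p: "\<And>n. real_polynomial_function (p n)"
    "\<And>g. continuous_on UNIV g \<Longrightarrow> uniform_limit K (\<lambda>n. smear (- b) b (p n) g) g sequentially"
    using smear_polynomial_kernels[OF K(1), of "- b" b] b by blast
  have pc: "continuous_on UNIV (p n)" for n using p(1)[of n] by (simp add: continuous_on_polymonial_function real_polynomial_function_eq)
  have supp: "h y = 0" if "y \<notin> cbox (- b) b" for y using that b \<theta>(8)[of y] unfolding h_def by auto
  have cont: "continuous_on UNIV (iter_deriv vs h)" if "length vs \<le> k" for vs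
    using h that unfolding smooth_upto_def
    by (auto intro!: continuous_at_imp_continuous_on differentiable_imp_continuous_within)
  show ?thesis
  proof (intro exI[of _ "\<lambda>n. smear (- b) b (p n) h"] conjI allI impI)
    show "real_polynomial_function (smear (- b) b (p n) h)" for n
      using cont[of "[]"] by (intro real_polynomial_smear p(1)) (auto intro: continuous_on_subset)
    fix vs :: "'a list" assume len: "length vs \<le> k"
    have 1: "iter_deriv vs (smear (- b) b (p n) h) = smear (- b) b (p n) (iter_deriv vs h)" for n
      using iter_deriv_smear[OF pc h supp len] by blast
    have 2: "iter_deriv vs h x = iter_deriv vs H x" if "x \<in> K" for x
      by (rule iter_deriv_cong_open[OF \<theta>(2)]) (use that \<theta> in \<open>auto simp: h_def\<close>)
    show "uniform_limit K (\<lambda>n. iter_deriv vs (smear (- b) b (p n) h)) (iter_deriv vs H) sequentially"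
      unfolding 1 using p(2)[OF cont[OF len]] by (rule uniform_limit_cong'[THEN iffD1, rotated -1]) (auto simp: 2)
  qed
qed

lemma smooth_on_real_polynomial_function:
  fixes p :: "'a::euclidean_space \<Rightarrow> real"
  assumes "real_polynomial_function p" shows "smooth_on UNIV p"
  using assms
  by induction (auto intro: smooth_on_bounded_linear smooth_on_add smooth_on_mult)

lemma smooth_on_frechet_mult:
  fixes f g :: "'a::euclidean_space \<Rightarrow> real"
  assumes "smooth_on U f" "smooth_on U g" "x \<in> U"
  shows "frechet_derivative (\<lambda>x. f x * g x) (at x) v
    = f x * frechet_derivative g (at x) v + frechet_derivative f (at x) v * g x"
  using frechet_derivative_eqI[OF has_derivative_mult[OF smooth_on_has_derivative[OF assms(1,3)] smooth_on_has_derivative[OF assms(2,3)]]]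
  by simp

lemma smooth_on_frechet_add:
  assumes "smooth_on U f" "smooth_on U g" "x \<in> U"
  shows "frechet_derivative (\<lambda>x. f x + g x) (at x) v = frechet_derivative f (at x) v + frechet_derivative g (at x) v"
  using frechet_derivative_eqI[OF has_derivative_add[OF smooth_on_has_derivative[OF assms(1,3)] smooth_on_has_derivative[OF assms(2,3)]]]
  by simp

text \<open>For polynomials the symmetry of second derivatives is an induction; in general it is
  inherited by approximation.\<close>

lemma polynomial_second_derivative_symmetric:
  fixes p :: "'a::euclidean_space \<Rightarrow> real"
  assumes "real_polynomial_function p"
  shows "iter_deriv [u, v] p x = iter_deriv [v, u] p x"
  using assms
proof (induction arbitrary: x)
  case (linear f)
  then have "frechet_derivative f (at y) = f" for y using frechet_derivative_eqI bounded_linear_imp_has_derivative by blast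
  then show ?case by simp
next
  case (add f g)
  have s: "smooth_on UNIV f" "smooth_on UNIV g" using add smooth_on_real_polynomial_function by auto
  show ?case using add.IH[of x]
    by (simp add: smooth_on_frechet_add[OF s UNIV_I] smooth_on_frechet_add[OF smooth_on_deriv[OF s(1)] smooth_on_deriv[OF s(2)] UNIV_I])
next
  case (mult f g)
  have s: "smooth_on UNIV f" "smooth_on UNIV g" using mult smooth_on_real_polynomial_function by auto
  note d = smooth_on_deriv[OF s(1)] smooth_on_deriv[OF s(2)]
  have "iter_deriv [u, v] (\<lambda>x. f x * g x) x = f x * iter_deriv [u, v] g x + frechet_derivative f (at x) u * frechet_derivative g (at x) v
      + (frechet_derivative f (at x) v * frechet_derivative g (at x) u + iter_deriv [u, v] f x * g x)" for u v
    using s d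
    by (simp add: smooth_on_frechet_mult[OF s UNIV_I] smooth_on_frechet_add[OF smooth_on_mult[OF open_UNIV s(1) d(2)] smooth_on_mult[OF open_UNIV d(1) s(2)] UNIV_I]
       smooth_on_frechet_mult[OF s(1) d(2) UNIV_I] smooth_on_frechet_mult[OF d(1) s(2) UNIV_I])
  from this[of u v] this[of v u] show ?case using mult.IH[of x] by simp
qed simp

lemma smooth_on_second_derivative_symmetric_real:
  fixes F :: "'a::euclidean_space \<Rightarrow> real"
  assumes "open U" "smooth_on U F" "x \<in> U"
  shows "iter_deriv [u, v] F x = iter_deriv [v, u] F x"
proof -
  obtain P where P: "\<And>n. real_polynomial_function (P n)"
    "\<And>vs. length vs \<le> 2 \<Longrightarrow> uniform_limit {x} (\<lambda>n. iter_deriv vs (P n)) (iter_deriv vs F) sequentially"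
    using smooth_polynomial_approximation[OF assms(1,2), of "{x}" 2] assms(3) by (auto simp del: iter_deriv.simps)
  have "(\<lambda>n. iter_deriv [u, v] (P n) x) \<longlonglongrightarrow> iter_deriv [u, v] F x"
    "(\<lambda>n. iter_deriv [v, u] (P n) x) \<longlonglongrightarrow> iter_deriv [v, u] F x"
    using tendsto_uniform_limitI[OF P(2), of _ x] by (simp_all del: iter_deriv.simps)
  then show ?thesis
    unfolding polynomial_second_derivative_symmetric[OF P(1), of u v] by (rule LIMSEQ_unique)
qed

lemma frechet_derivative_inner_const:
  assumes "F differentiable (at x)"
  shows "frechet_derivative (\<lambda>x. F x \<bullet> c) (at x) v = frechet_derivative F (at x) v \<bullet> c"
  using frechet_derivative_eqI[OF has_derivative_inner_left[OF differentiable_has_frechet[OF assms]]] by simp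

lemma smooth_on_second_derivative_symmetric:
  fixes F :: "'a::euclidean_space \<Rightarrow> 'b::euclidean_space"
  assumes "open U" "smooth_on U F" "x \<in> U"
  shows "frechet_derivative (\<lambda>y. frechet_derivative F (at y) v) (at x) u
    = frechet_derivative (\<lambda>y. frechet_derivative F (at y) u) (at x) v"
proof (rule euclidean_eqI)
  fix b :: 'b assume "b \<in> Basis"
  have "iter_deriv [u, v] (\<lambda>x. F x \<bullet> b) x = frechet_derivative (\<lambda>y. frechet_derivative F (at y) v) (at x) u \<bullet> b" for u v
  proof -
    have "frechet_derivative (\<lambda>y. frechet_derivative (\<lambda>x. F x \<bullet> b) (at y) v) (at x)
      = frechet_derivative (\<lambda>y. frechet_derivative F (at y) v \<bullet> b) (at x)"
      by (rule frechet_derivative_cong_open[OF assms(1,3)])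
        (simp add: frechet_derivative_inner_const smooth_on_differentiable[OF assms(2)])
    then show ?thesis
      by (simp add: frechet_derivative_inner_const smooth_on_differentiable[OF smooth_on_deriv[OF assms(2)] assms(3)])
  qed
  moreover have "smooth_on U (\<lambda>x. F x \<bullet> b)" by (intro smooth_on_inner assms smooth_on_const)
  ultimately show "frechet_derivative (\<lambda>y. frechet_derivative F (at y) v) (at x) u \<bullet> b
    = frechet_derivative (\<lambda>y. frechet_derivative F (at y) u) (at x) v \<bullet> b"
    using smooth_on_second_derivative_symmetric_real[OF assms(1) _ assms(3), of "\<lambda>x. F x \<bullet> b" u v] by metis
qed

section \<open>Uniform convergence with all derivatives\<close>

definition smoothly_tends_upto ::
    "nat \<Rightarrow> 'a::euclidean_space set \<Rightarrow> (nat \<Rightarrow> 'a \<Rightarrow> 'b::euclidean_space) \<Rightarrow> ('a \<Rightarrow> 'b) \<Rightarrow> bool" where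
  "smoothly_tends_upto k K Fs F \<longleftrightarrow> (\<forall>vs. set vs \<subseteq> Basis \<and> length vs \<le> k \<longrightarrow>
     uniform_limit K (\<lambda>i. iter_deriv vs (Fs i)) (iter_deriv vs F) sequentially)"

text \<open>Approximation is considered on one compact set at a time, as in the definition of density; this
  avoids exhaustions of \<open>U\<close>.\<close>

definition smooth_closure :: "'a::euclidean_space set \<Rightarrow> 'a set \<Rightarrow> ('a \<Rightarrow> real) set \<Rightarrow> ('a \<Rightarrow> real) set" where
  "smooth_closure U K L = {H. smooth_on U H \<and> (\<forall>k e. e > 0 \<longrightarrow>
     (\<exists>F\<in>L. \<forall>z\<in>K. \<forall>vs. set vs \<subseteq> Basis \<and> length vs \<le> k \<longrightarrow> norm (iter_deriv vs F z - iter_deriv vs H z) < e))}"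

lemma smoothly_tends_upto_0: "smoothly_tends_upto 0 K Fs F \<longleftrightarrow> uniform_limit K Fs F sequentially"
  by (auto simp: smoothly_tends_upto_def)

lemma smoothly_tends_upto_Suc:
  "smoothly_tends_upto (Suc k) K Fs F \<longleftrightarrow> uniform_limit K Fs F sequentially \<and>
    (\<forall>v\<in>Basis. smoothly_tends_upto k K (\<lambda>i x. frechet_derivative (Fs i) (at x) v) (\<lambda>x. frechet_derivative F (at x) v))"
    (is "?L \<longleftrightarrow> ?R")
proof
  assume L: ?L
  have 1: "iter_deriv vs (\<lambda>x. frechet_derivative F (at x) v) = iter_deriv (vs @ [v]) F" for vs v and F :: "'a \<Rightarrow> 'b"
    by (simp add: iter_deriv_append)
  have "uniform_limit K (\<lambda>i. iter_deriv [] (Fs i)) (iter_deriv [] F) sequentially"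
    using L unfolding smoothly_tends_upto_def by (metis empty_subsetI list.set(1) list.size(3) zero_le)
  moreover have "smoothly_tends_upto k K (\<lambda>i x. frechet_derivative (Fs i) (at x) v) (\<lambda>x. frechet_derivative F (at x) v)"
    if v: "v \<in> Basis" for v
    unfolding smoothly_tends_upto_def 1
  proof (intro allI impI)
    fix vs :: "'a list" assume "set vs \<subseteq> Basis \<and> length vs \<le> k"
    then have "set (vs @ [v]) \<subseteq> Basis \<and> length (vs @ [v]) \<le> Suc k" using v by simp
    then show "uniform_limit K (\<lambda>i. iter_deriv (vs @ [v]) (Fs i)) (iter_deriv (vs @ [v]) F) sequentially"
      using L unfolding smoothly_tends_upto_def by blast
  qed
  ultimately show ?R by simp
next
  assume R: ?R
  show ?L unfolding smoothly_tends_upto_def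
  proof (intro allI impI)
    fix vs assume vs: "set vs \<subseteq> (Basis::'a set) \<and> length vs \<le> Suc k"
    show "uniform_limit K (\<lambda>i. iter_deriv vs (Fs i)) (iter_deriv vs F) sequentially"
    proof (cases vs rule: rev_cases)
      case Nil then show ?thesis using R by simp
    next
      case (snoc ys y)
      then show ?thesis using R vs unfolding smoothly_tends_upto_def by (simp add: iter_deriv_append)
    qed
  qed
qed

lemma smoothly_tends_upto_Suc_imp: "smoothly_tends_upto (Suc k) K Fs F \<Longrightarrow> smoothly_tends_upto k K Fs F"
  by (simp add: smoothly_tends_upto_def)

lemma smoothly_tends_upto_const: "smoothly_tends_upto k K (\<lambda>i. F) F"
  by (simp add: smoothly_tends_upto_def uniform_limit_const)

lemma smoothly_tends_upto_cong:
  assumes "open U" "K \<subseteq> U" "\<And>i x. x \<in> U \<Longrightarrow> Fs i x = Gs i x" "\<And>x. x \<in> U \<Longrightarrow> F x = G x"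
    "smoothly_tends_upto k K Fs F"
  shows "smoothly_tends_upto k K Gs G"
  unfolding smoothly_tends_upto_def
proof (intro allI impI)
  fix vs assume vs: "set vs \<subseteq> (Basis::'a set) \<and> length vs \<le> k"
  have "uniform_limit K (\<lambda>i. iter_deriv vs (Fs i)) (iter_deriv vs F) sequentially \<longleftrightarrow>
     uniform_limit K (\<lambda>i. iter_deriv vs (Gs i)) (iter_deriv vs G) sequentially"
    by (rule uniform_limit_cong') (use assms(2) in \<open>auto intro!: iter_deriv_cong_open[OF assms(1)] assms(3,4)\<close>)
  then show "uniform_limit K (\<lambda>i. iter_deriv vs (Gs i)) (iter_deriv vs G) sequentially"
    using assms(5) vs unfolding smoothly_tends_upto_def by blast
qed

lemma smoothly_tends_upto_add:
  fixes F G :: "'a::euclidean_space \<Rightarrow> 'b::euclidean_space"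
  assumes U: "open U" "K \<subseteq> U"
    and "\<And>i. smooth_on U (Fs i)" "smooth_on U F" "\<And>i. smooth_on U (Gs i)" "smooth_on U G"
    and "smoothly_tends_upto k K Fs F" "smoothly_tends_upto k K Gs G"
  shows "smoothly_tends_upto k K (\<lambda>i x. Fs i x + Gs i x) (\<lambda>x. F x + G x)"
  using assms(3-)
proof (induction k arbitrary: Fs F Gs G)
  case 0
  then show ?case unfolding smoothly_tends_upto_0 by (intro uniform_limit_add)
next
  case (Suc k)
  show ?case unfolding smoothly_tends_upto_Suc
  proof (intro conjI ballI)
    show "uniform_limit K (\<lambda>i x. Fs i x + Gs i x) (\<lambda>x. F x + G x) sequentially"
      using Suc.prems unfolding smoothly_tends_upto_Suc by (intro uniform_limit_add) auto
    fix v :: 'a assume v: "v \<in> Basis"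
    show "smoothly_tends_upto k K (\<lambda>i x. frechet_derivative (\<lambda>x. Fs i x + Gs i x) (at x) v)
          (\<lambda>x. frechet_derivative (\<lambda>x. F x + G x) (at x) v)"
      by (rule smoothly_tends_upto_cong[OF U _ _ Suc.IH[of "\<lambda>i x. frechet_derivative (Fs i) (at x) v" "\<lambda>x. frechet_derivative F (at x) v"
            "\<lambda>i x. frechet_derivative (Gs i) (at x) v" "\<lambda>x. frechet_derivative G (at x) v"]])
        (use Suc.prems v in \<open>auto simp: smoothly_tends_upto_Suc smooth_on_frechet_add[where U=U] intro: smooth_on_deriv\<close>)
  qed
qed

lemma smooth_on_frechet_bilinear:
  assumes "bounded_bilinear p" "smooth_on U f" "smooth_on U g" "x \<in> U"
  shows "frechet_derivative (\<lambda>x. p (f x) (g x)) (at x) v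
    = p (f x) (frechet_derivative g (at x) v) + p (frechet_derivative f (at x) v) (g x)"
  using frechet_derivative_eqI[OF bounded_bilinear.FDERIV[OF assms(1) smooth_on_has_derivative[OF assms(2,4)] smooth_on_has_derivative[OF assms(3,4)]]]
  by simp

lemma smooth_on_continuous_on: "smooth_on U F \<Longrightarrow> continuous_on U F"
  by (auto intro!: continuous_at_imp_continuous_on differentiable_imp_continuous_within smooth_on_differentiable)

lemma smoothly_tends_upto_bilinear:
  fixes F :: "'a::euclidean_space \<Rightarrow> 'b::euclidean_space" and G :: "'a \<Rightarrow> 'c::euclidean_space"
    and p :: "'b \<Rightarrow> 'c \<Rightarrow> 'd::euclidean_space"
  assumes p: "bounded_bilinear p" and U: "open U" "K \<subseteq> U" and K: "compact K"
    and "\<And>i. smooth_on U (Fs i)" "smooth_on U F" "\<And>i. smooth_on U (Gs i)" "smooth_on U G"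
    and "smoothly_tends_upto k K Fs F" "smoothly_tends_upto k K Gs G"
  shows "smoothly_tends_upto k K (\<lambda>i x. p (Fs i x) (Gs i x)) (\<lambda>x. p (F x) (G x))"
proof -
  have ul: "uniform_limit K (\<lambda>i x. p (Fs i x) (Gs i x)) (\<lambda>x. p (F x) (G x)) sequentially"
    if "smooth_on U F" "smooth_on U G" "uniform_limit K Fs F sequentially" "uniform_limit K Gs G sequentially"
    for Fs Gs and F :: "'a \<Rightarrow> 'b" and G :: "'a \<Rightarrow> 'c"
  proof (rule bounded_bilinear.bounded_uniform_limit[OF p that(3,4)])
    show "bounded (F ` K)" "bounded (G ` K)"
      using that(1,2) U K smooth_on_continuous_on
      by (meson compact_continuous_image compact_imp_bounded continuous_on_subset)+
  qed
  show ?thesis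
    using assms(5-)
  proof (induction k arbitrary: Fs F Gs G)
    case 0
    then show ?case unfolding smoothly_tends_upto_0 by (intro ul)
  next
    case (Suc k)
    show ?case unfolding smoothly_tends_upto_Suc
    proof (intro conjI ballI)
      show "uniform_limit K (\<lambda>i x. p (Fs i x) (Gs i x)) (\<lambda>x. p (F x) (G x)) sequentially"
        using Suc.prems unfolding smoothly_tends_upto_Suc by (intro ul) auto
      fix v :: 'a assume v: "v \<in> Basis"
      have t: "smoothly_tends_upto k K Fs F" "smoothly_tends_upto k K Gs G"
        "smoothly_tends_upto k K (\<lambda>i x. frechet_derivative (Fs i) (at x) v) (\<lambda>x. frechet_derivative F (at x) v)"
        "smoothly_tends_upto k K (\<lambda>i x. frechet_derivative (Gs i) (at x) v) (\<lambda>x. frechet_derivative G (at x) v)"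
        using Suc.prems(5,6)[THEN smoothly_tends_upto_Suc_imp] Suc.prems(5,6) v by (simp_all add: smoothly_tends_upto_Suc)
      have "smoothly_tends_upto k K
          (\<lambda>i x. p (Fs i x) (frechet_derivative (Gs i) (at x) v) + p (frechet_derivative (Fs i) (at x) v) (Gs i x))
          (\<lambda>x. p (F x) (frechet_derivative G (at x) v) + p (frechet_derivative F (at x) v) (G x))"
        using Suc.prems t
        by (intro smoothly_tends_upto_add[OF U] Suc.IH smooth_on_bilinear[OF p U(1)] smooth_on_deriv) auto
      then show "smoothly_tends_upto k K (\<lambda>i x. frechet_derivative (\<lambda>x. p (Fs i x) (Gs i x)) (at x) v)
          (\<lambda>x. frechet_derivative (\<lambda>x. p (F x) (G x)) (at x) v)"
        by (rule smoothly_tends_upto_cong[OF U, rotated -1])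
          (auto intro!: smooth_on_frechet_bilinear[OF p, where U=U, symmetric] Suc.prems)
    qed
  qed
qed

lemma smoothly_tends_upto_sum:
  fixes F :: "'i \<Rightarrow> 'a::euclidean_space \<Rightarrow> 'b::euclidean_space"
  assumes U: "open U" "K \<subseteq> U"
    and "\<And>j i. j \<in> J \<Longrightarrow> smooth_on U (Fs j i)" "\<And>j. j \<in> J \<Longrightarrow> smooth_on U (F j)"
    and "\<And>j. j \<in> J \<Longrightarrow> smoothly_tends_upto k K (Fs j) (F j)"
  shows "smoothly_tends_upto k K (\<lambda>i x. \<Sum>j\<in>J. Fs j i x) (\<lambda>x. \<Sum>j\<in>J. F j x)"
  using assms(3-)
proof (induction J rule: infinite_finite_induct)
  case (insert j J)
  then show ?case
    by (simp, intro smoothly_tends_upto_add[OF U] smooth_on_sum[OF U(1)]) auto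
qed (auto intro: smoothly_tends_upto_const)

lemma real_frechet_derivative:
  fixes P :: "real \<Rightarrow> real" assumes "P differentiable (at x)"
  shows "frechet_derivative P (at x) v = v * frechet_derivative P (at x) 1"
proof -
  have "frechet_derivative P (at x) (v *\<^sub>R 1) = v *\<^sub>R frechet_derivative P (at x) 1"
    by (rule linear_scale[OF linear_frechet_derivative[OF assms]])
  then show ?thesis by simp
qed

lemma frechet_derivative_real_compose:
  fixes P :: "real \<Rightarrow> real" and u :: "'a::euclidean_space \<Rightarrow> real"
  assumes "P differentiable (at (u x))" "u differentiable (at x)"
  shows "frechet_derivative (\<lambda>x. P (u x)) (at x) v
    = frechet_derivative u (at x) v * frechet_derivative P (at (u x)) 1"
  unfolding frechet_derivative_eqI[OF frechet_derivative_compose_pt[OF assms]]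
  by (rule real_frechet_derivative[OF assms(1)])

lemma smoothly_tends_upto_compose:
  fixes P :: "real \<Rightarrow> real" and u :: "'a::euclidean_space \<Rightarrow> real"
  assumes U: "open U" "K \<subseteq> U" and K: "compact K" and V: "open V" "u ` U \<subseteq> V" and u: "smooth_on U u"
    and "\<And>i. smooth_on V (Ps i)" "smooth_on V P" "smoothly_tends_upto k (u ` K) Ps P"
  shows "smoothly_tends_upto k K (\<lambda>i x. Ps i (u x)) (\<lambda>x. P (u x))"
  using assms(7-)
proof (induction k arbitrary: Ps P)
  case 0
  then show ?case unfolding smoothly_tends_upto_0 by (auto simp: uniform_limit_iff)
next
  case (Suc k)
  have sm: "smooth_on U (\<lambda>x. Q (u x))" if "smooth_on V Q" for Q :: "real \<Rightarrow> real"
    by (rule smooth_on_compose[OF U(1) V(1) that u]) (use V in auto)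
  show ?case unfolding smoothly_tends_upto_Suc
  proof (intro conjI ballI)
    show "uniform_limit K (\<lambda>i x. Ps i (u x)) (\<lambda>x. P (u x)) sequentially"
      using Suc.prems unfolding smoothly_tends_upto_Suc by (auto simp: uniform_limit_iff)
    fix v :: 'a assume v: "v \<in> Basis"
    have d: "smooth_on V (\<lambda>x. frechet_derivative P (at x) 1)" "smooth_on V (\<lambda>x. frechet_derivative (Ps i) (at x) 1)" for i
      using Suc.prems smooth_on_deriv by auto
    have "smoothly_tends_upto k K
        (\<lambda>i x. frechet_derivative u (at x) v * frechet_derivative (Ps i) (at (u x)) 1)
        (\<lambda>x. frechet_derivative u (at x) v * frechet_derivative P (at (u x)) 1)"
      using Suc.prems Suc.IH[OF d(2,1)] sm[OF d(1)] sm[OF d(2)]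
      by (intro smoothly_tends_upto_bilinear[OF bounded_bilinear_mult U K] smoothly_tends_upto_const smooth_on_deriv u)
        (auto simp: smoothly_tends_upto_Suc)
    then show "smoothly_tends_upto k K (\<lambda>i x. frechet_derivative (\<lambda>x. Ps i (u x)) (at x) v)
        (\<lambda>x. frechet_derivative (\<lambda>x. P (u x)) (at x) v)"
      by (rule smoothly_tends_upto_cong[OF U, rotated -1])
        (use Suc.prems V u in \<open>auto intro!: frechet_derivative_real_compose[symmetric] smooth_on_differentiable[of V] smooth_on_differentiable[of U]\<close>)
  qed
qed

lemma finite_Basis_lists: "finite {vs :: 'a::euclidean_space list. set vs \<subseteq> Basis \<and> length vs \<le> k}"
  by (rule finite_lists_length_le) simp

lemma smoothly_tends_upto_eventually:
  assumes "smoothly_tends_upto k K Fs F" "e > 0"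
  shows "eventually (\<lambda>i. \<forall>z\<in>K. \<forall>vs. set vs \<subseteq> Basis \<and> length vs \<le> k \<longrightarrow>
    norm (iter_deriv vs (Fs i) z - iter_deriv vs F z) < e) sequentially"
proof -
  have "eventually (\<lambda>i. \<forall>vs\<in>{vs. set vs \<subseteq> Basis \<and> length vs \<le> k}. \<forall>z\<in>K. dist (iter_deriv vs (Fs i) z) (iter_deriv vs F z) < e) sequentially"
    by (rule eventually_ball_finite[OF finite_Basis_lists])
      (use assms in \<open>auto simp: smoothly_tends_upto_def uniform_limit_iff\<close>)
  then show ?thesis by eventually_elim (auto simp: dist_norm)
qed

lemma smooth_closureI_limit:
  assumes "smooth_on U H"
    and "\<And>k. \<exists>Hs. (\<forall>i. Hs i \<in> smooth_closure U K L) \<and> smoothly_tends_upto k K Hs H"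
  shows "H \<in> smooth_closure U K L"
  unfolding smooth_closure_def
proof (intro CollectI conjI allI impI)
  fix k and e :: real assume e: "e > 0"
  obtain Hs where Hs: "\<And>i. Hs i \<in> smooth_closure U K L" "smoothly_tends_upto k K Hs H" using assms(2) by blast
  have "\<exists>i. \<forall>z\<in>K. \<forall>vs. set vs \<subseteq> Basis \<and> length vs \<le> k \<longrightarrow> norm (iter_deriv vs (Hs i) z - iter_deriv vs H z) < e / 2"
  proof -
    have "e / 2 > 0" using e by simp
    from eventually_happens[OF smoothly_tends_upto_eventually[OF Hs(2) this]] show ?thesis by (meson sequentially_bot)
  qed
  then obtain i where i: "\<forall>z\<in>K. \<forall>vs. set vs \<subseteq> Basis \<and> length vs \<le> k \<longrightarrow> norm (iter_deriv vs (Hs i) z - iter_deriv vs H z) < e / 2"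
    by blast
  obtain F where F: "F \<in> L" "\<forall>z\<in>K. \<forall>vs. set vs \<subseteq> Basis \<and> length vs \<le> k \<longrightarrow> norm (iter_deriv vs F z - iter_deriv vs (Hs i) z) < e / 2"
  proof -
    have "e / 2 > 0" using e by simp
    then show ?thesis using Hs(1)[of i] that unfolding smooth_closure_def by blast
  qed
  have "norm (iter_deriv vs F z - iter_deriv vs H z) < e" if "z \<in> K" "set vs \<subseteq> Basis \<and> length vs \<le> k" for z vs
  proof -
    have "norm (iter_deriv vs F z - iter_deriv vs (Hs i) z) < e / 2" "norm (iter_deriv vs (Hs i) z - iter_deriv vs H z) < e / 2"
      using i F(2) that by auto
    then show ?thesis using norm_diff_triangle_less by (metis field_sum_of_halves)
  qed
  then show "\<exists>F\<in>L. \<forall>z\<in>K. \<forall>vs. set vs \<subseteq> Basis \<and> length vs \<le> k \<longrightarrow> norm (iter_deriv vs F z - iter_deriv vs H z) < e"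
    using F(1) by blast
qed (rule assms(1))

text \<open>A single sequence serves all orders of derivatives, which makes brackets of limits limits of
  brackets.\<close>

lemma smooth_closure_sequence:
  assumes "H \<in> smooth_closure U K L"
  obtains Fs where "\<And>i. Fs i \<in> L" "\<And>k. smoothly_tends_upto k K Fs H"
proof -
  have "\<exists>F\<in>L. \<forall>z\<in>K. \<forall>vs. set vs \<subseteq> Basis \<and> length vs \<le> i \<longrightarrow> norm (iter_deriv vs F z - iter_deriv vs H z) < 1 / real (Suc i)" for i
  proof -
    have "1 / real (Suc i) > 0" by simp
    then show ?thesis using assms unfolding smooth_closure_def by blast
  qed
  then obtain Fs where Fs: "\<And>i. Fs i \<in> L"
    "\<And>i z vs. z \<in> K \<Longrightarrow> set vs \<subseteq> Basis \<Longrightarrow> length vs \<le> i \<Longrightarrow> norm (iter_deriv vs (Fs i) z - iter_deriv vs H z) < 1 / real (Suc i)"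
    by metis
  have "uniform_limit K (\<lambda>i. iter_deriv vs (Fs i)) (iter_deriv vs H) sequentially" if "set vs \<subseteq> Basis" for vs
  proof (rule uniform_limitI)
    fix e :: real assume "e > 0"
    then have "eventually (\<lambda>i. 1 / real (Suc i) < e) sequentially"
      using order_tendstoD(2)[OF LIMSEQ_Suc[OF lim_1_over_n]] by blast
    then show "eventually (\<lambda>i. \<forall>x\<in>K. dist (iter_deriv vs (Fs i) x) (iter_deriv vs H x) < e) sequentially"
      using eventually_ge_at_top[of "length vs"]
    proof eventually_elim
      case (elim i)
      show ?case using Fs(2)[OF _ that elim(2)] elim(1) unfolding dist_norm by (meson less_trans)
    qed
  qed
  then have "smoothly_tends_upto k K Fs H" for k by (simp add: smoothly_tends_upto_def)
  with Fs(1) show thesis by (rule that)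
qed

lemma smooth_closureI:
  assumes "smooth_on U H" "\<And>i. Fs i \<in> L" "\<And>k. smoothly_tends_upto k K Fs H"
  shows "H \<in> smooth_closure U K L"
  unfolding smooth_closure_def
proof (intro CollectI conjI allI impI)
  fix k and e :: real assume "e > 0"
  from eventually_happens[OF smoothly_tends_upto_eventually[OF assms(3) this, of k]]
  show "\<exists>F\<in>L. \<forall>z\<in>K. \<forall>vs. set vs \<subseteq> Basis \<and> length vs \<le> k \<longrightarrow> norm (iter_deriv vs F z - iter_deriv vs H z) < e"
    using assms(2) sequentially_bot by blast
qed (rule assms(1))

section \<open>Hamiltonian vector fields of an exact symplectic form\<close>

locale exact_symplectic =
  fixes U :: "'a::euclidean_space set" and \<alpha> :: "'a \<Rightarrow> 'a \<Rightarrow> real"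
  assumes open_U: "open U"
    and smooth_\<alpha>: "\<And>\<eta>. smooth_on U (\<lambda>z. \<alpha> z \<eta>)"
    and linear_\<alpha>: "\<And>z. z \<in> U \<Longrightarrow> linear (\<alpha> z)"
    and nondegenerate: "\<And>z \<xi>. z \<in> U \<Longrightarrow> (\<And>\<eta>. ext_deriv \<alpha> z \<xi> \<eta> = 0) \<Longrightarrow> \<xi> = 0"
begin

definition \<omega> :: "'a \<Rightarrow> 'a \<Rightarrow> 'a \<Rightarrow> real" where
  "\<omega> = ext_deriv \<alpha>"

lemma frechet_\<alpha>_linear:
  assumes "z \<in> U" shows "linear (\<lambda>\<eta>. frechet_derivative (\<lambda>y. \<alpha> y \<eta>) (at z) \<xi>)"
proof (rule linearI)
  fix a b :: 'a and c :: real
  have "frechet_derivative (\<lambda>y. \<alpha> y (a + b)) (at z) = frechet_derivative (\<lambda>y. \<alpha> y a + \<alpha> y b) (at z)"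
    by (rule frechet_derivative_cong_open[OF open_U assms]) (simp add: linear_add[OF linear_\<alpha>])
  then show "frechet_derivative (\<lambda>y. \<alpha> y (a + b)) (at z) \<xi>
      = frechet_derivative (\<lambda>y. \<alpha> y a) (at z) \<xi> + frechet_derivative (\<lambda>y. \<alpha> y b) (at z) \<xi>"
    using smooth_on_frechet_add[OF smooth_\<alpha> smooth_\<alpha> assms] by simp
  have "frechet_derivative (\<lambda>y. \<alpha> y (c *\<^sub>R a)) (at z) = frechet_derivative (\<lambda>y. c * \<alpha> y a) (at z)"
    by (rule frechet_derivative_cong_open[OF open_U assms]) (simp add: linear_scale[OF linear_\<alpha>])
  then show "frechet_derivative (\<lambda>y. \<alpha> y (c *\<^sub>R a)) (at z) \<xi> = c *\<^sub>R frechet_derivative (\<lambda>y. \<alpha> y a) (at z) \<xi>"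
    using smooth_on_frechet_mult[OF smooth_on_const smooth_\<alpha> assms, of c a \<xi>] by simp
qed

lemma linear_frechet_\<alpha>: "z \<in> U \<Longrightarrow> linear (frechet_derivative (\<lambda>y. \<alpha> y \<eta>) (at z))"
  by (rule linear_frechet_derivative[OF smooth_on_differentiable[OF smooth_\<alpha>]])

lemma linear_\<omega>_right: "z \<in> U \<Longrightarrow> linear (\<omega> z \<xi>)"
  unfolding \<omega>_def ext_deriv_def
  by (rule linear_compose_sub[OF frechet_\<alpha>_linear linear_frechet_\<alpha>])

lemma linear_\<omega>_left: "z \<in> U \<Longrightarrow> linear (\<lambda>\<xi>. \<omega> z \<xi> \<eta>)"
  unfolding \<omega>_def ext_deriv_def
  by (rule linear_compose_sub[OF linear_frechet_\<alpha> frechet_\<alpha>_linear])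

lemma \<omega>_antisym: "\<omega> z \<xi> \<eta> = - \<omega> z \<eta> \<xi>"
  by (simp add: \<omega>_def ext_deriv_def)

lemma smooth_\<omega>: "smooth_on U (\<lambda>z. \<omega> z \<xi> \<eta>)"
  unfolding \<omega>_def ext_deriv_def by (intro smooth_on_diff open_U smooth_on_deriv smooth_\<alpha>)

definition d\<omega> :: "'a \<Rightarrow> 'a \<Rightarrow> 'a \<Rightarrow> 'a \<Rightarrow> real" where
  "d\<omega> z \<xi> a b = frechet_derivative (\<lambda>y. \<omega> y a b) (at z) \<xi>"

text \<open>\<open>\<omega>\<close> is closed because it is exact: the second derivatives of \<open>\<alpha>\<close> cancel in pairs by symmetry.\<close>

lemma d\<omega>_cyclic:
  assumes z: "z \<in> U" shows "d\<omega> z \<xi> a b + d\<omega> z a b \<xi> + d\<omega> z b \<xi> a = 0"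
proof -
  let ?S = "\<lambda>u v w. frechet_derivative (\<lambda>y. frechet_derivative (\<lambda>x. \<alpha> x w) (at y) v) (at z) u"
  have "d\<omega> z \<xi> a b = ?S \<xi> a b - ?S \<xi> b a" for \<xi> a b
    unfolding d\<omega>_def \<omega>_def ext_deriv_def
    using frechet_derivative_eqI[OF has_derivative_diff[OF
      smooth_on_has_derivative[OF smooth_on_deriv[OF smooth_\<alpha>] z] smooth_on_has_derivative[OF smooth_on_deriv[OF smooth_\<alpha>] z]]]
    by simp
  note this(1)[of \<xi> a b] this(1)[of a b \<xi>] this(1)[of b \<xi> a]
  moreover have "?S \<xi> a b = ?S a \<xi> b" "?S \<xi> b a = ?S b \<xi> a" "?S a b \<xi> = ?S b a \<xi>"
    by (rule smooth_on_second_derivative_symmetric[OF open_U smooth_\<alpha> z])+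
  ultimately show ?thesis by linarith
qed

lemma d\<omega>_antisym:
  assumes "z \<in> U" shows "d\<omega> z \<xi> a b = - d\<omega> z \<xi> b a"
proof -
  have "frechet_derivative (\<lambda>y. \<omega> y a b) (at z) = frechet_derivative (\<lambda>y. (-1) * \<omega> y b a) (at z)"
    using \<omega>_antisym[of _ a b] by (auto intro!: frechet_derivative_cong_open[OF open_U assms])
  then show ?thesis
    unfolding d\<omega>_def using smooth_on_frechet_mult[OF smooth_on_const smooth_\<omega> assms, of "-1"] by simp
qed

lemma frechet_derivative_\<omega>_fields:
  assumes Y: "smooth_on U Y" and Z: "smooth_on U Z" and z: "z \<in> U"
  shows "frechet_derivative (\<lambda>y. \<omega> y (Y y) (Z y)) (at z) \<xi>
    = d\<omega> z \<xi> (Y z) (Z z) + \<omega> z (frechet_derivative Y (at z) \<xi>) (Z z) + \<omega> z (Y z) (frechet_derivative Z (at z) \<xi>)"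
proof -
  have exp: "\<omega> y a b = (\<Sum>i\<in>Basis. \<Sum>j\<in>Basis. (a \<bullet> i) * (b \<bullet> j) * \<omega> y i j)" if "y \<in> U" for y a b
  proof -
    have "\<omega> y a b = (\<Sum>i\<in>Basis. (a \<bullet> i) *\<^sub>R \<omega> y i b)"
      by (rule linear_basis_expansion[OF linear_\<omega>_left[OF that]])
    also have "\<dots> = (\<Sum>i\<in>Basis. (a \<bullet> i) *\<^sub>R (\<Sum>j\<in>Basis. (b \<bullet> j) *\<^sub>R \<omega> y i j))"
      by (intro sum.cong refl arg_cong2[where f=scaleR] linear_basis_expansion[OF linear_\<omega>_right[OF that]])
    finally show ?thesis by (simp add: sum_distrib_left mult.assoc)
  qed
  have dexp: "d\<omega> z \<xi> a b = (\<Sum>i\<in>Basis. \<Sum>j\<in>Basis. (a \<bullet> i) * (b \<bullet> j) * d\<omega> z \<xi> i j)" for a b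
  proof -
    have "d\<omega> z \<xi> a b = frechet_derivative (\<lambda>y. \<Sum>i\<in>Basis. \<Sum>j\<in>Basis. (a \<bullet> i) * (b \<bullet> j) * \<omega> y i j) (at z) \<xi>"
      unfolding d\<omega>_def by (rule fun_cong[OF frechet_derivative_cong_open[OF open_U z exp]])
    also have "\<dots> = (\<Sum>i\<in>Basis. \<Sum>j\<in>Basis. (a \<bullet> i) * (b \<bullet> j) * frechet_derivative (\<lambda>y. \<omega> y i j) (at z) \<xi>)"
    proof -
      have "((\<lambda>y. \<Sum>i\<in>Basis. \<Sum>j\<in>Basis. (a \<bullet> i) * (b \<bullet> j) * \<omega> y i j) has_derivative
        (\<lambda>\<xi>. \<Sum>i\<in>Basis. \<Sum>j\<in>Basis. (a \<bullet> i) * (b \<bullet> j) * frechet_derivative (\<lambda>y. \<omega> y i j) (at z) \<xi>)) (at z)"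
        by (intro has_derivative_sum has_derivative_mult_right smooth_on_has_derivative[OF smooth_\<omega> z])
      then show ?thesis by (rule fun_cong[OF frechet_derivative_eqI])
    qed
    finally show ?thesis by (simp add: d\<omega>_def)
  qed
  let ?Y' = "frechet_derivative Y (at z)" and ?Z' = "frechet_derivative Z (at z)"
  have "frechet_derivative (\<lambda>y. \<omega> y (Y y) (Z y)) (at z)
      = frechet_derivative (\<lambda>y. \<Sum>i\<in>Basis. \<Sum>j\<in>Basis. (Y y \<bullet> i) * (Z y \<bullet> j) * \<omega> y i j) (at z)"
    by (rule frechet_derivative_cong_open[OF open_U z exp])
  also have "\<dots> = (\<lambda>\<xi>. \<Sum>i\<in>Basis. \<Sum>j\<in>Basis. (Y z \<bullet> i) * (Z z \<bullet> j) * frechet_derivative (\<lambda>y. \<omega> y i j) (at z) \<xi>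
      + ((Y z \<bullet> i) * (?Z' \<xi> \<bullet> j) + (?Y' \<xi> \<bullet> i) * (Z z \<bullet> j)) * \<omega> z i j)"
    by (rule frechet_derivative_eqI)
      (intro has_derivative_sum has_derivative_mult has_derivative_inner_left smooth_on_has_derivative[OF smooth_\<omega> z]
        smooth_on_has_derivative[OF Y z] smooth_on_has_derivative[OF Z z])
  finally have "frechet_derivative (\<lambda>y. \<omega> y (Y y) (Z y)) (at z) \<xi> = (\<Sum>i\<in>Basis. \<Sum>j\<in>Basis. (Y z \<bullet> i) * (Z z \<bullet> j) * d\<omega> z \<xi> i j
      + ((Y z \<bullet> i) * (?Z' \<xi> \<bullet> j) + (?Y' \<xi> \<bullet> i) * (Z z \<bullet> j)) * \<omega> z i j)"
    unfolding d\<omega>_def by meson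
  also have "\<dots> = d\<omega> z \<xi> (Y z) (Z z) + \<omega> z (?Y' \<xi>) (Z z) + \<omega> z (Y z) (?Z' \<xi>)"
  proof -
    show ?thesis
      by (simp only: dexp[of "Y z" "Z z"] exp[OF z, of "?Y' \<xi>"] exp[OF z, of "Y z"] distrib_right sum.distrib add.assoc add.commute)
  qed
  finally show ?thesis .
qed

text \<open>Differentiate the equations \<open>\<omega> (X, \<zeta>) = dF \<zeta>\<close> and \<open>\<omega> (Y, \<zeta>) = dG \<zeta>\<close> along \<open>Y\<close>, \<open>X\<close> and \<open>\<zeta>\<close>. The
  derivatives of \<open>\<omega>\<close> that appear cancel since \<open>\<omega>\<close> is closed, and those of \<open>dF\<close> and \<open>dG\<close> by symmetry
  of second derivatives.\<close>

theorem lie_bracket_hamiltonian: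
  assumes X: "smooth_on U X" and Y: "smooth_on U Y" and F: "smooth_on U F" and G: "smooth_on U G"
    and XF: "\<And>z \<eta>. z \<in> U \<Longrightarrow> \<omega> z (X z) \<eta> = frechet_derivative F (at z) \<eta>"
    and YG: "\<And>z \<eta>. z \<in> U \<Longrightarrow> \<omega> z (Y z) \<eta> = frechet_derivative G (at z) \<eta>"
    and z: "z \<in> U"
  shows "\<omega> z (lie_bracket X Y z) \<zeta> = frechet_derivative (\<lambda>y. frechet_derivative G (at y) (X y)) (at z) \<zeta>"
proof -
  let ?D = "\<lambda>F u v. frechet_derivative (\<lambda>y. frechet_derivative F (at y) v) (at z) u"
  have const: "frechet_derivative (\<lambda>y. \<omega> y (Z y) \<eta>) (at z) \<xi> = d\<omega> z \<xi> (Z z) \<eta> + \<omega> z (frechet_derivative Z (at z) \<xi>) \<eta>"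
    if "smooth_on U Z" for Z \<xi> \<eta>
    using frechet_derivative_\<omega>_fields[OF that smooth_on_const z, of \<eta> \<xi>] linear_0[OF linear_\<omega>_right[OF z]] by simp
  have dX: "d\<omega> z \<xi> (X z) \<eta> + \<omega> z (frechet_derivative X (at z) \<xi>) \<eta> = ?D F \<xi> \<eta>" for \<xi> \<eta>
    unfolding const[OF X, symmetric] by (rule fun_cong[OF frechet_derivative_cong_open[OF open_U z XF]])
  have dY: "d\<omega> z \<xi> (Y z) \<eta> + \<omega> z (frechet_derivative Y (at z) \<xi>) \<eta> = ?D G \<xi> \<eta>" for \<xi> \<eta>
    unfolding const[OF Y, symmetric] by (rule fun_cong[OF frechet_derivative_cong_open[OF open_U z YG]])
  have "frechet_derivative (\<lambda>y. frechet_derivative G (at y) (X y)) (at z) \<zeta>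
      = frechet_derivative (\<lambda>y. \<omega> y (Y y) (X y)) (at z) \<zeta>"
    by (rule fun_cong[OF frechet_derivative_cong_open[OF open_U z]]) (simp add: YG)
  also have "\<dots> = d\<omega> z \<zeta> (Y z) (X z) + \<omega> z (frechet_derivative Y (at z) \<zeta>) (X z)
      + \<omega> z (Y z) (frechet_derivative X (at z) \<zeta>)"
    by (rule frechet_derivative_\<omega>_fields[OF Y X z])
  also have "\<dots> = ?D G \<zeta> (X z) - (?D F \<zeta> (Y z) - d\<omega> z \<zeta> (X z) (Y z))"
    using dY[of \<zeta> "X z"] dX[of \<zeta> "Y z"] \<omega>_antisym[of z "Y z"] by simp
  also have "\<dots> = \<omega> z (frechet_derivative Y (at z) (X z)) \<zeta> - \<omega> z (frechet_derivative X (at z) (Y z)) \<zeta>"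
    using dY[of "X z" \<zeta>] dX[of "Y z" \<zeta>] d\<omega>_cyclic[OF z, of \<zeta> "X z" "Y z"] d\<omega>_antisym[OF z, of "Y z" "X z" \<zeta>]
      smooth_on_second_derivative_symmetric[OF open_U F z, of \<zeta> "Y z"]
      smooth_on_second_derivative_symmetric[OF open_U G z, of \<zeta> "X z"] by linarith
  finally show ?thesis unfolding lie_bracket_def using linear_diff[OF linear_\<omega>_left[OF z]] by simp
qed

definition flat :: "'a \<Rightarrow> 'a \<Rightarrow> 'a" where
  "flat z \<xi> = (\<Sum>c\<in>Basis. \<omega> z \<xi> c *\<^sub>R c)"

lemma flat_inner: "z \<in> U \<Longrightarrow> flat z \<xi> \<bullet> \<eta> = \<omega> z \<xi> \<eta>"
  unfolding flat_def using linear_basis_expansion[OF linear_\<omega>_right, of z \<xi> \<eta>]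
  by (simp add: inner_sum_left inner_commute[of \<eta>] mult.commute)

lemma linear_flat: "z \<in> U \<Longrightarrow> linear (flat z)"
  unfolding flat_def[abs_def]
  by (intro linear_compose_sum ballI linear_compose[OF linear_\<omega>_left, unfolded o_def]) (auto intro: linearI simp: scaleR_add_left)

lemma inj_flat: assumes "z \<in> U" shows "inj (flat z)"
  unfolding linear_injective_0[OF linear_flat[OF assms]]
  by (metis \<omega>_def assms flat_inner inner_zero_left nondegenerate)

lemma smooth_flat: "smooth_on U (\<lambda>z. flat z \<xi>)"
  unfolding flat_def by (intro smooth_on_sum smooth_on_scaleR smooth_\<omega> smooth_on_const open_U)

definition sharp :: "'a \<Rightarrow> 'a \<Rightarrow> 'a" where
  "sharp z = inv (flat z)"

lemma flat_sharp: "z \<in> U \<Longrightarrow> flat z (sharp z b) = b"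
  unfolding sharp_def by (meson inj_flat linear_flat linear_inj_imp_surj surj_f_inv_f)

lemma smooth_sharp: "smooth_on U (\<lambda>z. sharp z b)"
  by (rule smooth_on_linear_system_solution[where T=flat and y="\<lambda>_. b"])
    (simp_all add: open_U linear_flat inj_flat smooth_flat flat_sharp)

text \<open>The expansion in the fields dual to the basis shows at once that \<open>ham F\<close> is smooth and depends on
  \<open>F\<close> through a differential operator of first order.\<close>

definition ham :: "('a \<Rightarrow> real) \<Rightarrow> 'a \<Rightarrow> 'a" where
  "ham F z = (\<Sum>b\<in>Basis. frechet_derivative F (at z) b *\<^sub>R sharp z b)"

lemma \<omega>_ham:
  assumes "z \<in> U" "F differentiable (at z)"
  shows "\<omega> z (ham F z) \<eta> = frechet_derivative F (at z) \<eta>"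
proof -
  have "\<omega> z (ham F z) \<eta> = (\<Sum>b\<in>Basis. frechet_derivative F (at z) b * \<omega> z (sharp z b) \<eta>)"
    unfolding ham_def by (simp add: linear_sum[OF linear_\<omega>_left[OF assms(1)]] linear_scale[OF linear_\<omega>_left[OF assms(1)]])
  also have "\<dots> = (\<Sum>b\<in>Basis. (\<eta> \<bullet> b) *\<^sub>R frechet_derivative F (at z) b)"
    using flat_inner[OF assms(1), of "sharp z _" \<eta>] flat_sharp[OF assms(1)]
    by (intro sum.cong) (auto simp: inner_commute)
  finally show ?thesis using linear_basis_expansion[OF linear_frechet_derivative[OF assms(2)], of \<eta>] by simp
qed

lemma ham_unique:
  assumes "z \<in> U" "F differentiable (at z)" "\<And>\<eta>. \<omega> z \<xi> \<eta> = frechet_derivative F (at z) \<eta>"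
  shows "\<xi> = ham F z"
proof -
  have "\<omega> z (\<xi> - ham F z) \<eta> = 0" for \<eta>
    using linear_diff[OF linear_\<omega>_left[OF assms(1)]] \<omega>_ham[OF assms(1,2)] assms(3) by simp
  then have "\<xi> - ham F z = 0" using nondegenerate[OF assms(1)] unfolding \<omega>_def by blast
  then show ?thesis by simp
qed

lemma smooth_ham: "smooth_on U F \<Longrightarrow> smooth_on U (ham F)"
  unfolding ham_def[abs_def] by (intro smooth_on_sum smooth_on_scaleR smooth_on_deriv smooth_sharp open_U)

definition poisson :: "('a \<Rightarrow> real) \<Rightarrow> ('a \<Rightarrow> real) \<Rightarrow> 'a \<Rightarrow> real" where
  "poisson F G z = frechet_derivative G (at z) (ham F z)"

lemma smooth_poisson: "smooth_on U F \<Longrightarrow> smooth_on U G \<Longrightarrow> smooth_on U (poisson F G)"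
  unfolding poisson_def[abs_def] by (rule smooth_on_deriv_along[OF open_U _ smooth_ham])

lemma poisson_antisym:
  assumes "smooth_on U F" "smooth_on U G" "z \<in> U" shows "poisson F G z = - poisson G F z"
  unfolding poisson_def
  using \<omega>_ham[OF assms(3) smooth_on_differentiable[OF assms(1,3)]] \<omega>_ham[OF assms(3) smooth_on_differentiable[OF assms(2,3)]]
    \<omega>_antisym by metis

lemma poisson_mult:
  assumes "smooth_on U F" "smooth_on U G" "smooth_on U H" "z \<in> U"
  shows "poisson F (\<lambda>z. G z * H z) z = G z * poisson F H z + poisson F G z * H z"
  unfolding poisson_def using smooth_on_frechet_mult[OF assms(2-)] by simp

lemma poisson_mult_left:
  assumes "smooth_on U F" "smooth_on U G" "smooth_on U H" "z \<in> U"
  shows "poisson (\<lambda>z. F z * G z) H z = F z * poisson G H z + poisson F H z * G z"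
  using poisson_mult[OF assms(3,1,2,4)] poisson_antisym[OF smooth_on_mult[OF open_U assms(1,2)] assms(3,4)]
    poisson_antisym[OF assms(1,3,4)] poisson_antisym[OF assms(2,3,4)] by simp

lemma smoothly_tends_ham:
  assumes K: "compact K" "K \<subseteq> U" and F: "smooth_on U F" "\<And>i. smooth_on U (Fs i)" "smoothly_tends_upto (Suc k) K Fs F"
  shows "smoothly_tends_upto k K (\<lambda>i. ham (Fs i)) (ham F)"
  unfolding ham_def[abs_def]
  using F(3) unfolding smoothly_tends_upto_Suc
  by (intro smoothly_tends_upto_sum[OF open_U K(2)] smoothly_tends_upto_bilinear[OF bounded_bilinear_scaleR open_U K(2,1)]
      smooth_on_scaleR smooth_on_deriv smooth_sharp open_U F smoothly_tends_upto_const) auto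

lemma smoothly_tends_poisson:
  assumes K: "compact K" "K \<subseteq> U" and F: "smooth_on U F" "\<And>i. smooth_on U (Fs i)" "smoothly_tends_upto (Suc k) K Fs F"
    and G: "smooth_on U G" "\<And>i. smooth_on U (Gs i)" "smoothly_tends_upto (Suc k) K Gs G"
  shows "smoothly_tends_upto k K (\<lambda>i. poisson (Fs i) (Gs i)) (poisson F G)"
proof -
  have exp: "(\<Sum>b\<in>Basis. (ham F z \<bullet> b) *\<^sub>R frechet_derivative G (at z) b) = poisson F G z" if "smooth_on U G" "z \<in> U" for F G z
    unfolding poisson_def using linear_basis_expansion[OF linear_frechet_derivative[OF smooth_on_differentiable[OF that]]] by metis
  have "smoothly_tends_upto k K (\<lambda>i z. \<Sum>b\<in>Basis. (ham (Fs i) z \<bullet> b) *\<^sub>R frechet_derivative (Gs i) (at z) b)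
     (\<lambda>z. \<Sum>b\<in>Basis. (ham F z \<bullet> b) *\<^sub>R frechet_derivative G (at z) b)"
    using G(3) smoothly_tends_ham[OF K F] unfolding smoothly_tends_upto_Suc
    by (intro smoothly_tends_upto_sum[OF open_U K(2)] smoothly_tends_upto_bilinear[OF bounded_bilinear_scaleR open_U K(2,1)]
        smoothly_tends_upto_bilinear[OF bounded_bilinear_inner open_U K(2,1)]
        smooth_on_scaleR smooth_on_inner smooth_on_const smooth_on_deriv smooth_ham open_U F G smoothly_tends_upto_const) auto
  then show ?thesis
    by (rule smoothly_tends_upto_cong[OF open_U K(2), rotated -1]) (auto simp: exp[unfolded real_scaleR_def] G)
qed

lemma lie_algebra_generated_hamiltonian:
  assumes "X \<in> lie_algebra_generated \<G>" "\<G> \<subseteq> hamiltonian_fields U \<omega>"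
  shows "X \<in> hamiltonian_fields U \<omega>"
  using assms(1)
proof induction
  case (gen X)
  then show ?case using assms(2) by blast
next
  case zero
  show ?case unfolding hamiltonian_fields_def
    by (auto intro!: exI[of _ "\<lambda>_. 0"] simp: linear_0[OF linear_\<omega>_left])
next
  case (add X Y)
  then obtain F G where *: "smooth_on U X" "smooth_on U Y" "smooth_on U F" "smooth_on U G"
    "\<And>z \<eta>. z \<in> U \<Longrightarrow> \<omega> z (X z) \<eta> = frechet_derivative F (at z) \<eta>"
    "\<And>z \<eta>. z \<in> U \<Longrightarrow> \<omega> z (Y z) \<eta> = frechet_derivative G (at z) \<eta>" unfolding hamiltonian_fields_def by blast
  then show ?case unfolding hamiltonian_fields_def
    by (intro CollectI conjI exI[of _ "\<lambda>z. F z + G z"] smooth_on_add open_U)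
      (auto simp: smooth_on_frechet_add linear_add[OF linear_\<omega>_left])
next
  case (scale X c)
  then obtain F where *: "smooth_on U X" "smooth_on U F"
    "\<And>z \<eta>. z \<in> U \<Longrightarrow> \<omega> z (X z) \<eta> = frechet_derivative F (at z) \<eta>" unfolding hamiltonian_fields_def by blast
  then show ?case unfolding hamiltonian_fields_def
    by (intro CollectI conjI exI[of _ "\<lambda>z. c * F z"] smooth_on_scaleR smooth_on_mult open_U smooth_on_const)
      (auto simp: smooth_on_frechet_mult[OF smooth_on_const] linear_scale[OF linear_\<omega>_left])
next
  case (bracket X Y)
  then obtain F G where *: "smooth_on U X" "smooth_on U Y" "smooth_on U F" "smooth_on U G"
    "\<And>z \<eta>. z \<in> U \<Longrightarrow> \<omega> z (X z) \<eta> = frechet_derivative F (at z) \<eta>"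
    "\<And>z \<eta>. z \<in> U \<Longrightarrow> \<omega> z (Y z) \<eta> = frechet_derivative G (at z) \<eta>" unfolding hamiltonian_fields_def by blast
  show ?case unfolding hamiltonian_fields_def
  proof (intro CollectI conjI exI[of _ "\<lambda>y. frechet_derivative G (at y) (X y)"] ballI allI)
    show "smooth_on U (lie_bracket X Y)" unfolding lie_bracket_def
      by (intro smooth_on_diff smooth_on_deriv_along open_U *)
    show "smooth_on U (\<lambda>y. frechet_derivative G (at y) (X y))" by (intro smooth_on_deriv_along open_U *)
  qed (rule lie_bracket_hamiltonian[OF *])
qed

text \<open>Elements of a generated Lie algebra are arbitrary outside \<open>U\<close>, so Hamiltonian fields can only be
  compared with them on \<open>U\<close>.\<close>

definition hamiltonians :: "('a \<Rightarrow> 'a) set \<Rightarrow> ('a \<Rightarrow> real) set" where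
  "hamiltonians \<L> = {F. smooth_on U F \<and> (\<exists>X\<in>\<L>. \<forall>z\<in>U. X z = ham F z)}"

lemma hamiltoniansI:
  "smooth_on U F \<Longrightarrow> X \<in> \<L> \<Longrightarrow> (\<And>z. z \<in> U \<Longrightarrow> X z = ham F z) \<Longrightarrow> F \<in> hamiltonians \<L>"
  unfolding hamiltonians_def by blast

lemma hamiltonians_add:
  assumes "F \<in> hamiltonians (lie_algebra_generated \<G>)" "G \<in> hamiltonians (lie_algebra_generated \<G>)"
  shows "(\<lambda>z. F z + G z) \<in> hamiltonians (lie_algebra_generated \<G>)"
proof -
  obtain X Y where *: "smooth_on U F" "smooth_on U G" "X \<in> lie_algebra_generated \<G>" "Y \<in> lie_algebra_generated \<G>"
    "\<And>z. z \<in> U \<Longrightarrow> X z = ham F z" "\<And>z. z \<in> U \<Longrightarrow> Y z = ham G z" using assms unfolding hamiltonians_def by blast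
  then have "X z + Y z = ham (\<lambda>z. F z + G z) z" if "z \<in> U" for z
    using that by (simp add: ham_def smooth_on_frechet_add[OF *(1,2)] scaleR_add_left sum.distrib)
  then show ?thesis by (rule hamiltoniansI[OF smooth_on_add[OF open_U *(1,2)] lie_algebra_generated.add[OF *(3,4)]])
qed

lemma hamiltonians_scale:
  assumes "F \<in> hamiltonians (lie_algebra_generated \<G>)"
  shows "(\<lambda>z. c * F z) \<in> hamiltonians (lie_algebra_generated \<G>)"
proof -
  obtain X where *: "smooth_on U F" "X \<in> lie_algebra_generated \<G>"
    "\<And>z. z \<in> U \<Longrightarrow> X z = ham F z" using assms unfolding hamiltonians_def by blast
  then have "c *\<^sub>R X z = ham (\<lambda>z. c * F z) z" if "z \<in> U" for z
    using that by (simp add: ham_def smooth_on_frechet_mult[OF smooth_on_const *(1)] scaleR_sum_right)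
  then show ?thesis by (rule hamiltoniansI[OF smooth_on_mult[OF open_U smooth_on_const *(1)] lie_algebra_generated.scale[OF *(2)]])
qed

lemma hamiltonians_poisson:
  assumes "F \<in> hamiltonians (lie_algebra_generated \<G>)" "G \<in> hamiltonians (lie_algebra_generated \<G>)"
  shows "poisson F G \<in> hamiltonians (lie_algebra_generated \<G>)"
proof -
  obtain X Y where *: "smooth_on U F" "smooth_on U G" "X \<in> lie_algebra_generated \<G>" "Y \<in> lie_algebra_generated \<G>"
    "\<And>z. z \<in> U \<Longrightarrow> X z = ham F z" "\<And>z. z \<in> U \<Longrightarrow> Y z = ham G z" using assms unfolding hamiltonians_def by blast
  have "lie_bracket X Y z = ham (poisson F G) z" if z: "z \<in> U" for z
  proof (rule ham_unique[OF z smooth_on_differentiable[OF smooth_poisson[OF *(1,2)] z]])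
    have "lie_bracket X Y z = lie_bracket (ham F) (ham G) z"
      unfolding lie_bracket_def
      using frechet_derivative_cong_open[OF open_U z *(5)] frechet_derivative_cong_open[OF open_U z *(6)] *(5,6)[OF z] by simp
    moreover have "\<omega> z (lie_bracket (ham F) (ham G) z) \<eta> = frechet_derivative (poisson F G) (at z) \<eta>" for \<eta>
      unfolding poisson_def[abs_def]
      by (rule lie_bracket_hamiltonian[OF smooth_ham[OF *(1)] smooth_ham[OF *(2)] *(1,2) _ _ z])
        (auto intro: \<omega>_ham smooth_on_differentiable *(1,2))
    ultimately show "\<omega> z (lie_bracket X Y z) \<eta> = frechet_derivative (poisson F G) (at z) \<eta>" for \<eta> by simp
  qed
  then show ?thesis by (rule hamiltoniansI[OF smooth_poisson[OF *(1,2)] lie_algebra_generated.bracket[OF *(3,4)]])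
qed

theorem C_infinity_dense_hamiltonian:
  assumes \<G>: "\<G> \<subseteq> hamiltonian_fields U \<omega>"
    and dense: "\<And>K H. compact K \<Longrightarrow> K \<subseteq> U \<Longrightarrow> smooth_on U H \<Longrightarrow>
      H \<in> smooth_closure U K (hamiltonians (lie_algebra_generated \<G>))"
  shows "C_infinity_dense U (lie_algebra_generated \<G>) (hamiltonian_fields U \<omega>)"
  unfolding C_infinity_dense_def
proof (intro conjI ballI allI impI subsetI)
  show "X \<in> hamiltonian_fields U \<omega>" if "X \<in> lie_algebra_generated \<G>" for X
    by (rule lie_algebra_generated_hamiltonian[OF that \<G>])
  fix X K k and e :: real
  assume "X \<in> hamiltonian_fields U \<omega>" and K: "compact K \<and> K \<subseteq> U \<and> 0 < e"
  then obtain H where H: "smooth_on U X" "smooth_on U H"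
    "\<And>z \<eta>. z \<in> U \<Longrightarrow> \<omega> z (X z) \<eta> = frechet_derivative H (at z) \<eta>" unfolding hamiltonian_fields_def by blast
  have X: "X z = ham H z" if "z \<in> U" for z
    by (rule ham_unique[OF that smooth_on_differentiable[OF H(2) that] H(3)[OF that]])
  obtain Fs where Fs: "\<And>i. Fs i \<in> hamiltonians (lie_algebra_generated \<G>)" "\<And>k. smoothly_tends_upto k K Fs H"
    using smooth_closure_sequence[OF dense] K H(2) by blast
  have "smoothly_tends_upto k K (\<lambda>i. ham (Fs i)) (ham H)"
    by (rule smoothly_tends_ham[OF _ _ H(2) _ Fs(2)]) (use K Fs(1) in \<open>auto simp: hamiltonians_def\<close>)
  from eventually_happens[OF smoothly_tends_upto_eventually[OF this, of e]] K
  obtain i where i: "\<forall>z\<in>K. \<forall>vs. set vs \<subseteq> Basis \<and> length vs \<le> k \<longrightarrow>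
     norm (iter_deriv vs (ham (Fs i)) z - iter_deriv vs (ham H) z) < e"
    using sequentially_bot by blast
  obtain Y where Y: "Y \<in> lie_algebra_generated \<G>" "\<And>z. z \<in> U \<Longrightarrow> Y z = ham (Fs i) z"
    using Fs(1)[of i] unfolding hamiltonians_def by blast
  have "iter_deriv vs Y z = iter_deriv vs (ham (Fs i)) z" "iter_deriv vs X z = iter_deriv vs (ham H) z" if "z \<in> K" for z and vs :: "'a list"
    using that K by (auto intro!: iter_deriv_cong_open[OF open_U] Y X)
  then show "\<exists>Y\<in>lie_algebra_generated \<G>. \<forall>z\<in>K. \<forall>vs. set vs \<subseteq> Basis \<and> length vs \<le> k \<longrightarrow>
      norm (iter_deriv vs Y z - iter_deriv vs X z) < e"
    using i by (intro bexI[OF _ Y(1)]) simp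
qed

end

section \<open>Generation from fibrewise spheres\<close>

text \<open>The maps \<open>W s\<close> embed the fibres of \<open>(s, w) \<mapsto> s\<close> linearly into a Euclidean space, and \<open>L\<close> is a Poisson
  algebra that contains \<open>b(s) sqrt (1 - \<bar>W s w\<bar>\<^sup>2)\<close> for all smooth \<open>b\<close>. Hamiltonian fields of functions
  of \<open>s\<close> are vertical; the coefficients \<open>c\<close> express the fibre directions through the fields of the
  coordinates of \<open>s\<close>.\<close>

locale fibrewise_generation = exact_symplectic U \<alpha>
  for U :: "('a::euclidean_space \<times> 'b::euclidean_space) set" and \<alpha> +
  fixes D :: "'a set" and W :: "'a \<Rightarrow> 'b \<Rightarrow> 'e::euclidean_space"
    and c :: "'b \<Rightarrow> 'a \<Rightarrow> 'a \<Rightarrow> real" and L :: "('a \<times> 'b \<Rightarrow> real) set" and K :: "('a \<times> 'b) set"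
  assumes open_D: "open D" and base: "fst ` U \<subseteq> D" and K: "compact K" "K \<subseteq> U"
    and smooth_W: "\<And>j. smooth_on D (\<lambda>s. W s j)"
    and linear_W: "\<And>s. s \<in> D \<Longrightarrow> linear (W s)" and inj_W: "\<And>s. s \<in> D \<Longrightarrow> inj (W s)"
    and W_less_1: "\<And>z. z \<in> U \<Longrightarrow> norm (W (fst z) (snd z)) < 1"
    and vertical: "\<And>b z. smooth_on D b \<Longrightarrow> z \<in> U \<Longrightarrow> fst (ham (\<lambda>z. b (fst z)) z) = 0"
    and smooth_c: "\<And>i j. smooth_on D (c j i)"
    and spanning: "\<And>j z. j \<in> Basis \<Longrightarrow> z \<in> U \<Longrightarrow>
      (0, j) = (\<Sum>i\<in>Basis. c j i (fst z) *\<^sub>R ham (\<lambda>z. fst z \<bullet> i) z)"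
    and L_smooth: "\<And>F. F \<in> L \<Longrightarrow> smooth_on U F"
    and L_add: "\<And>F G. F \<in> L \<Longrightarrow> G \<in> L \<Longrightarrow> (\<lambda>z. F z + G z) \<in> L"
    and L_scale: "\<And>F a. F \<in> L \<Longrightarrow> (\<lambda>z. a * F z) \<in> L"
    and L_poisson: "\<And>F G. F \<in> L \<Longrightarrow> G \<in> L \<Longrightarrow> poisson F G \<in> L"
    and L_gen: "\<And>b. smooth_on D b \<Longrightarrow> (\<lambda>z. b (fst z) * (1 - (norm (W (fst z) (snd z)))\<^sup>2) powr (1/2)) \<in> L"
begin

definition M :: "('a \<times> 'b \<Rightarrow> real) set" where
  "M = smooth_closure U K L"

lemma M_smooth: "F \<in> M \<Longrightarrow> smooth_on U F"
  by (simp add: M_def smooth_closure_def)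

lemma M_I: "F \<in> L \<Longrightarrow> F \<in> M"
  unfolding M_def by (rule smooth_closureI[of _ _ "\<lambda>_. F"]) (auto intro: L_smooth smoothly_tends_upto_const)

lemma M_cong:
  assumes "F \<in> M" "\<And>z. z \<in> U \<Longrightarrow> F z = G z" shows "G \<in> M"
proof -
  obtain Fs where "\<And>i. Fs i \<in> L" "\<And>k. smoothly_tends_upto k K Fs F"
    using assms(1) smooth_closure_sequence unfolding M_def by metis
  then show ?thesis unfolding M_def
    by (intro smooth_closureI[of U G Fs] smooth_on_cong[OF open_U assms(2) M_smooth[OF assms(1)]]
        smoothly_tends_upto_cong[OF open_U K(2) _ assms(2)]) auto
qed

lemma M_add: assumes "F \<in> M" "G \<in> M" shows "(\<lambda>z. F z + G z) \<in> M"
proof -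
  obtain Fs Gs where *: "\<And>i. Fs i \<in> L" "\<And>k. smoothly_tends_upto k K Fs F" "\<And>i. Gs i \<in> L" "\<And>k. smoothly_tends_upto k K Gs G"
    using assms smooth_closure_sequence unfolding M_def by metis
  show ?thesis unfolding M_def
    by (rule smooth_closureI[of _ _ "\<lambda>i z. Fs i z + Gs i z"])
      (simp_all add: smooth_on_add open_U M_smooth assms L_add * smoothly_tends_upto_add[OF open_U K(2)] L_smooth)
qed

lemma M_scale: assumes "F \<in> M" shows "(\<lambda>z. a * F z) \<in> M"
proof -
  obtain Fs where *: "\<And>i. Fs i \<in> L" "\<And>k. smoothly_tends_upto k K Fs F"
    using assms smooth_closure_sequence unfolding M_def by metis
  show ?thesis unfolding M_def
    by (rule smooth_closureI[of _ _ "\<lambda>i z. a * Fs i z"])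
      (simp_all add: smooth_on_mult open_U M_smooth assms L_scale * L_smooth smoothly_tends_upto_const
          smoothly_tends_upto_bilinear[OF bounded_bilinear_mult open_U K(2,1)])
qed

lemma M_poisson: assumes "F \<in> M" "G \<in> M" shows "poisson F G \<in> M"
proof -
  obtain Fs Gs where *: "\<And>i. Fs i \<in> L" "\<And>k. smoothly_tends_upto k K Fs F" "\<And>i. Gs i \<in> L" "\<And>k. smoothly_tends_upto k K Gs G"
    using assms smooth_closure_sequence unfolding M_def by metis
  show ?thesis unfolding M_def
    by (rule smooth_closureI[of _ _ "\<lambda>i. poisson (Fs i) (Gs i)"])
      (simp_all add: smooth_poisson M_smooth assms L_poisson * L_smooth smoothly_tends_poisson[OF K])
qed

lemma M_limit:
  assumes "smooth_on U H" "\<And>k. \<exists>Hs. (\<forall>i. Hs i \<in> M) \<and> smoothly_tends_upto k K Hs H" shows "H \<in> M"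
  using smooth_closureI_limit[of U H K L] assms unfolding M_def by simp

lemma smooth_base: "smooth_on D b \<Longrightarrow> smooth_on U (\<lambda>z. b (fst z))"
  by (rule smooth_on_fst[OF open_U open_D _ base])

lemma poisson_base_base:
  assumes "smooth_on D b" "smooth_on D b'" "z \<in> U"
  shows "poisson (\<lambda>z. b (fst z)) (\<lambda>z. b' (fst z)) z = 0"
proof -
  have "b' differentiable (at (fst z))" using smooth_on_differentiable[OF assms(2)] base assms(3) by blast
  then have "((\<lambda>z. b' (fst z)) has_derivative (\<lambda>v. frechet_derivative b' (at (fst z)) (fst v))) (at z)"
    using has_derivative_compose[OF has_derivative_fst[OF has_derivative_ident] differentiable_has_frechet, of b' z UNIV] by simp
  from frechet_derivative_eqI[OF this] show ?thesis
    unfolding poisson_def using vertical[OF assms(1,3)]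
      linear_0[OF linear_frechet_derivative[OF \<open>b' differentiable (at (fst z))\<close>]] by simp
qed

text \<open>The largest \<open>C\<^sup>\<infinity>(D)\<close>-module contained in the closure.\<close>

definition \<M> :: "('a \<times> 'b \<Rightarrow> real) set" where
  "\<M> = {X. smooth_on U X \<and> (\<forall>b. smooth_on D b \<longrightarrow> (\<lambda>z. b (fst z) * X z) \<in> M)}"

lemma \<M>_smooth: "X \<in> \<M> \<Longrightarrow> smooth_on U X"
  by (simp add: \<M>_def)

lemma \<M>_base_M: "X \<in> \<M> \<Longrightarrow> smooth_on D b \<Longrightarrow> (\<lambda>z. b (fst z) * X z) \<in> M"
  by (simp add: \<M>_def)

lemma \<M>_imp_M: "X \<in> \<M> \<Longrightarrow> X \<in> M"
  using \<M>_base_M[of X "\<lambda>_. 1"] by simp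

lemma \<M>_cong: assumes "X \<in> \<M>" "\<And>z. z \<in> U \<Longrightarrow> X z = Y z" shows "Y \<in> \<M>"
  unfolding \<M>_def
proof (intro CollectI conjI allI impI)
  show "smooth_on U Y" using smooth_on_cong[OF open_U assms(2) \<M>_smooth[OF assms(1)]] .
  show "smooth_on D b \<Longrightarrow> (\<lambda>z. b (fst z) * Y z) \<in> M" for b :: "'a \<Rightarrow> real"
    by (rule M_cong[OF \<M>_base_M[OF assms(1)]]) (auto simp: assms(2))
qed

lemma \<M>_add: assumes "X \<in> \<M>" "Y \<in> \<M>" shows "(\<lambda>z. X z + Y z) \<in> \<M>"
  unfolding \<M>_def
proof (intro CollectI conjI allI impI)
  show "smooth_on U (\<lambda>z. X z + Y z)" by (intro smooth_on_add open_U \<M>_smooth assms)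
  show "smooth_on D b \<Longrightarrow> (\<lambda>z. b (fst z) * (X z + Y z)) \<in> M" for b :: "'a \<Rightarrow> real"
    using M_add[OF \<M>_base_M[OF assms(1), of b] \<M>_base_M[OF assms(2), of b]] by (simp add: distrib_left)
qed

lemma \<M>_base: assumes "X \<in> \<M>" "smooth_on D b" shows "(\<lambda>z. b (fst z) * X z) \<in> \<M>"
  unfolding \<M>_def
proof (intro CollectI conjI allI impI)
  show "smooth_on U (\<lambda>z. b (fst z) * X z)" by (intro smooth_on_mult open_U smooth_base assms \<M>_smooth)
  fix a :: "'a \<Rightarrow> real" assume a: "smooth_on D a"
  show "(\<lambda>z. a (fst z) * (b (fst z) * X z)) \<in> M"
    using \<M>_base_M[OF assms(1) smooth_on_mult[OF open_D a assms(2)]] by (simp add: mult.assoc)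
qed

lemma \<M>_scale: "X \<in> \<M> \<Longrightarrow> (\<lambda>z. a * X z) \<in> \<M>"
  using \<M>_base[of X "\<lambda>_. a"] by simp

lemma \<M>_zero: "(\<lambda>z. 0) \<in> \<M>"
proof -
  have "(\<lambda>z. 1 * (1 - (norm (W (fst z) (snd z)))\<^sup>2) powr (1/2)) \<in> M" using M_I[OF L_gen[of "\<lambda>_. 1"]] by simp
  from M_scale[OF this, of 0] have "(\<lambda>z. 0) \<in> M" by simp
  then show ?thesis by (simp add: \<M>_def)
qed

lemma \<M>_sum: "(\<And>i. i \<in> I \<Longrightarrow> X i \<in> \<M>) \<Longrightarrow> (\<lambda>z. \<Sum>i\<in>I. X i z) \<in> \<M>"
  by (induction I rule: infinite_finite_induct) (auto intro: \<M>_zero \<M>_add)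

lemma \<M>_limit:
  assumes "smooth_on U X" "\<And>k. \<exists>Xs. (\<forall>i. Xs i \<in> \<M>) \<and> smoothly_tends_upto k K Xs X" shows "X \<in> \<M>"
  unfolding \<M>_def
proof (intro CollectI conjI allI impI)
  show "smooth_on U X" by (rule assms)
  fix b :: "'a \<Rightarrow> real" assume b: "smooth_on D b"
  show "(\<lambda>z. b (fst z) * X z) \<in> M"
  proof (rule M_limit)
    show "smooth_on U (\<lambda>z. b (fst z) * X z)" by (intro smooth_on_mult open_U smooth_base assms b)
    fix k
    obtain Xs where Xs: "\<And>i. Xs i \<in> \<M>" "smoothly_tends_upto k K Xs X" using assms(2) by blast
    then have "smoothly_tends_upto k K (\<lambda>i z. b (fst z) * Xs i z) (\<lambda>z. b (fst z) * X z)"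
      by (intro smoothly_tends_upto_bilinear[OF bounded_bilinear_mult open_U K(2,1)] smooth_base b
          smoothly_tends_upto_const assms \<M>_smooth)
    then show "\<exists>Hs. (\<forall>i. Hs i \<in> M) \<and> smoothly_tends_upto k K Hs (\<lambda>z. b (fst z) * X z)"
      using \<M>_base_M[OF Xs(1) b] by (intro exI[of _ "\<lambda>i z. b (fst z) * Xs i z"]) auto
  qed
qed

text \<open>Since functions of the base point commute, \<open>a {b, X Y} = {a b X, Y} - {a X, b Y}\<close>: the
  module need not contain products, but it contains their brackets with base functions.\<close>

lemma \<M>_poisson_base_mult:
  assumes X: "X \<in> \<M>" and Y: "Y \<in> \<M>" and b: "smooth_on D b"
  shows "poisson (\<lambda>z. b (fst z)) (\<lambda>z. X z * Y z) \<in> \<M>"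
  unfolding \<M>_def
proof (intro CollectI conjI allI impI)
  note sX = \<M>_smooth[OF X] and sY = \<M>_smooth[OF Y] and sb = smooth_base[OF b]
  show "smooth_on U (poisson (\<lambda>z. b (fst z)) (\<lambda>z. X z * Y z))"
    by (intro smooth_poisson smooth_on_mult open_U sX sY sb)
  fix a :: "'a \<Rightarrow> real" assume a: "smooth_on D a"
  note sa = smooth_base[OF a]
  have ab: "smooth_on D (\<lambda>s. a s * b s)" by (rule smooth_on_mult[OF open_D a b])
  note sab = smooth_base[OF ab]
  have "(\<lambda>z. poisson (\<lambda>z. (a (fst z) * b (fst z)) * X z) Y z + (-1) * poisson (\<lambda>z. a (fst z) * X z) (\<lambda>z. b (fst z) * Y z) z) \<in> M"
    by (intro M_add M_scale M_poisson \<M>_base_M X Y a b ab \<M>_imp_M)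
  then show "(\<lambda>z. a (fst z) * poisson (\<lambda>z. b (fst z)) (\<lambda>z. X z * Y z) z) \<in> M"
  proof (rule M_cong)
    fix z assume z: "z \<in> U"
    have 1: "poisson (\<lambda>z. (a (fst z) * b (fst z)) * X z) Y z
      = a (fst z) * b (fst z) * poisson X Y z + (a (fst z) * poisson (\<lambda>z. b (fst z)) Y z + poisson (\<lambda>z. a (fst z)) Y z * b (fst z)) * X z"
      by (simp only: poisson_mult_left[OF sab sX sY z] poisson_mult_left[OF sa sb sY z])
    have 2: "poisson (\<lambda>z. a (fst z) * X z) (\<lambda>z. b (fst z) * Y z) z
      = b (fst z) * (a (fst z) * poisson X Y z + poisson (\<lambda>z. a (fst z)) Y z * X z)
        + (a (fst z) * poisson X (\<lambda>z. b (fst z)) z + poisson (\<lambda>z. a (fst z)) (\<lambda>z. b (fst z)) z * X z) * Y z"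
      by (simp only: poisson_mult[OF smooth_on_mult[OF open_U sa sX] sb sY z] poisson_mult_left[OF sa sX sY z] poisson_mult_left[OF sa sX sb z])
    have 3: "poisson (\<lambda>z. b (fst z)) (\<lambda>z. X z * Y z) z = X z * poisson (\<lambda>z. b (fst z)) Y z + poisson (\<lambda>z. b (fst z)) X z * Y z"
      by (rule poisson_mult[OF sb sX sY z])
    show "poisson (\<lambda>z. (a (fst z) * b (fst z)) * X z) Y z + (-1) * poisson (\<lambda>z. a (fst z) * X z) (\<lambda>z. b (fst z) * Y z) z
        = a (fst z) * poisson (\<lambda>z. b (fst z)) (\<lambda>z. X z * Y z) z"
      unfolding 1 2 3 poisson_base_base[OF a b z] poisson_antisym[OF sX sb z] by (simp add: algebra_simps)
  qed
qed

definition fibre_deriv :: "'b \<Rightarrow> ('a \<times> 'b \<Rightarrow> real) \<Rightarrow> 'a \<times> 'b \<Rightarrow> real" where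
  "fibre_deriv j X z = frechet_derivative X (at z) (0, j)"

text \<open>A derivative in a fibre direction is a combination of brackets with base coordinates, with
  coefficients that depend on the base point only.\<close>

lemma \<M>_fibre_deriv_mult:
  assumes X: "X \<in> \<M>" and Y: "Y \<in> \<M>" and j: "j \<in> Basis"
  shows "fibre_deriv j (\<lambda>z. X z * Y z) \<in> \<M>"
proof (rule \<M>_cong)
  have "smooth_on D (\<lambda>s. s \<bullet> i)" for i by (intro smooth_on_bounded_linear bounded_linear_inner_left)
  then show "(\<lambda>z. \<Sum>i\<in>Basis. c j i (fst z) * poisson (\<lambda>z. fst z \<bullet> i) (\<lambda>z. X z * Y z) z) \<in> \<M>"
    by (intro \<M>_sum \<M>_base smooth_c \<M>_poisson_base_mult X Y)
  fix z assume z: "z \<in> U"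
  have "linear (frechet_derivative (\<lambda>z. X z * Y z) (at z))"
    by (rule linear_frechet_derivative[OF smooth_on_differentiable[OF smooth_on_mult[OF open_U \<M>_smooth[OF X] \<M>_smooth[OF Y]] z]])
  then show "(\<Sum>i\<in>Basis. c j i (fst z) * poisson (\<lambda>z. fst z \<bullet> i) (\<lambda>z. X z * Y z) z) = fibre_deriv j (\<lambda>z. X z * Y z) z"
    unfolding fibre_deriv_def spanning[OF j z] poisson_def by (simp add: linear_sum linear_scale)
qed

definition Q :: "'a \<times> 'b \<Rightarrow> real" where
  "Q z = 1 - (norm (W (fst z) (snd z)))\<^sup>2"

definition y :: "'b \<Rightarrow> 'a \<times> 'b \<Rightarrow> real" where
  "y l z = snd z \<bullet> l"

definition g :: "'b \<Rightarrow> 'a \<times> 'b \<Rightarrow> real" where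
  "g j z = W (fst z) (snd z) \<bullet> W (fst z) j"

lemma in_D: "z \<in> U \<Longrightarrow> fst z \<in> D"
  using base by blast

lemma Q_pos: "z \<in> U \<Longrightarrow> Q z > 0"
  unfolding Q_def using W_less_1[of z] by (simp add: abs_square_less_1)

lemma smooth_y: "smooth_on V (y l)"
  unfolding y_def[abs_def]
  by (intro smooth_on_bounded_linear bounded_linear_inner_left_comp bounded_linear_snd)

lemma frechet_y: "frechet_derivative (y l) (at z) v = y l v"
proof -
  have "bounded_linear (y l)" unfolding y_def[abs_def]
    by (intro bounded_linear_inner_left_comp bounded_linear_snd)
  from frechet_derivative_eqI[OF bounded_linear_imp_has_derivative[OF this]] show ?thesis by simp
qed

lemma smooth_W_fibre: "smooth_on U (\<lambda>z. W (fst z) (snd z))"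
proof (rule smooth_on_cong[OF open_U])
  show "smooth_on U (\<lambda>z. \<Sum>b\<in>Basis. y b z *\<^sub>R W (fst z) b)"
    by (intro smooth_on_sum smooth_on_scaleR open_U smooth_y smooth_on_fst[OF open_U open_D smooth_W base])
  show "z \<in> U \<Longrightarrow> (\<Sum>b\<in>Basis. y b z *\<^sub>R W (fst z) b) = W (fst z) (snd z)" for z
    unfolding y_def using linear_basis_expansion[OF linear_W[OF in_D]] by metis
qed

lemma Q_inner: "Q z = 1 - W (fst z) (snd z) \<bullet> W (fst z) (snd z)"
  by (simp add: Q_def power2_norm_eq_inner)

lemma smooth_Q: "smooth_on U Q"
  unfolding Q_inner[abs_def] by (intro smooth_on_diff smooth_on_inner open_U smooth_on_const smooth_W_fibre)

text \<open>Along a fibre line \<open>Q\<close> is a quadratic polynomial of the parameter.\<close>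

lemma fibre_deriv_Q: assumes z: "z \<in> U" shows "fibre_deriv j Q z = - 2 * g j z"
proof -
  have eq: "Q (z + t *\<^sub>R (0, j)) = Q z - 2 * g j z * t - (W (fst z) j \<bullet> W (fst z) j) * t\<^sup>2" for t
    unfolding Q_inner g_def using linear_W[OF in_D[OF z]]
    by (simp add: linear_add linear_scale inner_add_left inner_add_right inner_commute power2_eq_square algebra_simps)
  have lin: "linear (frechet_derivative Q (at z))"
    by (rule linear_frechet_derivative[OF smooth_on_differentiable[OF smooth_Q z]])
  have "((\<lambda>t. z + t *\<^sub>R (0, j)) has_derivative (\<lambda>t. t *\<^sub>R (0, j))) (at 0)"
    by (auto intro!: derivative_eq_intros)
  moreover have "(Q has_derivative frechet_derivative Q (at z)) (at (z + 0 *\<^sub>R (0, j)))"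
    using smooth_on_has_derivative[OF smooth_Q z] by (simp add: zero_prod_def[symmetric])
  ultimately have "((\<lambda>t. Q (z + t *\<^sub>R (0, j))) has_derivative (\<lambda>t. frechet_derivative Q (at z) (t *\<^sub>R (0, j)))) (at 0)"
    by (rule has_derivative_compose)
  then have 1: "((\<lambda>t. Q (z + t *\<^sub>R (0, j))) has_real_derivative fibre_deriv j Q z) (at 0)"
    unfolding has_field_derivative_def fibre_deriv_def linear_scale[OF lin] real_scaleR_def
    by (rule has_derivative_eq_rhs) (simp add: fun_eq_iff)
  have "((\<lambda>t. Q z - 2 * g j z * t - (W (fst z) j \<bullet> W (fst z) j) * t\<^sup>2) has_real_derivative - 2 * g j z) (at 0)"
    by (auto intro!: derivative_eq_intros)
  then show ?thesis using 1 unfolding eq by (rule DERIV_unique[rotated])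
qed

definition Qp :: "real \<Rightarrow> 'a \<times> 'b \<Rightarrow> real" where
  "Qp a z = Q z powr a"

lemma smooth_Qp: "smooth_on U (Qp a)"
  unfolding Qp_def[abs_def]
  by (rule smooth_on_compose[OF open_U _ smooth_on_powr smooth_Q]) (auto simp: Q_pos)

lemma fibre_deriv_Qp: assumes z: "z \<in> U" shows "fibre_deriv j (Qp a) z = - 2 * a * (g j z * Qp (a - 1) z)"
proof -
  have "((\<lambda>u. u powr a) has_real_derivative a * Q z powr (a - 1)) (at (Q z))"
    using Q_pos[OF z] by (auto intro!: derivative_eq_intros)
  then have "(Qp a has_derivative (\<lambda>v. a * Q z powr (a - 1) * frechet_derivative Q (at z) v)) (at z)"
    unfolding Qp_def[abs_def] using smooth_on_has_derivative[OF smooth_Q z]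
    by (intro has_derivative_compose[of Q _ _ _ "\<lambda>u. u powr a"]) (auto simp: has_field_derivative_def)
  from frechet_derivative_eqI[OF this] have "fibre_deriv j (Qp a) z = a * Q z powr (a - 1) * fibre_deriv j Q z" by (simp add: fibre_deriv_def)
  then show ?thesis by (simp add: fibre_deriv_Q[OF z] Qp_def)
qed

lemma Qp_mult: "z \<in> U \<Longrightarrow> Qp a z * Qp b z = Qp (a + b) z"
  using Q_pos[of z] by (simp add: Qp_def powr_add)

lemma Qp_0: "z \<in> U \<Longrightarrow> Qp 0 z = 1" and Qp_1: "z \<in> U \<Longrightarrow> Qp 1 z = Q z"
  using Q_pos[of z] by (simp_all add: Qp_def)

lemma Qp_half_\<M>: "Qp (1/2) \<in> \<M>"
  unfolding \<M>_def using M_I[OF L_gen] smooth_Qp by (simp add: Qp_def Q_def)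

text \<open>The square of the generator \<open>sqrt Q\<close> is \<open>Q\<close>, whose fibre derivatives are \<open>- 2 g\<^sub>j\<close>.\<close>

lemma g_\<M>: assumes j: "j \<in> Basis" shows "g j \<in> \<M>"
proof -
  have "(\<lambda>z. (-1/2) * fibre_deriv j (\<lambda>z. Qp (1/2) z * Qp (1/2) z) z) \<in> \<M>"
    by (intro \<M>_scale \<M>_fibre_deriv_mult Qp_half_\<M> j)
  then show ?thesis
  proof (rule \<M>_cong)
    fix z assume z: "z \<in> U"
    have "fibre_deriv j (\<lambda>z. Qp (1/2) z * Qp (1/2) z) z = fibre_deriv j Q z"
      unfolding fibre_deriv_def
      by (rule fun_cong[OF frechet_derivative_cong_open[OF open_U z]]) (simp add: Qp_mult Qp_1)
    then show "(-1/2) * fibre_deriv j (\<lambda>z. Qp (1/2) z * Qp (1/2) z) z = g j z" by (simp add: fibre_deriv_Q[OF z])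
  qed
qed

text \<open>The inverse Gram matrix recovers the fibre coordinates from the functions \<open>g\<^sub>j\<close>.\<close>

definition gram :: "'a \<Rightarrow> 'b \<Rightarrow> 'b" where
  "gram s w = (\<Sum>j\<in>Basis. (W s w \<bullet> W s j) *\<^sub>R j)"

lemma gram_inner: assumes "s \<in> D" shows "gram s w \<bullet> v = W s w \<bullet> W s v"
proof -
  have "W s w \<bullet> W s v = W s w \<bullet> (\<Sum>j\<in>Basis. (v \<bullet> j) *\<^sub>R W s j)"
    using linear_basis_expansion[OF linear_W[OF assms], of v] by simp
  then show ?thesis unfolding gram_def by (simp add: inner_sum_left inner_sum_right inner_commute[of v] mult.commute)
qed

lemma linear_gram: assumes "s \<in> D" shows "linear (gram s)"
  using linear_W[OF assms] unfolding gram_def[abs_def]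
  by (intro linearI) (simp_all add: linear_add linear_scale inner_add_left scaleR_add_left sum.distrib scaleR_sum_right)

lemma inj_gram: assumes "s \<in> D" shows "inj (gram s)"
  unfolding linear_injective_0[OF linear_gram[OF assms]]
proof (intro allI impI)
  fix w assume "gram s w = 0"
  then have "W s w = 0" using gram_inner[OF assms, of w w] by simp
  then show "w = 0" using inj_W[OF assms] linear_W[OF assms] by (simp add: linear_injective_0)
qed

definition gram_inv :: "'a \<Rightarrow> 'b \<Rightarrow> 'b" where
  "gram_inv s = inv (gram s)"

lemma gram_gram_inv: "s \<in> D \<Longrightarrow> gram s (gram_inv s l) = l"
  unfolding gram_inv_def by (meson inj_gram linear_gram linear_inj_imp_surj surj_f_inv_f)

lemma smooth_gram_inv: "smooth_on D (\<lambda>s. gram_inv s l)"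
proof (rule smooth_on_linear_system_solution[where T=gram and y="\<lambda>_. l"])
  show "smooth_on D (\<lambda>s. gram s b)" for b
    unfolding gram_def by (intro smooth_on_sum smooth_on_scaleR smooth_on_inner smooth_W smooth_on_const open_D)
qed (simp_all add: open_D linear_gram inj_gram gram_gram_inv)

lemma y_gram: assumes z: "z \<in> U" shows "(\<Sum>j\<in>Basis. (gram_inv (fst z) l \<bullet> j) * g j z) = y l z"
proof -
  note s = in_D[OF z]
  have "y l z = snd z \<bullet> gram (fst z) (gram_inv (fst z) l)" by (simp add: y_def gram_gram_inv[OF s])
  also have "\<dots> = W (fst z) (snd z) \<bullet> W (fst z) (gram_inv (fst z) l)"
    by (simp add: gram_inner[OF s] inner_commute[of "snd z"] inner_commute[of "W (fst z) (snd z)"])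
  also have "\<dots> = W (fst z) (snd z) \<bullet> (\<Sum>j\<in>Basis. (gram_inv (fst z) l \<bullet> j) *\<^sub>R W (fst z) j)"
    using linear_basis_expansion[OF linear_W[OF s], of "gram_inv (fst z) l"] by simp
  finally show ?thesis by (simp add: g_def inner_sum_right)
qed

lemma \<M>_replace_g:
  assumes "\<And>j. j \<in> Basis \<Longrightarrow> (\<lambda>z. g j z * X z) \<in> \<M>" shows "(\<lambda>z. y l z * X z) \<in> \<M>"
proof (rule \<M>_cong)
  show "(\<lambda>z. \<Sum>j\<in>Basis. (gram_inv (fst z) l \<bullet> j) * (g j z * X z)) \<in> \<M>"
    by (intro \<M>_sum \<M>_base[of _ "\<lambda>s. gram_inv s l \<bullet> _"] assms smooth_on_inner smooth_gram_inv smooth_on_const open_D)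
  show "z \<in> U \<Longrightarrow> (\<Sum>j\<in>Basis. (gram_inv (fst z) l \<bullet> j) * (g j z * X z)) = y l z * X z" for z
    by (simp add: y_gram[symmetric] sum_distrib_right mult.assoc)
qed

lemma y_\<M>: "y l \<in> \<M>"
  using \<M>_replace_g[of "\<lambda>_. 1" l] g_\<M> by simp

lemma fibre_deriv_mult:
  assumes "smooth_on U X" "smooth_on U Y" "z \<in> U"
  shows "fibre_deriv j (\<lambda>z. X z * Y z) z = X z * fibre_deriv j Y z + fibre_deriv j X z * Y z"
  unfolding fibre_deriv_def by (rule smooth_on_frechet_mult[OF assms])

lemma fibre_deriv_y: "fibre_deriv j (y l) z = j \<bullet> l"
  by (simp add: fibre_deriv_def frechet_y y_def)

lemma \<M>_y_fibre_deriv: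
  assumes X: "X \<in> \<M>" and j: "j \<in> Basis" shows "(\<lambda>z. y l z * fibre_deriv j X z) \<in> \<M>"
proof (rule \<M>_cong)
  show "(\<lambda>z. fibre_deriv j (\<lambda>z. y l z * X z) z + (- (j \<bullet> l)) * X z) \<in> \<M>"
    by (intro \<M>_add \<M>_scale \<M>_fibre_deriv_mult y_\<M> X j)
  show "z \<in> U \<Longrightarrow> fibre_deriv j (\<lambda>z. y l z * X z) z + (- (j \<bullet> l)) * X z = y l z * fibre_deriv j X z" for z
    by (simp add: fibre_deriv_mult[OF smooth_y \<M>_smooth[OF X]] fibre_deriv_y)
qed

lemma y_g_sum: assumes z: "z \<in> U" shows "(\<Sum>j\<in>Basis. y j z * g j z) = 1 - Q z"
proof -
  have "W (fst z) (snd z) \<bullet> W (fst z) (snd z) = W (fst z) (snd z) \<bullet> (\<Sum>j\<in>Basis. (snd z \<bullet> j) *\<^sub>R W (fst z) j)"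
    using linear_basis_expansion[OF linear_W[OF in_D[OF z]], of "snd z"] by simp
  then show ?thesis by (simp add: Q_inner y_def g_def inner_sum_right)
qed

text \<open>The derivative \<open>d\<^sub>j Q\<^sup>a\<close> is \<open>- 2 a g\<^sub>j Q\<^sup>a\<^sup>-\<^sup>1\<close>, and \<open>a = 1/2 - k\<close> never vanishes. Multiplication
  by \<open>y\<^sub>l\<close> and replacement of \<open>g\<^sub>j\<close> by fibre coordinates give the quadratic terms; the contraction
  \<open>\<Sum>j. y\<^sub>j g\<^sub>j = 1 - Q\<close> lowers the exponent by one.\<close>

lemma Qp_\<M>: "Qp (1/2 - real k) \<in> \<M> \<and> (\<forall>l m. (\<lambda>z. y l z * (y m z * Qp (- 1/2 - real k) z)) \<in> \<M>)"
proof (induction k)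
  have quad: "(\<lambda>z. y l z * (g j z * Qp (- 1/2 - real k) z)) \<in> \<M>"
    if X: "Qp (1/2 - real k) \<in> \<M>" and j: "j \<in> Basis" for l j k
  proof (rule \<M>_cong)
    show "(\<lambda>z. (1 / (2 * real k - 1)) * (y l z * fibre_deriv j (Qp (1/2 - real k)) z)) \<in> \<M>"
      by (intro \<M>_scale \<M>_y_fibre_deriv X j)
    have "2 * real k - 1 \<noteq> 0"
    proof
      assume "2 * real k - 1 = 0"
      then have "real (2 * k) = real 1" by simp
      then show False using of_nat_eq_iff by (metis odd_one dvd_triv_left)
    qed
    moreover have "1/2 - real k - 1 = - 1/2 - real k" by simp
    ultimately show "z \<in> U \<Longrightarrow> (1 / (2 * real k - 1)) * (y l z * fibre_deriv j (Qp (1/2 - real k)) z) = y l z * (g j z * Qp (- 1/2 - real k) z)" for z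
      by (simp add: fibre_deriv_Qp field_simps)
  qed
  have step: "\<forall>l m. (\<lambda>z. y l z * (y m z * Qp (- 1/2 - real k) z)) \<in> \<M>" if X: "Qp (1/2 - real k) \<in> \<M>" for k
  proof (intro allI)
    fix l m
    have "(\<lambda>z. g j z * (y l z * Qp (- 1/2 - real k) z)) \<in> \<M>" if "j \<in> Basis" for j
      using quad[OF X that, of l] by (simp add: mult.left_commute)
    from \<M>_replace_g[OF this, of m] show "(\<lambda>z. y l z * (y m z * Qp (- 1/2 - real k) z)) \<in> \<M>"
      by (simp add: mult.left_commute)
  qed
  case 0
  show ?case using Qp_half_\<M> step[of 0] by simp
  case (Suc k)
  then have X: "Qp (1/2 - real k) \<in> \<M>" by blast
  have "Qp (1/2 - real (Suc k)) \<in> \<M>"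
  proof (rule \<M>_cong)
    show "(\<lambda>z. (\<Sum>j\<in>Basis. y j z * (g j z * Qp (- 1/2 - real k) z)) + Qp (1/2 - real k) z) \<in> \<M>"
      by (intro \<M>_add \<M>_sum quad X)
    fix z assume z: "z \<in> U"
    have "(\<Sum>j\<in>Basis. y j z * (g j z * Qp (- 1/2 - real k) z)) = (1 - Q z) * Qp (- 1/2 - real k) z"
      by (simp add: y_g_sum[OF z, symmetric] sum_distrib_right mult.assoc)
    also have "\<dots> = Qp (- 1/2 - real k) z - Qp (1/2 - real k) z"
      using Qp_mult[OF z, of 1 "- 1/2 - real k"] by (simp add: Qp_1[OF z] left_diff_distrib)
    finally show "(\<Sum>j\<in>Basis. y j z * (g j z * Qp (- 1/2 - real k) z)) + Qp (1/2 - real k) z = Qp (1/2 - real (Suc k)) z"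
    proof -
      have e: "1/2 - real (Suc k) = - 1/2 - real k" by simp
      show ?thesis unfolding e
        using \<open>(\<Sum>j\<in>Basis. y j z * (g j z * Qp (- 1/2 - real k) z)) = (1 - Q z) * Qp (- 1/2 - real k) z\<close>
          \<open>(1 - Q z) * Qp (- 1/2 - real k) z = _\<close> by simp
    qed
  qed
  then show ?case using step by blast
qed

text \<open>Polynomials in \<open>1 / Q\<close> approximate all real powers of \<open>Q\<close> on \<open>K\<close>. This step
  needs limits: all elements of the algebra generated by the functions \<open>b sqrt Q\<close> change sign under
  \<open>(w, sqrt Q) \<mapsto> (- w, - sqrt Q)\<close>, but \<open>1\<close> does not.\<close>

lemma \<M>_powr_limit:
  assumes X: "smooth_on U X" and pow: "\<And>k::nat. (\<lambda>z. X z * Qp (- real k) z) \<in> \<M>"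
  shows "(\<lambda>z. X z * Qp a z) \<in> \<M>"
proof (rule \<M>_limit)
  show "smooth_on U (\<lambda>z. X z * Qp a z)" by (intro smooth_on_mult open_U X smooth_Qp)
  fix k
  define V :: "real set" where "V = {0<..}"
  have V: "open V" by (simp add: V_def)
  have im: "Qp (-1) ` U \<subseteq> V" unfolding V_def Qp_def using Q_pos by force
  have cK: "compact (Qp (-1) ` K)"
    by (rule compact_continuous_image[OF continuous_on_subset[OF smooth_on_continuous_on[OF smooth_Qp] K(2)] K(1)])
  have KV: "Qp (-1) ` K \<subseteq> V" using im K(2) by blast
  have sp: "smooth_on V (\<lambda>u. u powr (-a))" unfolding V_def by (rule smooth_on_powr)
  from smooth_polynomial_approximation[OF V sp cK KV, of k] obtain P where P: "\<And>n. real_polynomial_function (P n)"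
    "\<And>vs. length vs \<le> k \<Longrightarrow> uniform_limit (Qp (-1) ` K) (\<lambda>n. iter_deriv vs (P n)) (iter_deriv vs (\<lambda>u. u powr (-a))) sequentially"
    by blast
  have sP: "smooth_on V (P n)" for n using smooth_on_real_polynomial_function[OF P(1)] smooth_on_subset by blast
  have "smoothly_tends_upto k K (\<lambda>n z. P n (Qp (-1) z)) (\<lambda>z. Qp (-1) z powr (-a))"
    by (rule smoothly_tends_upto_compose[OF open_U K(2,1) V im smooth_Qp sP sp])
      (simp add: smoothly_tends_upto_def P(2))
  then have t: "smoothly_tends_upto k K (\<lambda>n z. X z * P n (Qp (-1) z)) (\<lambda>z. X z * Qp (-1) z powr (-a))"
    by (intro smoothly_tends_upto_bilinear[OF bounded_bilinear_mult open_U K(2,1)] X smoothly_tends_upto_const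
        smooth_on_compose[OF open_U V sP smooth_Qp] smooth_on_compose[OF open_U V sp smooth_Qp]) (use im in auto)
  have "smoothly_tends_upto k K (\<lambda>n z. X z * P n (Qp (-1) z)) (\<lambda>z. X z * Qp a z)"
  proof (rule smoothly_tends_upto_cong[OF open_U K(2) _ _ t])
    show "X z * Qp (-1) z powr (-a) = X z * Qp a z" for z unfolding Qp_def powr_powr by simp
  qed simp
  moreover have "(\<lambda>z. X z * P n (Qp (-1) z)) \<in> \<M>" for n
  proof -
    obtain d m where P': "P n = (\<lambda>x. \<Sum>i\<le>m. d i * x ^ i)"
      using P(1)[of n] unfolding real_polynomial_function_iff_sum by blast
    have "(\<lambda>z. \<Sum>i\<le>m. d i * (X z * Qp (- real i) z)) \<in> \<M>" by (intro \<M>_sum \<M>_scale pow)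
    then show ?thesis
    proof (rule \<M>_cong)
      fix z assume z: "z \<in> U"
      have "Qp (-1) z ^ i = Qp (- real i) z" for i
        using Q_pos[OF z] unfolding Qp_def by (subst powr_realpow[symmetric]) (simp_all only: powr_powr, simp_all)
      then show "(\<Sum>i\<le>m. d i * (X z * Qp (- real i) z)) = X z * P n (Qp (-1) z)"
        by (simp add: P' sum_distrib_left mult.left_commute)
    qed
  qed
  ultimately show "\<exists>Xs. (\<forall>i. Xs i \<in> \<M>) \<and> smoothly_tends_upto k K Xs (\<lambda>z. X z * Qp a z)"
    by (intro exI[of _ "\<lambda>n z. X z * P n (Qp (-1) z)"]) auto
qed

text \<open>\<open>1 = Q\<^sup>1\<^sup>/\<^sup>2 Q\<^sup>-\<^sup>1\<^sup>/\<^sup>2\<close>, where the second factor is approximated.\<close>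

lemma one_\<M>: "(\<lambda>z. 1) \<in> \<M>"
proof -
  have "(\<lambda>z. Qp (1/2) z * Qp (- real k) z) \<in> \<M>" for k
    by (rule \<M>_cong[OF conjunct1[OF Qp_\<M>[of k]]]) (simp add: Qp_mult)
  from \<M>_powr_limit[OF smooth_Qp this, of "-1/2"] show ?thesis
    by (rule \<M>_cong) (simp add: Qp_mult Qp_0)
qed

lemma quadratic_\<M>: "(\<lambda>z. y l z * y m z) \<in> \<M>"
proof -
  have s: "smooth_on U (\<lambda>z. y l z * (y m z * Qp (-1/2) z))" by (intro smooth_on_mult open_U smooth_y smooth_Qp)
  have "(\<lambda>z. (y l z * (y m z * Qp (-1/2) z)) * Qp (- real k) z) \<in> \<M>" for k
    by (rule \<M>_cong[OF Qp_\<M>[of k, THEN conjunct2, rule_format, of l m]]) (simp add: Qp_mult mult.assoc)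
  from \<M>_powr_limit[OF s this, of "1/2"] show ?thesis
    by (rule \<M>_cong) (simp add: Qp_mult Qp_0 mult.assoc)
qed

definition monomial :: "'b list \<Rightarrow> 'a \<times> 'b \<Rightarrow> real" where
  "monomial ls z = (\<Prod>l\<leftarrow>ls. y l z)"

lemma monomial_simps: "monomial [] z = 1" "monomial (l # ls) z = y l z * monomial ls z"
  by (simp_all add: monomial_def)

lemma monomial_append: "monomial (ls @ ms) z = monomial ls z * monomial ms z"
  by (simp add: monomial_def)

lemma smooth_monomial: "smooth_on V (monomial ls)" if "open V"
  by (induction ls) (auto simp: monomial_simps[abs_def] intro!: smooth_on_mult smooth_y that)

lemma basis_sum_y: "(\<Sum>j\<in>Basis. y j z * (j \<bullet> l)) = y l z"
  unfolding y_def using euclidean_inner[of "snd z" l] by (simp add: inner_commute[of l])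

lemma euler_monomial: assumes z: "z \<in> U" shows "(\<Sum>j\<in>Basis. y j z * fibre_deriv j (monomial ls) z) = real (length ls) * monomial ls z"
proof (induction ls)
  case Nil
  have "monomial [] = (\<lambda>_. 1)" by (simp add: monomial_simps fun_eq_iff)
  then show ?case by (simp add: fibre_deriv_def)
next
  case (Cons l ls)
  have "fibre_deriv j (monomial (l # ls)) z = y l z * fibre_deriv j (monomial ls) z + (j \<bullet> l) * monomial ls z" for j
    unfolding monomial_simps[abs_def] using fibre_deriv_mult[OF smooth_y smooth_monomial[OF open_U] z] by (simp add: fibre_deriv_y)
  then have "(\<Sum>j\<in>Basis. y j z * fibre_deriv j (monomial (l # ls)) z)
      = y l z * (\<Sum>j\<in>Basis. y j z * fibre_deriv j (monomial ls) z) + (\<Sum>j\<in>Basis. y j z * (j \<bullet> l)) * monomial ls z"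
    by (simp add: sum_distrib_left sum_distrib_right sum.distrib algebra_simps)
  then show ?case unfolding Cons basis_sum_y monomial_simps by (simp add: algebra_simps)
qed

text \<open>For a homogeneous \<open>m\<close> of degree \<open>k\<close> on a fibre of dimension \<open>n\<close>, Euler's identity gives
  \<open>\<Sum>j. d\<^sub>j (y\<^sub>j y\<^sub>l m) = (n + 1 + k) y\<^sub>l m\<close>.\<close>

lemma monomial_\<M>: "monomial ls \<in> \<M>"
proof (induction ls)
  case Nil
  show ?case using one_\<M> by (simp add: monomial_simps[abs_def])
next
  case (Cons l ls)
  define N where "N = real DIM('b) + 1 + real (length ls)"
  have N: "N > 0" by (simp add: N_def)
  have "(\<lambda>z. (1 / N) * (\<Sum>j\<in>Basis. fibre_deriv j (\<lambda>z. (y j z * y l z) * monomial ls z) z)) \<in> \<M>"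
    by (intro \<M>_scale \<M>_sum \<M>_fibre_deriv_mult quadratic_\<M> Cons)
  then show ?case
  proof (rule \<M>_cong)
    fix z assume z: "z \<in> U"
    have "fibre_deriv j (\<lambda>z. (y j z * y l z) * monomial ls z) z
        = y l z * (y j z * fibre_deriv j (monomial ls) z) + ((y j z * (j \<bullet> l)) + (j \<bullet> j) * y l z) * monomial ls z" for j
      using fibre_deriv_mult[OF smooth_on_mult[OF open_U smooth_y smooth_y] smooth_monomial[OF open_U] z, of j j l ls]
        fibre_deriv_mult[OF smooth_y smooth_y z, of j j l] by (simp add: fibre_deriv_y algebra_simps)
    then have "(\<Sum>j\<in>Basis. fibre_deriv j (\<lambda>z. (y j z * y l z) * monomial ls z) z)
      = y l z * (\<Sum>j\<in>Basis. y j z * fibre_deriv j (monomial ls) z) + ((\<Sum>j\<in>Basis. y j z * (j \<bullet> l)) + (\<Sum>j\<in>(Basis::'b set). j \<bullet> j) * y l z) * monomial ls z"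
      by (simp only: sum.distrib sum_distrib_left[symmetric] sum_distrib_right[symmetric])
    also have "(\<Sum>j\<in>(Basis::'b set). j \<bullet> j) = real DIM('b)" by simp
    finally show "(1 / N) * (\<Sum>j\<in>Basis. fibre_deriv j (\<lambda>z. (y j z * y l z) * monomial ls z) z) = monomial (l # ls) z"
      using N by (simp add: basis_sum_y euler_monomial[OF z] monomial_simps) (simp add: N_def field_simps)
  qed
qed

text \<open>Monomials on the fibres are brought together with arbitrary smooth coefficients of the base point,
  because such multiples lie in the closure by the definition of \<open>\<M>\<close>.\<close>

inductive fibre_polynomial :: "('a \<times> 'b \<Rightarrow> real) \<Rightarrow> bool" where
  monomial: "smooth_on D b \<Longrightarrow> fibre_polynomial (\<lambda>z. b (fst z) * monomial ls z)"
| add: "fibre_polynomial p \<Longrightarrow> fibre_polynomial q \<Longrightarrow> fibre_polynomial (\<lambda>z. p z + q z)"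

lemma fibre_polynomial_mult_monomial:
  assumes "fibre_polynomial q" "smooth_on D b"
  shows "fibre_polynomial (\<lambda>z. b (fst z) * monomial ls z * q z)"
  using assms(1)
proof induction
  case (monomial b' ls')
  have "fibre_polynomial (\<lambda>z. (b (fst z) * b' (fst z)) * monomial (ls @ ls') z)"
    by (rule fibre_polynomial.monomial[of "\<lambda>s. b s * b' s"]) (intro smooth_on_mult open_D assms(2) monomial)
  then show ?case by (simp add: monomial_append mult_ac)
next
  case (add p q)
  from fibre_polynomial.add[OF add.IH] show ?case by (simp add: distrib_left)
qed

lemma fibre_polynomial_mult:
  assumes "fibre_polynomial p" "fibre_polynomial q" shows "fibre_polynomial (\<lambda>z. p z * q z)"
  using assms(1)
proof induction
  case (monomial b ls)
  then show ?case by (rule fibre_polynomial_mult_monomial[OF assms(2)])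
next
  case (add p q)
  from fibre_polynomial.add[OF add.IH] show ?case by (simp add: distrib_right)
qed

lemma fibre_polynomial_base: "smooth_on D b \<Longrightarrow> fibre_polynomial (\<lambda>z. b (fst z))"
  using fibre_polynomial.monomial[of b "[]"] by (simp add: monomial_simps)

lemma fibre_polynomial_sum: "(\<And>i. i \<in> I \<Longrightarrow> fibre_polynomial (p i)) \<Longrightarrow> fibre_polynomial (\<lambda>z. \<Sum>i\<in>I. p i z)"
  by (induction I rule: infinite_finite_induct)
    (auto intro: fibre_polynomial.add fibre_polynomial_base[of "\<lambda>_. 0"])

lemma fibre_polynomial_polynomial: "real_polynomial_function p \<Longrightarrow> fibre_polynomial p"
proof (induction rule: real_polynomial_function.induct)
  case (linear f)
  interpret f: bounded_linear f by (rule linear)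
  have "bounded_linear (\<lambda>s. f (s, 0))" by (intro f.bounded_linear_axioms bounded_linear_compose[of f]) (auto intro: bounded_linear_intros)
  then have 1: "fibre_polynomial (\<lambda>z. f (fst z, 0))"
    by (intro fibre_polynomial_base smooth_on_bounded_linear)
  have "fibre_polynomial (\<lambda>z. f (0, l) * monomial [l] z)" for l
    by (rule fibre_polynomial.monomial) simp
  then have "fibre_polynomial (\<lambda>z. f (fst z, 0) + (\<Sum>l\<in>Basis. f (0, l) * monomial [l] z))"
    by (intro fibre_polynomial.add 1 fibre_polynomial_sum)
  note fp = this
  have "f z = f (fst z, 0) + (\<Sum>l\<in>Basis. f (0, l) * monomial [l] z)" for z
  proof -
    have lin: "linear (\<lambda>w. f (0, w))"
      by (rule linear_compose[of "\<lambda>w. (0, w)" f, unfolded o_def]) (auto intro: linearI f.linear)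
    have "f z = f (fst z, 0) + f (0, snd z)" using f.add[of "(fst z, 0)" "(0, snd z)"] by simp
    then show ?thesis using linear_basis_expansion[OF lin, of "snd z"] by (simp add: monomial_simps y_def mult.commute)
  qed
  then have "f = (\<lambda>z. f (fst z, 0) + (\<Sum>l\<in>Basis. f (0, l) * monomial [l] z))" by (rule ext)
  from fp[folded this] show ?case .
next
  case (const a)
  show ?case using fibre_polynomial_base[of "\<lambda>_. a"] by simp
qed (auto intro: fibre_polynomial.add fibre_polynomial_mult)

lemma fibre_polynomial_M: "fibre_polynomial p \<Longrightarrow> p \<in> M"
  by (induction rule: fibre_polynomial.induct) (auto intro: M_add \<M>_base_M monomial_\<M>)

theorem smooth_in_closure:
  assumes H: "smooth_on U H" shows "H \<in> smooth_closure U K L"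
  unfolding M_def[symmetric]
proof (rule M_limit[OF H])
  fix k
  obtain P where P: "\<And>n. real_polynomial_function (P n)"
    "\<And>vs. length vs \<le> k \<Longrightarrow> uniform_limit K (\<lambda>n. iter_deriv vs (P n)) (iter_deriv vs H) sequentially"
    using smooth_polynomial_approximation[OF open_U H K, of k] by blast
  then show "\<exists>Hs. (\<forall>i. Hs i \<in> M) \<and> smoothly_tends_upto k K Hs H"
    by (intro exI[of _ P]) (auto simp: smoothly_tends_upto_def intro: fibre_polynomial_M fibre_polynomial_polynomial)
qed

end

section \<open>Local inverses and reflections\<close>

text \<open>Composition with the inverse of the derivative at \<open>x0\<close> gives a map of one space into itself whose
  derivative at \<open>x0\<close> is the identity.\<close>

lemma smooth_local_inverse:
  fixes F :: "'a::euclidean_space \<Rightarrow> 'b::euclidean_space"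
  assumes O: "open S" and F: "smooth_on S F" and x0: "x0 \<in> S" and bij: "bij (frechet_derivative F (at x0))"
  obtains U' V g where "open U'" "U' \<subseteq> S" "x0 \<in> U'" "open V" "F x0 \<in> V" "homeomorphism U' V F g"
    "g differentiable (at (F x0))"
proof -
  define A where "A = frechet_derivative F (at x0)"
  define B where "B = inv A"
  have linA: "linear A" unfolding A_def by (rule linear_frechet_derivative[OF smooth_on_differentiable[OF F x0]])
  have BA: "B (A v) = v" and AB: "A (B w) = w" for v w
    using bij unfolding A_def B_def by (simp_all add: bij_is_inj bij_is_surj surj_f_inv_f)
  obtain B' where B': "linear B'" "B' \<circ> A = id"
    using linear_injective_left_inverse[OF linA] bij bij_is_inj unfolding A_def by blast
  have "B w = B' w" for w using fun_cong[OF B'(2), of "B w"] by (simp add: AB)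
  then have "B = B'" by (rule ext)
  then have linB: "linear B" using B'(1) by simp
  have blB: "bounded_linear B" using linB linear_conv_bounded_linear by blast
  define G where "G x = B (F x)" for x
  define G' where "G' x = Blinfun (\<lambda>v. B (frechet_derivative F (at x) v))" for x
  have G': "blinfun_apply (G' x) v = B (frechet_derivative F (at x) v)" if "x \<in> S" for x v
    unfolding G'_def
    by (subst bounded_linear_Blinfun_apply[OF bounded_linear_compose[OF blB has_derivative_bounded_linear[OF smooth_on_has_derivative[OF F that]]]]) simp
  obtain U' V1 g1 g1' where ift: "open U'" "U' \<subseteq> S" "x0 \<in> U'" "open V1" "G x0 \<in> V1" "homeomorphism U' V1 G g1"
    "\<And>y. y \<in> V1 \<Longrightarrow> (g1 has_derivative (g1' y)) (at y)"
  proof (rule inverse_function_theorem[OF O _ _ x0, of G G' id_blinfun])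
    show "(G has_derivative blinfun_apply (G' x)) (at x)" if "x \<in> S" for x
    proof -
      have "(G has_derivative (\<lambda>v. B (frechet_derivative F (at x) v))) (at x)"
        unfolding G_def by (rule bounded_linear.has_derivative[OF blB smooth_on_has_derivative[OF F that]])
      moreover have "blinfun_apply (G' x) = (\<lambda>v. B (frechet_derivative F (at x) v))" using G'[OF that] by blast
      ultimately show ?thesis by simp
    qed
    show "continuous_on S G'"
    proof (rule continuous_on_blinfun_componentwise)
      fix i :: 'a
      have "continuous_on S (\<lambda>x. B (frechet_derivative F (at x) i))"
        by (rule smooth_on_continuous_on[OF smooth_on_linear_comp[OF blB O smooth_on_deriv[OF F]]])
      then show "continuous_on S (\<lambda>x. blinfun_apply (G' x) i)"
        by (rule continuous_on_eq) (simp add: G')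
    qed
    show "id_blinfun o\<^sub>L G' x0 = id_blinfun"
      by (rule blinfun_eqI) (simp add: G'[OF x0] A_def[symmetric] BA)
  qed blast
  have FG: "F x = A (G x)" for x by (simp add: G_def AB)
  have contA: "continuous_on T A" for T using linA by (simp add: linear_continuous_on linear_conv_bounded_linear)
  have contB: "continuous_on T B" for T by (rule linear_continuous_on[OF blB])
  have "homeomorphism V1 (A ` V1) A B" unfolding homeomorphism_def by (auto simp: BA AB contA contB image_image)
  from homeomorphism_compose[OF ift(6) this] have hom: "homeomorphism U' (A ` V1) F (g1 \<circ> B)"
    by (simp add: o_def FG[symmetric])
  have "A ` V1 = B -` V1" using AB by (auto simp: BA) (metis AB image_eqI)
  then have op: "open (A ` V1)" using open_vimage[OF ift(4) contB] by simp
  have "(g1 has_derivative g1' (G x0)) (at (B (F x0)))" using ift(7)[OF ift(5)] by (simp add: G_def)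
  from has_derivative_compose[OF bounded_linear_imp_has_derivative[OF blB] this]
  have "(g1 \<circ> B) differentiable (at (F x0))" unfolding differentiable_def o_def by blast
  with that[OF ift(1-3) op _ hom] show thesis using ift(5) FG by blast
qed

text \<open>An injective linear map is bounded below, and small perturbations keep half of the bound.\<close>

lemma eventually_inj_linear:
  fixes T :: "'z::topological_space \<Rightarrow> 'a::euclidean_space \<Rightarrow> 'b::euclidean_space"
  assumes lin: "eventually (\<lambda>z. linear (T z)) F" and lin0: "linear T0" and inj: "inj T0"
    and T: "\<And>b. b \<in> Basis \<Longrightarrow> ((\<lambda>z. T z b) \<longlongrightarrow> T0 b) F"
  shows "eventually (\<lambda>z. inj (T z)) F"
proof -
  obtain B where B: "B > 0" "\<And>x. B * norm x \<le> norm (T0 x)" using linear_inj_bounded_below_pos[OF lin0 inj] by blast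
  have "((\<lambda>z. \<Sum>b\<in>Basis. norm (T z b - T0 b)) \<longlongrightarrow> (\<Sum>b\<in>(Basis::'a set). norm (T0 b - T0 b))) F"
    using T by (intro tendsto_intros)
  then have "eventually (\<lambda>z. (\<Sum>b\<in>Basis. norm (T z b - T0 b)) < B) F"
    using order_tendstoD(2)[of _ _ F B] B(1) by simp
  with lin show ?thesis
  proof eventually_elim
    case (elim z)
    show ?case unfolding linear_injective_0[OF elim(1)]
    proof (intro allI impI)
      fix x assume x: "T z x = 0"
      have "T0 x = (\<Sum>b\<in>Basis. (x \<bullet> b) *\<^sub>R T0 b)" by (rule linear_basis_expansion[OF lin0])
      also have "\<dots> = (\<Sum>b\<in>Basis. (x \<bullet> b) *\<^sub>R T0 b) - T z x" by (simp add: x)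
      also have "\<dots> = (\<Sum>b\<in>Basis. (x \<bullet> b) *\<^sub>R (T0 b - T z b))"
        unfolding linear_basis_expansion[OF elim(1), of x] by (simp add: scaleR_diff_right sum_subtractf)
      finally have "norm (T0 x) \<le> (\<Sum>b\<in>Basis. norm x * norm (T z b - T0 b))"
        by (simp only:) (rule sum_norm_le, auto intro!: mult_right_mono Basis_le_norm simp: norm_minus_commute)
      then have "B * norm x \<le> norm x * (\<Sum>b\<in>Basis. norm (T z b - T0 b))"
        using B(2)[of x] by (simp add: sum_distrib_left)
      then show "x = 0" using elim(2) B(1) by (metis linorder_not_less mult.commute mult_strict_left_mono norm_le_zero_iff zero_less_norm_iff)
    qed
  qed
qed

lemma hyperplane_range:
  fixes \<tau> :: "real^'n \<Rightarrow> real^'m"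
  assumes card: "CARD('m) = CARD('n) + 1" and lin: "linear \<tau>" and inj: "inj \<tau>"
    and n: "n \<noteq> 0" "\<And>a. \<tau> a \<bullet> n = 0" and x: "x \<bullet> n = 0"
  shows "x \<in> range \<tau>"
proof -
  have "range \<tau> = {x. n \<bullet> x = 0}"
  proof (rule subspace_dim_equal)
    show "subspace (range \<tau>)" by (rule linear_subspace_image[OF lin subspace_UNIV])
    show "subspace {x. n \<bullet> x = 0}" by (rule subspace_hyperplane)
    show "range \<tau> \<subseteq> {x. n \<bullet> x = 0}" using n(2) by (auto simp: inner_commute)
    have "dim (range \<tau>) = dim (UNIV :: (real^'n) set)" by (rule dim_image_eq[OF lin]) (simp add: inj)
    then show "dim {x. n \<bullet> x = 0} \<le> dim (range \<tau>)" using dim_hyperplane[OF n(1)] card by simp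
  qed
  then show ?thesis using x by (auto simp: inner_commute)
qed

text \<open>Division by \<open>n \<bullet> n\<close> admits normals of any length, so that no square roots have to be
  differentiated.\<close>

definition mirror :: "'e::euclidean_space \<Rightarrow> 'e \<Rightarrow> 'e" where
  "mirror n u = u - (2 * (u \<bullet> n) / (n \<bullet> n)) *\<^sub>R n"

lemma mirror_mirror: "n \<noteq> 0 \<Longrightarrow> mirror n (mirror n u) = u"
  by (simp add: mirror_def inner_diff_left algebra_simps)

lemma norm_mirror: assumes "n \<noteq> 0" shows "norm (mirror n u) = norm u"
proof -
  have "mirror n u \<bullet> mirror n u = u \<bullet> u"
    using assms by (simp add: mirror_def inner_diff_left inner_diff_right inner_commute field_simps)
  then show ?thesis by (simp add: norm_eq_sqrt_inner)
qed

text \<open>The normal space is a line, hence the selected unit normal is a multiple of \<open>n\<close>.\<close>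

lemma reflect_at_eq:
  fixes \<psi> :: "real^'n \<Rightarrow> real^'m"
  assumes card: "CARD('m) = CARD('n) + 1" and lin: "linear (frechet_derivative \<psi> (at s))"
    and inj: "inj (frechet_derivative \<psi> (at s))"
    and n: "n \<noteq> 0" "\<And>a. frechet_derivative \<psi> (at s) a \<bullet> n = 0"
  shows "reflect_at \<psi> s L = oline (\<psi> s) (mirror n (snd L))"
proof -
  define m where "m = (SOME m. unit_normal \<psi> s m)"
  have "unit_normal \<psi> s ((1 / norm n) *\<^sub>R n)" using n by (simp add: unit_normal_def)
  then have m: "unit_normal \<psi> s m" unfolding m_def by (rule someI)
  define k where "k = (m \<bullet> n) / (n \<bullet> n)"
  have "(m - k *\<^sub>R n) \<bullet> n = 0" using n(1) by (simp add: k_def inner_diff_left)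
  from hyperplane_range[OF card lin inj n this] obtain a where a: "m - k *\<^sub>R n = frechet_derivative \<psi> (at s) a" by blast
  have "(m - k *\<^sub>R n) \<bullet> (m - k *\<^sub>R n) = frechet_derivative \<psi> (at s) a \<bullet> m - k * (frechet_derivative \<psi> (at s) a \<bullet> n)"
    unfolding a[symmetric] by (simp add: inner_diff_right)
  also have "\<dots> = 0" using m n(2) by (simp add: unit_normal_def)
  finally have mk: "m = k *\<^sub>R n" by simp
  have "m \<bullet> m = 1" using m by (simp add: unit_normal_def norm_eq_1)
  then have k: "k * k * (n \<bullet> n) = 1" unfolding mk by simp
  have "(2 * (u \<bullet> m)) *\<^sub>R m = (2 * (u \<bullet> n) / (n \<bullet> n)) *\<^sub>R n" for u
  proof -
    have "2 * (u \<bullet> n) / (n \<bullet> n) = 2 * (u \<bullet> n) * (k * k)" using k n(1) by (simp add: field_simps)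
    then show ?thesis unfolding mk by (simp add: mult_ac)
  qed
  then show ?thesis unfolding reflect_at_def Let_def m_def[symmetric] mirror_def by simp
qed

lemma oline_shift:
  assumes "q = p + t *\<^sub>R u" shows "oline q u = oline p u"
proof -
  have "q + a *\<^sub>R u = p + (t + a) *\<^sub>R u" for a by (simp add: assms scaleR_add_left)
  moreover have "p + a *\<^sub>R u = q + (a - t) *\<^sub>R u" for a by (simp add: assms scaleR_diff_left)
  ultimately have "range (\<lambda>a. q + a *\<^sub>R u) = range (\<lambda>a. p + a *\<^sub>R u)"
    by (intro subset_antisym image_subsetI) (metis rangeI)+
  then show ?thesis by (simp add: oline_def)
qed

lemma oline_point: "x \<in> fst (oline p u) \<Longrightarrow> oline p u = oline x u"
proof -
  assume "x \<in> fst (oline p u)"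
  then obtain t where "x = p + t *\<^sub>R u" by (auto simp: oline_def)
  from oline_shift[OF this] show ?thesis by simp
qed

lemma fst_oline: "x \<in> fst (oline p u) \<longleftrightarrow> (\<exists>t. x = p + t *\<^sub>R u)"
  by (auto simp: oline_def)

lemma snd_oline [simp]: "snd (oline p u) = u"
  by (simp add: oline_def)

lemma has_vector_derivative_compose_frechet:
  fixes F :: "'a::euclidean_space \<Rightarrow> 'b::euclidean_space"
  assumes "F differentiable (at (s e))" "(s has_vector_derivative s') (at e)"
  shows "((\<lambda>e. F (s e)) has_vector_derivative frechet_derivative F (at (s e)) s') (at e)"
proof -
  have "((\<lambda>x. F (s x)) has_derivative (\<lambda>t. frechet_derivative F (at (s e)) (t *\<^sub>R s'))) (at e)"
    using has_derivative_compose[OF assms(2)[unfolded has_vector_derivative_def] differentiable_has_frechet[OF assms(1)]] .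
  then show ?thesis unfolding has_vector_derivative_def
    by (simp add: linear_scale[OF linear_frechet_derivative[OF assms(1)]])
qed

lemma has_vector_derivative_inner:
  fixes f g :: "real \<Rightarrow> 'a::real_inner"
  assumes "(f has_vector_derivative f') (at e)" "(g has_vector_derivative g') (at e)"
  shows "((\<lambda>e. f e \<bullet> g e) has_vector_derivative (f e \<bullet> g' + f' \<bullet> g e)) (at e)"
  using bounded_bilinear.has_vector_derivative[OF bounded_bilinear_inner assms] .

lemma has_vector_derivative_scaleR':
  fixes g :: "real \<Rightarrow> 'a::real_normed_vector"
  assumes "(f has_vector_derivative f') (at e)" "(g has_vector_derivative g') (at e)"
  shows "((\<lambda>e. f e *\<^sub>R g e) has_vector_derivative (f e *\<^sub>R g' + f' *\<^sub>R g e)) (at e)"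
  using bounded_bilinear.has_vector_derivative[OF bounded_bilinear_scaleR assms] .

lemma has_vector_derivative_cong_eventually:
  assumes f: "(f has_vector_derivative f') (at e)" and ev: "eventually (\<lambda>x. f x = g x) (nhds e)"
  shows "(g has_vector_derivative f') (at e)"
proof -
  obtain S where S: "open S" "e \<in> S" "\<And>x. x \<in> S \<Longrightarrow> f x = g x" using ev unfolding eventually_nhds by blast
  show ?thesis by (rule has_vector_derivative_transform_within_open[OF f S])
qed

lemma isCont_eventually_open:
  assumes "isCont f x" "open S" "f x \<in> S" shows "eventually (\<lambda>y. f y \<in> S) (nhds x)"
proof -
  have "eventually (\<lambda>y. f y \<in> S) (at x)" using assms unfolding continuous_at by (rule topological_tendstoD)
  with assms(3) show ?thesis by (simp add: eventually_nhds_conv_at)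
qed

section \<open>The geometry of the hypersurface\<close>

context parametrized_hypersurface
begin

abbreviation d\<phi> :: "real^'n \<Rightarrow> real^'n \<Rightarrow> real^'m" where
  "d\<phi> s \<equiv> frechet_derivative \<phi> (at s)"

definition \<nu> :: "real^'n \<Rightarrow> real^'m" where
  "\<nu> s = N (\<phi> s)"

lemma open_D: "open D"
  using domain by (simp add: contractible_domain_def)

lemma smooth_d\<phi>: "smooth_on D (\<lambda>s. d\<phi> s a)"
  by (rule smooth_on_deriv[OF smooth_param])

lemma linear_d\<phi>: "s \<in> D \<Longrightarrow> linear (d\<phi> s)"
  by (rule linear_frechet_derivative[OF smooth_on_differentiable[OF smooth_param]])

lemma smooth_\<nu>: "smooth_on D \<nu>"
  using smooth_normal by (simp add: \<nu>_def[abs_def])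

lemma norm_\<nu>: "s \<in> D \<Longrightarrow> norm (\<nu> s) = 1"
  and d\<phi>_\<nu>: "s \<in> D \<Longrightarrow> d\<phi> s a \<bullet> \<nu> s = 0"
  using normal[of s] by (auto simp: unit_normal_def \<nu>_def)

lemma \<nu>_\<nu>: "s \<in> D \<Longrightarrow> \<nu> s \<bullet> \<nu> s = 1"
  using norm_\<nu> by (simp add: norm_eq_1)

lemma \<nu>_nonzero: "s \<in> D \<Longrightarrow> \<nu> s \<noteq> 0"
  using norm_\<nu> by fastforce

lemma tangent_vector:
  assumes "s \<in> D" "x \<bullet> \<nu> s = 0" obtains a where "x = d\<phi> s a"
  using hyperplane_range[OF codim_one linear_d\<phi>[OF assms(1)] immersion[OF assms(1)] \<nu>_nonzero[OF assms(1)] d\<phi>_\<nu>[OF assms(1)] assms(2)]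
  by blast

lemma inj_param: "inj_on \<phi> D"
proof -
  obtain h where "homeomorphism D (\<phi> ` D) \<phi> h" using embedding by blast
  then show ?thesis by (intro inj_on_inverseI[of D h]) (rule homeomorphism_apply1)
qed

lemma param_\<phi>: "s \<in> D \<Longrightarrow> param (\<phi> s) = s"
  unfolding param_def by (rule the_inv_into_f_f[OF inj_param])

lemma embedding_near:
  assumes s0: "s0 \<in> D" and r: "r > 0"
  obtains \<rho> where "\<rho> > 0" "\<And>s. s \<in> D \<Longrightarrow> dist (\<phi> s) (\<phi> s0) < \<rho> \<Longrightarrow> dist s s0 < r"
proof -
  obtain h where h: "homeomorphism D (\<phi> ` D) \<phi> h" using embedding by blast
  then have "continuous_on (\<phi> ` D) h" by (simp add: homeomorphism_def)
  moreover have "\<phi> s0 \<in> \<phi> ` D" using s0 by simp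
  ultimately have "\<exists>\<rho>>0. \<forall>x\<in>\<phi> ` D. dist x (\<phi> s0) < \<rho> \<longrightarrow> dist (h x) (h (\<phi> s0)) < r"
    using r unfolding continuous_on_iff by blast
  then obtain \<rho> where \<rho>: "\<rho> > 0" "\<forall>x\<in>\<phi> ` D. dist x (\<phi> s0) < \<rho> \<longrightarrow> dist (h x) (h (\<phi> s0)) < r" by blast
  show thesis
  proof (rule that[OF \<rho>(1)])
    fix s assume s: "s \<in> D" "dist (\<phi> s) (\<phi> s0) < \<rho>"
    then have "dist (h (\<phi> s)) (h (\<phi> s0)) < r" using \<rho>(2) by blast
    then show "dist s s0 < r" by (simp add: homeomorphism_apply1[OF h] s s0)
  qed
qed

definition proj :: "real^'m \<Rightarrow> real^'n" where
  "proj v = (\<chi> i. v $ \<iota> i)"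

lemma linear_proj: "linear proj"
  by (rule linearI) (simp_all add: proj_def vec_eq_iff)

lemma bounded_linear_proj: "bounded_linear proj"
  using linear_proj linear_conv_bounded_linear by blast

lemma linear_proj_d\<phi>: "s \<in> D \<Longrightarrow> linear (\<lambda>a. proj (d\<phi> s a))"
  using linear_compose[OF linear_d\<phi> linear_proj] by (simp add: o_def)

lemma inj_proj_d\<phi>: assumes "s \<in> D" shows "inj (\<lambda>a. proj (d\<phi> s a))"
proof (rule injI)
  fix a b assume "proj (d\<phi> s a) = proj (d\<phi> s b)"
  then have "d\<phi> s a = d\<phi> s b" using tangent_proj[OF assms] unfolding proj_def inj_on_def by blast
  then show "a = b" using immersion[OF assms] by (simp add: inj_def)
qed

text \<open>\<open>lift s w\<close> is the tangent vector with coordinates \<open>w\<close>.\<close>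

definition lift :: "real^'n \<Rightarrow> real^'n \<Rightarrow> real^'m" where
  "lift s w = d\<phi> s (inv (\<lambda>a. proj (d\<phi> s a)) w)"

lemma proj_lift: assumes "s \<in> D" shows "proj (lift s w) = w"
  unfolding lift_def using surj_f_inv_f[OF linear_inj_imp_surj[OF linear_proj_d\<phi> inj_proj_d\<phi>], OF assms assms, of w] .

lemma lift_\<nu>: "s \<in> D \<Longrightarrow> lift s w \<bullet> \<nu> s = 0"
  unfolding lift_def by (rule d\<phi>_\<nu>)

lemma lift_proj: assumes "s \<in> D" "x \<bullet> \<nu> s = 0" shows "lift s (proj x) = x"
proof -
  obtain a where a: "x = d\<phi> s a" by (rule tangent_vector[OF assms])
  show ?thesis unfolding lift_def a using inv_f_f[OF inj_proj_d\<phi>[OF assms(1)], of a] by simp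
qed

lemma lift_surj: assumes "s \<in> D" obtains w where "d\<phi> s a = lift s w"
  using lift_proj[OF assms d\<phi>_\<nu>[OF assms]] by metis

lemma linear_lift: assumes "s \<in> D" shows "linear (lift s)"
proof (rule linearI)
  fix v w and r :: real
  have l: "lift s v \<bullet> \<nu> s = 0" for v by (rule lift_\<nu>[OF assms])
  show "lift s (v + w) = lift s v + lift s w"
    using lift_proj[OF assms, of "lift s v + lift s w"] by (simp add: l inner_add_left linear_add[OF linear_proj] proj_lift[OF assms])
  show "lift s (r *\<^sub>R v) = r *\<^sub>R lift s v"
    using lift_proj[OF assms, of "r *\<^sub>R lift s v"] by (simp add: l linear_scale[OF linear_proj] proj_lift[OF assms])
qed

lemma inj_lift: "s \<in> D \<Longrightarrow> inj (lift s)"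
  by (metis injI proj_lift)

lemma smooth_lift: "smooth_on D (\<lambda>s. lift s w)"
proof -
  let ?k = "\<lambda>s. inv (\<lambda>a. proj (d\<phi> s a)) w"
  have k: "smooth_on D ?k"
  proof (rule smooth_on_linear_system_solution[where T="\<lambda>s a. proj (d\<phi> s a)" and y="\<lambda>_. w"])
    show "smooth_on D (\<lambda>s. proj (d\<phi> s b))" for b
      by (rule smooth_on_linear_comp[OF bounded_linear_proj open_D smooth_d\<phi>])
    show "s \<in> D \<Longrightarrow> proj (d\<phi> s (inv (\<lambda>a. proj (d\<phi> s a)) w)) = w" for s
      using proj_lift[of s w] by (simp add: lift_def)
  qed (simp_all add: open_D linear_proj_d\<phi> inj_proj_d\<phi>)
  show ?thesis unfolding lift_def by (rule smooth_on_deriv_along[OF open_D smooth_param k])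
qed

text \<open>By transversality the derivative is bijective at the initial point. Carrying the deformation
  parameter \<open>e\<close> and the direction \<open>w\<close> as components makes the local inverse \<open>g\<close> differentiable in them,
  so that one lemma covers the reflected line and the line after the inverse reflection.\<close>

lemma deform_hit:
  assumes s0: "s0 \<in> D" and w0: "w0 \<bullet> \<nu> s0 \<noteq> 0" and f: "f \<in> smooth_functions"
  obtains U' V g where "open U'" "(s0, 0, 0, w0) \<in> U'" "U' \<subseteq> D \<times> UNIV" "open V" "(\<phi> s0, 0, w0) \<in> V"
    "homeomorphism U' V (\<lambda>(s, t, e, w). (deform f e s - t *\<^sub>R w, e, w)) g"
    "g differentiable (at (\<phi> s0, 0, w0))" "g (\<phi> s0, 0, w0) = (s0, 0, 0, w0)"
proof -
  define F where "F s = f (\<phi> s)" for s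
  have F: "smooth_on D F" using f by (simp add: smooth_functions_def F_def[abs_def])
  define \<Phi> where "\<Phi> = (\<lambda>z::(real^'n) \<times> real \<times> real \<times> (real^'m).
    ((\<phi> (fst z) + (fst (snd (snd z)) * F (fst z)) *\<^sub>R \<nu> (fst z)) - fst (snd z) *\<^sub>R snd (snd (snd z)), fst (snd (snd z)), snd (snd (snd z))))"
  have \<Phi>_eq: "\<Phi> = (\<lambda>(s, t, e, w). (deform f e s - t *\<^sub>R w, e, w))"
    by (auto simp: \<Phi>_def deform_def F_def \<nu>_def)
  let ?S = "D \<times> (UNIV :: (real \<times> real \<times> (real^'m)) set)"
  have S: "open ?S" by (intro open_Times open_D open_UNIV)
  have bl: "bounded_linear (\<lambda>z::(real^'n) \<times> real \<times> real \<times> (real^'m). fst (snd (snd z)))"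
    "bounded_linear (\<lambda>z::(real^'n) \<times> real \<times> real \<times> (real^'m). snd (snd (snd z)))"
    "bounded_linear (\<lambda>z::(real^'n) \<times> real \<times> real \<times> (real^'m). fst (snd z))"
    by (intro bounded_linear_intros)+
  have sm: "smooth_on ?S (\<lambda>z. h (fst z))" if "smooth_on D h" for h :: "real^'n \<Rightarrow> 'z::euclidean_space"
    by (rule smooth_on_fst[OF S open_D that]) auto
  have \<Phi>: "smooth_on ?S \<Phi>" unfolding \<Phi>_def
    by (intro smooth_on_Pair S smooth_on_diff smooth_on_add smooth_on_scaleR smooth_on_mult sm smooth_param F smooth_\<nu>
        smooth_on_bounded_linear[OF bl(1)] smooth_on_bounded_linear[OF bl(2)] smooth_on_bounded_linear[OF bl(3)])
  let ?z0 = "(s0, 0, 0, w0)"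
  define A where "A = (\<lambda>h::(real^'n) \<times> real \<times> real \<times> (real^'m).
    ((d\<phi> s0 (fst h) + (fst (snd (snd h)) * F s0) *\<^sub>R \<nu> s0) - fst (snd h) *\<^sub>R w0, fst (snd (snd h)), snd (snd (snd h))))"
  have fst_der: "((\<lambda>z. h (fst z)) has_derivative (\<lambda>v. frechet_derivative h (at s0) (fst v))) (at ?z0)"
    if "smooth_on D h" for h :: "real^'n \<Rightarrow> 'z::euclidean_space"
    using has_derivative_compose[OF has_derivative_fst[OF has_derivative_ident], of h _ ?z0 UNIV]
      smooth_on_has_derivative[OF that s0] by simp
  have "(\<Phi> has_derivative A) (at ?z0)" unfolding \<Phi>_def A_def
    by (rule has_derivative_eq_rhs[OF has_derivative_Pair[OF has_derivative_diff[OF has_derivative_add[OF fst_der[OF smooth_param]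
        has_derivative_scaleR[OF has_derivative_mult[OF bounded_linear_imp_has_derivative[OF bl(1)] fst_der[OF F]] fst_der[OF smooth_\<nu>]]]
        has_derivative_scaleR[OF bounded_linear_imp_has_derivative[OF bl(3)] bounded_linear_imp_has_derivative[OF bl(2)]]]
        has_derivative_Pair[OF bounded_linear_imp_has_derivative[OF bl(1)] bounded_linear_imp_has_derivative[OF bl(2)]]]])
      (simp add: fun_eq_iff)
  then have A: "frechet_derivative \<Phi> (at ?z0) = A" by (rule frechet_derivative_eqI)
  have linA: "linear A" using linear_frechet_derivative[OF smooth_on_differentiable[OF \<Phi>, of ?z0]] s0 by (simp add: A)
  have "inj A" unfolding linear_injective_0[OF linA]
  proof (intro allI impI)
    fix h assume "A h = 0"
    then have h: "fst (snd (snd h)) = 0" "snd (snd (snd h)) = 0" "d\<phi> s0 (fst h) = fst (snd h) *\<^sub>R w0"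
      by (auto simp: A_def zero_prod_def)
    from arg_cong[OF h(3), of "\<lambda>v. v \<bullet> \<nu> s0"] have "fst (snd h) = 0" using w0 d\<phi>_\<nu>[OF s0] by simp
    moreover from this h(3) have "d\<phi> s0 (fst h) = d\<phi> s0 0" by (simp add: linear_0[OF linear_d\<phi>[OF s0]])
    then have "fst h = 0" using immersion[OF s0] by (simp add: inj_def)
    ultimately show "h = 0" using h(1,2) by (simp add: prod_eq_iff)
  qed
  moreover have "surj A"
  proof (rule surjI)
    fix y :: "(real^'m) \<times> real \<times> (real^'m)"
    define q where "q = fst y - (fst (snd y) * F s0) *\<^sub>R \<nu> s0"
    define t where "t = - (q \<bullet> \<nu> s0) / (w0 \<bullet> \<nu> s0)"
    have "(q + t *\<^sub>R w0) \<bullet> \<nu> s0 = 0" using w0 by (simp only: t_def inner_add_left inner_scaleR_left) simp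
    then obtain a where "q + t *\<^sub>R w0 = d\<phi> s0 a" using tangent_vector[OF s0] by blast
    then have "A (a, t, fst (snd y), snd (snd y)) = y" by (simp add: A_def q_def algebra_simps prod_eq_iff)
    then show "A (SOME h. A h = y) = y" by (rule someI)
  qed
  ultimately have "bij (frechet_derivative \<Phi> (at ?z0))" by (simp add: A bij_def)
  moreover have z0: "?z0 \<in> ?S" using s0 by simp
  moreover have \<Phi>z0: "\<Phi> ?z0 = (\<phi> s0, 0, w0)" by (simp add: \<Phi>_def)
  ultimately obtain U' V g where *: "open U'" "U' \<subseteq> ?S" "?z0 \<in> U'" "open V" "(\<phi> s0, 0, w0) \<in> V" "homeomorphism U' V \<Phi> g"
    "g differentiable (at (\<phi> s0, 0, w0))" using smooth_local_inverse[OF S \<Phi>, of ?z0] by metis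
  show thesis
  proof (rule that[OF *(1,3,2,4,5)])
    show "homeomorphism U' V (\<lambda>(s, t, e, w). (deform f e s - t *\<^sub>R w, e, w)) g" using *(6) by (simp add: \<Phi>_eq)
    show "g (\<phi> s0, 0, w0) = ?z0" using homeomorphism_apply1[OF *(6,3)] by (simp add: \<Phi>z0)
  qed (rule *(7))
qed

end

section \<open>First-order variation of the reflected line\<close>

lemma differentiable_at_curve:
  fixes g :: "'a::euclidean_space \<Rightarrow> 'b::euclidean_space" and q :: "real \<Rightarrow> 'a"
  assumes "g differentiable (at (q e))" "(q has_vector_derivative q') (at e)"
  shows "\<exists>d. ((\<lambda>e. g (q e)) has_vector_derivative d) (at e)"
  using has_vector_derivative_compose_frechet[OF assms] by blast

lemma has_vector_derivative_Pair':
  assumes "(f has_vector_derivative f') (at e)" "(g has_vector_derivative g') (at e)"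
  shows "((\<lambda>e. (f e, g e)) has_vector_derivative (f', g')) (at e)"
  using has_derivative_Pair[OF assms[unfolded has_vector_derivative_def]] by (simp add: has_vector_derivative_def)

lemma has_vector_derivative_bounded_linear:
  "bounded_linear L \<Longrightarrow> (f has_vector_derivative f') F \<Longrightarrow> ((\<lambda>e. L (f e)) has_vector_derivative L f') F"
  by (rule bounded_linear.has_vector_derivative)

context parametrized_hypersurface
begin

definition pull :: "(real^'m \<Rightarrow> real) \<Rightarrow> real^'n \<Rightarrow> real" where
  "pull f s = f (\<phi> s)"

definition disp :: "(real^'m \<Rightarrow> real) \<Rightarrow> real^'n \<Rightarrow> real^'m" where
  "disp f s = pull f s *\<^sub>R \<nu> s"

lemma smooth_pull: "f \<in> smooth_functions \<Longrightarrow> smooth_on D (pull f)"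
  by (simp add: smooth_functions_def pull_def[abs_def])

lemma smooth_disp: "f \<in> smooth_functions \<Longrightarrow> smooth_on D (disp f)"
  unfolding disp_def[abs_def] by (intro smooth_on_scaleR open_D smooth_pull smooth_\<nu>)

lemma deform_disp: "deform f e s = \<phi> s + e *\<^sub>R disp f s"
  by (simp add: deform_def disp_def pull_def \<nu>_def)

lemma frechet_deform:
  assumes f: "f \<in> smooth_functions" and s: "s \<in> D"
  shows "frechet_derivative (deform f e) (at s) = (\<lambda>a. d\<phi> s a + e *\<^sub>R frechet_derivative (disp f) (at s) a)"
    and "linear (frechet_derivative (deform f e) (at s))"
proof -
  have "(deform f e has_derivative (\<lambda>a. d\<phi> s a + e *\<^sub>R frechet_derivative (disp f) (at s) a)) (at s)"
    unfolding deform_disp[abs_def]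
    by (intro has_derivative_add has_derivative_scaleR_right smooth_on_has_derivative[OF smooth_param s]
        smooth_on_has_derivative[OF smooth_disp[OF f] s])
  then show 1: "frechet_derivative (deform f e) (at s) = (\<lambda>a. d\<phi> s a + e *\<^sub>R frechet_derivative (disp f) (at s) a)"
    by (rule frechet_derivative_eqI)
  show "linear (frechet_derivative (deform f e) (at s))"
    using \<open>(deform f e has_derivative _) (at s)\<close> linear_frechet_derivative differentiable_def by blast
qed

lemma disp_normal:
  assumes f: "f \<in> smooth_functions" and s: "s \<in> D"
  shows "frechet_derivative (disp f) (at s) a \<bullet> \<nu> s = frechet_derivative (pull f) (at s) a"
    and "frechet_derivative \<nu> (at s) a \<bullet> \<nu> s = 0"
proof -
  have "frechet_derivative (\<lambda>s. \<nu> s \<bullet> \<nu> s) (at s) = frechet_derivative (\<lambda>_. 1) (at s)"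
    by (rule frechet_derivative_cong_open[OF open_D s]) (rule \<nu>_\<nu>)
  then show 1: "frechet_derivative \<nu> (at s) a \<bullet> \<nu> s = 0"
    using smooth_on_frechet_bilinear[OF bounded_bilinear_inner smooth_\<nu> smooth_\<nu> s, of a]
    by (simp add: inner_commute)
  have "frechet_derivative (disp f) (at s) a = pull f s *\<^sub>R frechet_derivative \<nu> (at s) a + frechet_derivative (pull f) (at s) a *\<^sub>R \<nu> s"
    unfolding disp_def[abs_def] by (rule smooth_on_frechet_bilinear[OF bounded_bilinear_scaleR smooth_pull[OF f] smooth_\<nu> s])
  then show "frechet_derivative (disp f) (at s) a \<bullet> \<nu> s = frechet_derivative (pull f) (at s) a"
    by (simp add: inner_add_left 1 \<nu>_\<nu>[OF s])
qed

text \<open>The Weingarten relation.\<close>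

lemma second_fundamental_form:
  assumes s: "s \<in> D"
  shows "frechet_derivative (\<lambda>s. d\<phi> s a) (at s) b \<bullet> \<nu> s = - (d\<phi> s a \<bullet> frechet_derivative \<nu> (at s) b)"
proof -
  have "frechet_derivative (\<lambda>s. d\<phi> s a \<bullet> \<nu> s) (at s) = frechet_derivative (\<lambda>_. 0) (at s)"
    by (rule frechet_derivative_cong_open[OF open_D s]) (rule d\<phi>_\<nu>)
  then show ?thesis using smooth_on_frechet_bilinear[OF bounded_bilinear_inner smooth_d\<phi>[of a] smooth_\<nu> s, of b] by simp
qed

text \<open>The point found by the implicit function theorem is the minimizer: since \<open>\<phi>\<close> is an embedding, a
  competitor that is not farther from \<open>\<phi> s0\<close> has a parameter close to \<open>s0\<close>, and there the intersection
  is unique. Closeness of the positions on the line follows, as they are determined by the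
  intersection points.\<close>

lemma near_hit_curve:
  assumes s0: "s0 \<in> D" and f: "f \<in> smooth_functions" and u: "norm u = 1" "u \<bullet> \<nu> s0 \<noteq> 0"
  obtains s t s' t' where "(s has_vector_derivative s') (at 0)" "(t has_vector_derivative t') (at 0)"
    "s 0 = s0" "t 0 = 0"
    "eventually (\<lambda>e. s e \<in> D \<and> deform f e (s e) = \<phi> s0 + t e *\<^sub>R u \<and>
       near_hit f e (\<phi> s0) (oline (\<phi> s0) u) = s e) (nhds 0)"
proof -
  obtain U' V g where U': "open U'" "(s0, 0, 0, u) \<in> U'" "U' \<subseteq> D \<times> UNIV" and V: "open V" "(\<phi> s0, 0, u) \<in> V"
    and hom: "homeomorphism U' V (\<lambda>(s, t, e, w). (deform f e s - t *\<^sub>R w, e, w)) g"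
    and g: "g differentiable (at (\<phi> s0, 0, u))" "g (\<phi> s0, 0, u) = (s0, 0, 0, u)"
    using deform_hit[OF s0 u(2) f] by blast
  define G where "G e = g (\<phi> s0, e, u)" for e
  define s where "s e = fst (G e)" for e
  define t where "t e = fst (snd (G e))" for e
  have q: "((\<lambda>e. (\<phi> s0, e, u)) has_vector_derivative (0, 1, 0)) (at 0)"
    by (intro has_vector_derivative_Pair' has_vector_derivative_const has_vector_derivative_id)
  obtain d where d: "(G has_vector_derivative d) (at 0)"
    using differentiable_at_curve[OF _ q, of g] g(1) unfolding G_def by blast
  have s': "(s has_vector_derivative fst d) (at 0)" unfolding s_def
    by (rule has_vector_derivative_bounded_linear[OF bounded_linear_fst d])
  have t': "(t has_vector_derivative fst (snd d)) (at 0)" unfolding t_def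
    by (intro has_vector_derivative_bounded_linear[OF bounded_linear_fst] has_vector_derivative_bounded_linear[OF bounded_linear_snd] d)
  have G0: "G 0 = (s0, 0, 0, u)" by (simp add: G_def g(2))
  have s_0: "s 0 = s0" and t_0: "t 0 = 0" by (simp_all add: s_def t_def G0)
  have evV: "eventually (\<lambda>e. (\<phi> s0, e, u) \<in> V) (nhds 0)"
    by (rule isCont_eventually_open[OF _ V(1)]) (use V(2) has_vector_derivative_continuous[OF q] in auto)
  have sol: "s e \<in> D \<and> deform f e (s e) = \<phi> s0 + t e *\<^sub>R u" if "(\<phi> s0, e, u) \<in> V" for e
  proof -
    have "(\<lambda>(s, t, e, w). (deform f e s - t *\<^sub>R w, e, w)) (G e) = (\<phi> s0, e, u)"
      unfolding G_def by (rule homeomorphism_apply2[OF hom that])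
    moreover have "G e \<in> U'" unfolding G_def using homeomorphism_image2[OF hom] that by blast
    ultimately show ?thesis using U'(3) unfolding s_def t_def by (auto simp: split_beta algebra_simps)
  qed
  obtain A1 B1 where 1: "open A1" "open B1" "(s0, 0, 0, u) \<in> A1 \<times> B1" "A1 \<times> B1 \<subseteq> U'" using open_prod_elim[OF U'(1,2)] .
  obtain B C1 where 2: "open B" "open C1" "(0, 0, u) \<in> B \<times> C1" "B \<times> C1 \<subseteq> B1"
    using open_prod_elim[OF 1(2), of "(0, 0, u)"] 1(3) by auto
  obtain C E where 3: "open C" "open E" "(0, u) \<in> C \<times> E" "C \<times> E \<subseteq> C1"
    using open_prod_elim[OF 2(2), of "(0, u)"] 2(3) by auto
  define h where "h z = (deform f (snd z) (fst z) - \<phi> s0) \<bullet> u" for z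
  have "isCont h (s0, 0)"
  proof -
    have "isCont (\<lambda>z::(real^'n) \<times> real. \<phi> (fst z)) (s0, 0)" "isCont (\<lambda>z::(real^'n) \<times> real. disp f (fst z)) (s0, 0)"
      by (rule continuous_at_compose[of _ fst, unfolded o_def];
        use s0 f in \<open>auto intro!: continuous_intros differentiable_imp_continuous_within smooth_on_differentiable[OF smooth_param] smooth_on_differentiable[OF smooth_disp]\<close>)+
    then show ?thesis unfolding h_def deform_disp by (intro continuous_intros)
  qed
  then have "eventually (\<lambda>z. h z \<in> B) (nhds (s0, 0))"
    by (rule isCont_eventually_open[OF _ 2(1)]) (use 2(3) in \<open>simp add: h_def deform_disp\<close>)
  then obtain Z where Z: "open Z" "(s0, 0) \<in> Z" "\<And>z. z \<in> Z \<Longrightarrow> h z \<in> B" unfolding eventually_nhds by blast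
  obtain A2 C2 where 4: "open A2" "open C2" "(s0, 0) \<in> A2 \<times> C2" "A2 \<times> C2 \<subseteq> Z" using open_prod_elim[OF Z(1,2)] .
  have unique: "s1 = s e" if s1: "s1 \<in> A1 \<inter> A2" and e: "e \<in> C \<inter> C2" and eq: "deform f e s1 = \<phi> s0 + t1 *\<^sub>R u" for s1 e t1
  proof -
    have "h (s1, e) = t1" using u(1) by (simp add: h_def eq norm_eq_1)
    moreover have "(s1, e) \<in> Z" using 4(4) s1 e by blast
    ultimately have "t1 \<in> B" using Z(3) by metis
    then have "(s1, t1, e, u) \<in> U'" using 1(4) 2(4) 3(3,4) s1 e by blast
    from homeomorphism_apply1[OF hom this] have "G e = (s1, t1, e, u)" by (simp add: eq G_def)
    then show ?thesis by (simp add: s_def)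
  qed
  have "open (A1 \<inter> A2)" "s0 \<in> A1 \<inter> A2" using 1 4 by auto
  then obtain r where r: "r > 0" "ball s0 r \<subseteq> A1 \<inter> A2" using open_contains_ball by blast
  obtain \<rho> where \<rho>: "\<rho> > 0" "\<And>s. s \<in> D \<Longrightarrow> dist (\<phi> s) (\<phi> s0) < \<rho> \<Longrightarrow> dist s s0 < r"
    using embedding_near[OF s0 r(1)] by blast
  have ev\<rho>: "eventually (\<lambda>e. \<phi> (s e) \<in> ball (\<phi> s0) \<rho>) (nhds 0)"
  proof (rule isCont_eventually_open)
    show "isCont (\<lambda>e. \<phi> (s e)) 0"
      using has_vector_derivative_continuous[OF has_vector_derivative_compose_frechet[OF _ s', of \<phi>]]
        smooth_on_differentiable[OF smooth_param s0] by (simp add: s_0)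
  qed (use \<rho>(1) in \<open>auto simp: s_0\<close>)
  have evC: "eventually (\<lambda>e. e \<in> C \<inter> C2) (nhds 0)"
    by (rule eventually_nhds_in_open) (use 3 4 in auto)
  have "eventually (\<lambda>e. s e \<in> D \<and> deform f e (s e) = \<phi> s0 + t e *\<^sub>R u \<and>
       near_hit f e (\<phi> s0) (oline (\<phi> s0) u) = s e) (nhds 0)"
    using evV evC ev\<rho>
  proof eventually_elim
    case (elim e)
    note se = sol[OF elim(1)]
    let ?P = "\<lambda>s. s \<in> D \<and> deform f e s \<in> fst (oline (\<phi> s0) u)"
    let ?d = "\<lambda>s. dist (\<phi> s) (\<phi> s0)"
    have Ps: "?P (s e)" using se by (auto simp: fst_oline)
    have near: "s1 = s e" if P1: "?P s1" and d1: "?d s1 \<le> ?d (s e)" for s1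
    proof -
      have "?d s1 < \<rho>" using d1 elim(3) by (simp add: dist_commute)
      then have "s1 \<in> A1 \<inter> A2" using \<rho>(2)[of s1] P1 r(2) by (auto simp: dist_commute)
      moreover obtain t1 where "deform f e s1 = \<phi> s0 + t1 *\<^sub>R u" using P1 unfolding fst_oline by blast
      ultimately show ?thesis using unique elim(2) by blast
    qed
    have "is_arg_min ?d ?P (s e)" unfolding is_arg_min_def
    proof (intro conjI notI)
      show "s e \<in> D" "deform f e (s e) \<in> fst (oline (\<phi> s0) u)" using Ps by auto
      assume "\<exists>y. ?P y \<and> ?d y < ?d (s e)"
      then obtain y where y: "?P y" "?d y < ?d (s e)" by blast
      then have "y = s e" using near[of y] by simp
      then show False using y(2) by simp
    qed
    moreover have "y = s e" if "is_arg_min ?d ?P y" for y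
    proof (rule near)
      show "?P y" using that by (simp add: is_arg_min_def)
      show "?d y \<le> ?d (s e)" using that Ps unfolding is_arg_min_def by (meson linorder_not_less)
    qed
    ultimately have "arg_min ?d ?P = s e" unfolding arg_min_def by (rule some_equality)
    then show ?case using se by (simp add: near_hit_def)
  qed
  then show thesis using that[OF s' t' s_0 t_0] by blast
qed

text \<open>A normal field of the deformed hypersurfaces along a curve of points, normalized by its
  component along the initial normal; its tangential part solves a linear system whose initial
  matrix is the Gram matrix of the immersion.\<close>

lemma normal_curve:
  assumes s0: "s 0 = s0" "s0 \<in> D" and f: "f \<in> smooth_functions" and s: "(s has_vector_derivative s') (at 0)"
  obtains n n' where "(n has_vector_derivative n') (at 0)" "n 0 = \<nu> s0"
    "\<And>a. n' \<bullet> d\<phi> s0 a = d\<phi> s0 a \<bullet> frechet_derivative \<nu> (at s0) s' - frechet_derivative (pull f) (at s0) a"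
    "n' \<bullet> \<nu> s0 = 0"
    "eventually (\<lambda>e. n e \<noteq> 0 \<and> inj (frechet_derivative (deform f e) (at (s e))) \<and>
       (\<forall>a. frechet_derivative (deform f e) (at (s e)) a \<bullet> n e = 0)) (nhds 0)"
proof -
  define \<tau> where "\<tau> e a = d\<phi> (s e) a + e *\<^sub>R frechet_derivative (disp f) (at (s e)) a" for e a
  let ?T2 = "\<lambda>a. frechet_derivative (\<lambda>s. d\<phi> s a) (at s0) s' + frechet_derivative (disp f) (at s0) a"
  have \<tau>': "((\<lambda>e. \<tau> e a) has_vector_derivative ?T2 a) (at 0)" for a
  proof -
    have 1: "((\<lambda>e. d\<phi> (s e) a) has_vector_derivative frechet_derivative (\<lambda>s. d\<phi> s a) (at s0) s') (at 0)"
      using has_vector_derivative_compose_frechet[OF _ s, of "\<lambda>s. d\<phi> s a"] smooth_on_differentiable[OF smooth_d\<phi> s0(2)] by (simp add: s0(1))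
    have 2: "((\<lambda>e. frechet_derivative (disp f) (at (s e)) a) has_vector_derivative
        frechet_derivative (\<lambda>s. frechet_derivative (disp f) (at s) a) (at s0) s') (at 0)"
      using has_vector_derivative_compose_frechet[OF _ s, of "\<lambda>s. frechet_derivative (disp f) (at s) a"]
        smooth_on_differentiable[OF smooth_on_deriv[OF smooth_disp[OF f]] s0(2)] by (simp add: s0(1))
    show ?thesis unfolding \<tau>_def
      using has_vector_derivative_add[OF 1 has_vector_derivative_scaleR'[OF has_vector_derivative_id 2]] by (simp add: s0(1))
  qed
  have \<tau>0: "\<tau> 0 = d\<phi> s0" by (simp add: \<tau>_def s0(1) fun_eq_iff)
  have \<tau>_lim: "((\<lambda>e. \<tau> e a) \<longlongrightarrow> d\<phi> s0 a) (nhds 0)" for a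
    using has_vector_derivative_continuous[OF \<tau>'[of a]] by (simp add: continuous_at_imp_continuous_at_within isCont_def tendsto_nhds_iff \<tau>0)
  have evD: "eventually (\<lambda>e. s e \<in> D) (nhds 0)"
    by (rule isCont_eventually_open[OF has_vector_derivative_continuous[OF s] open_D]) (simp add: s0)
  have \<tau>_deform: "frechet_derivative (deform f e) (at (s e)) = \<tau> e" "linear (\<tau> e)" if "s e \<in> D" for e
    using frechet_deform[OF f that, of e] by (simp_all add: \<tau>_def[abs_def])
  have ev_inj: "eventually (\<lambda>e. inj (\<tau> e)) (nhds 0)"
    by (rule eventually_inj_linear[OF _ linear_d\<phi>[OF s0(2)] immersion[OF s0(2)] \<tau>_lim])
      (use evD \<tau>_deform(2) in \<open>auto elim: eventually_mono\<close>)
  define T where "T e c = (\<Sum>a\<in>Basis. (d\<phi> s0 c \<bullet> \<tau> e a) *\<^sub>R a)" for e c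
  have linT: "linear (T e)" for e
    unfolding T_def[abs_def] using linear_d\<phi>[OF s0(2)]
    by (intro linearI) (simp_all add: linear_add linear_scale inner_add_left scaleR_add_left sum.distrib scaleR_sum_right)
  have T_inner: "T e c \<bullet> v = d\<phi> s0 c \<bullet> \<tau> e v" if "linear (\<tau> e)" for e c v
  proof -
    have "d\<phi> s0 c \<bullet> \<tau> e v = d\<phi> s0 c \<bullet> (\<Sum>a\<in>Basis. (v \<bullet> a) *\<^sub>R \<tau> e a)"
      using linear_basis_expansion[OF that, of v] by simp
    then show ?thesis unfolding T_def by (simp add: inner_sum_left inner_sum_right inner_commute[of v] mult.commute)
  qed
  have injT0: "inj (T 0)" unfolding linear_injective_0[OF linT]
  proof (intro allI impI)
    fix c assume "T 0 c = 0"
    then have "d\<phi> s0 c \<bullet> d\<phi> s0 c = 0" using T_inner[of 0 c c] linear_d\<phi>[OF s0(2)] by (simp add: \<tau>0)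
    then have "d\<phi> s0 c = d\<phi> s0 0" by (simp add: linear_0[OF linear_d\<phi>[OF s0(2)]])
    then show "c = 0" using immersion[OF s0(2)] by (simp add: inj_def)
  qed
  have ev_injT: "eventually (\<lambda>e. inj (T e)) (nhds 0)"
  proof (rule eventually_inj_linear[OF _ linT injT0])
    show "((\<lambda>e. T e b) \<longlongrightarrow> T 0 b) (nhds 0)" for b
      unfolding T_def \<tau>0 by (intro tendsto_intros \<tau>_lim)
  qed (simp add: linT)
  from eventually_conj[OF evD eventually_conj[OF ev_inj ev_injT]]
  obtain Z where Z: "open Z" "0 \<in> Z" "\<And>e. e \<in> Z \<Longrightarrow> s e \<in> D" "\<And>e. e \<in> Z \<Longrightarrow> inj (\<tau> e)" "\<And>e. e \<in> Z \<Longrightarrow> inj (T e)"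
    unfolding eventually_nhds by blast
  define y where "y e = - (\<Sum>a\<in>Basis. (\<nu> s0 \<bullet> \<tau> e a) *\<^sub>R a)" for e
  define c where "c e = inv (T e) (y e)" for e
  have Tc: "T e (c e) = y e" if "e \<in> Z" for e
    unfolding c_def using surj_f_inv_f[OF linear_inj_imp_surj[OF linT Z(5)[OF that]]] .
  have dT: "(\<lambda>e. T e b) differentiable (at 0)" and dy: "y differentiable (at 0)" for b
  proof -
    have "(\<lambda>e. \<tau> e a) differentiable (at 0)" for a
      using \<tau>'[of a] unfolding has_vector_derivative_def differentiable_def by blast
    then show "(\<lambda>e. T e b) differentiable (at 0)" "y differentiable (at 0)"
      unfolding T_def y_def
      by (intro differentiable_minus differentiable_sum differentiable_scaleR differentiable_inner differentiable_const; simp)+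
  qed
  have "c differentiable (at 0)"
    by (rule linear_system_solution_differentiable[OF Z(1,2) linT injT0 dT dy Tc])
  then obtain c' where c': "(c has_vector_derivative c') (at 0)" using vector_derivative_works by blast
  define n where "n e = \<nu> s0 + d\<phi> s0 (c e)" for e
  have bl: "bounded_linear (d\<phi> s0)" using linear_d\<phi>[OF s0(2)] linear_conv_bounded_linear by blast
  have n': "(n has_vector_derivative d\<phi> s0 c') (at 0)" unfolding n_def
    using has_vector_derivative_add[OF has_vector_derivative_const has_vector_derivative_bounded_linear[OF bl c']] by simp
  have orth: "\<tau> e a \<bullet> n e = 0" if "e \<in> Z" for e a
  proof -
    have lin: "linear (\<tau> e)" by (rule \<tau>_deform(2)[OF Z(3)[OF that]])
    have "d\<phi> s0 (c e) \<bullet> \<tau> e a = y e \<bullet> a" using T_inner[OF lin, of "c e" a] Tc[OF that] by simp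
    also have "\<dots> = - (\<nu> s0 \<bullet> \<tau> e a)"
    proof -
      have "\<nu> s0 \<bullet> \<tau> e a = \<nu> s0 \<bullet> (\<Sum>b\<in>Basis. (a \<bullet> b) *\<^sub>R \<tau> e b)"
        using linear_basis_expansion[OF lin, of a] by simp
      then show ?thesis unfolding y_def by (simp add: inner_sum_left inner_sum_right inner_commute[of a] mult.commute)
    qed
    finally show ?thesis by (simp add: n_def inner_add_left inner_commute[of "\<tau> e a"])
  qed
  have c0: "c 0 = 0"
  proof -
    have "T 0 (c 0) = 0" unfolding Tc[OF Z(2)] y_def \<tau>0
      by (simp add: inner_commute[of "\<nu> s0"] d\<phi>_\<nu>[OF s0(2)])
    then show ?thesis using injT0 linear_injective_0[OF linT] by blast
  qed
  have n0: "n 0 = \<nu> s0" by (simp add: n_def c0 linear_0[OF linear_d\<phi>[OF s0(2)]])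
  have deriv: "d\<phi> s0 c' \<bullet> d\<phi> s0 a = d\<phi> s0 a \<bullet> frechet_derivative \<nu> (at s0) s' - frechet_derivative (pull f) (at s0) a" for a
  proof -
    have 1: "((\<lambda>e. \<tau> e a \<bullet> n e) has_vector_derivative (d\<phi> s0 a \<bullet> d\<phi> s0 c' + ?T2 a \<bullet> \<nu> s0)) (at 0)"
      using has_vector_derivative_inner[OF \<tau>' n', of a] by (simp add: \<tau>0 n0)
    have "((\<lambda>e. 0) has_vector_derivative (d\<phi> s0 a \<bullet> d\<phi> s0 c' + ?T2 a \<bullet> \<nu> s0)) (at 0)"
      by (rule has_vector_derivative_transform_within_open[OF 1 Z(1,2)]) (rule orth)
    then have "d\<phi> s0 a \<bullet> d\<phi> s0 c' + ?T2 a \<bullet> \<nu> s0 = 0"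
      using vector_derivative_unique_at has_vector_derivative_const by blast
    then show ?thesis
      by (simp add: inner_add_left second_fundamental_form[OF s0(2)] disp_normal(1)[OF f s0(2)] inner_commute[of "d\<phi> s0 c'"])
  qed
  have ev: "eventually (\<lambda>e. n e \<noteq> 0 \<and> inj (frechet_derivative (deform f e) (at (s e))) \<and>
       (\<forall>a. frechet_derivative (deform f e) (at (s e)) a \<bullet> n e = 0)) (nhds 0)"
    unfolding eventually_nhds
  proof (intro exI[of _ Z] conjI ballI allI)
    fix e assume e: "e \<in> Z"
    have "n e \<bullet> \<nu> s0 = 1" by (simp add: n_def inner_add_left \<nu>_\<nu>[OF s0(2)] d\<phi>_\<nu>[OF s0(2)])
    then show "n e \<noteq> 0" by auto
    show "inj (frechet_derivative (deform f e) (at (s e)))" using Z(4)[OF e] \<tau>_deform[OF Z(3)[OF e]] by simp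
    show "frechet_derivative (deform f e) (at (s e)) a \<bullet> n e = 0" for a using orth[OF e] \<tau>_deform[OF Z(3)[OF e]] by simp
  qed (use Z in auto)
  show thesis by (rule that[OF n' n0 deriv d\<phi>_\<nu>[OF s0(2)] ev])
qed

lemma inverse_reflection_eq:
  assumes f: "f \<in> smooth_functions" and s: "s \<in> D" and n: "n \<noteq> 0"
    "inj (frechet_derivative (deform f e) (at s))"
    "\<And>a. frechet_derivative (deform f e) (at s) a \<bullet> n = 0" and w: "norm w = 1" and p: "deform f e s \<in> fst (oline q w)"
  shows "the_inv_into (lines_through (deform f e s)) (reflect_at (deform f e) s) (oline q w) = oline (deform f e s) (mirror n w)"
proof -
  let ?p = "deform f e s" and ?r = "reflect_at (deform f e) s"
  have r: "?r L = oline ?p (mirror n (snd L))" for L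
    by (rule reflect_at_eq[OF codim_one frechet_deform(2)[OF f s] n(2,1,3)])
  have inj: "inj_on ?r (lines_through ?p)"
  proof (rule inj_onI)
    fix L L' assume L: "L \<in> lines_through ?p" "L' \<in> lines_through ?p" "?r L = ?r L'"
    then have "mirror n (mirror n (snd L)) = mirror n (mirror n (snd L'))" unfolding r by (metis snd_oline)
    then have "snd L = snd L'" by (simp add: mirror_mirror[OF n(1)])
    then show "L = L'" using L unfolding lines_through_def by auto
  qed
  show ?thesis
  proof (rule the_inv_into_f_eq[OF inj])
    show "?r (oline ?p (mirror n w)) = oline q w" unfolding r by (simp add: mirror_mirror[OF n(1)] oline_point[OF p])
    show "oline ?p (mirror n w) \<in> lines_through ?p" unfolding lines_through_def using w norm_mirror[OF n(1), of w] by auto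
  qed
qed

lemma reflection_eq:
  assumes s: "s \<in> D" and b: "base_point (oline (\<phi> s) u) = \<phi> s"
  shows "reflection (oline (\<phi> s) u) = oline (\<phi> s) (u - (2 * (u \<bullet> \<nu> s)) *\<^sub>R \<nu> s)"
  unfolding reflection_def b param_\<phi>[OF s]
    reflect_at_eq[OF codim_one linear_d\<phi>[OF s] immersion[OF s] \<nu>_nonzero[OF s] d\<phi>_\<nu>[OF s]]
  by (simp add: mirror_def \<nu>_\<nu>[OF s])

text \<open>The displacements along the reflected line and back along the new line have equal rates
  \<open>- f / R\<close>. Their normal parts cancel, and the base point moves along the tangential part \<open>w\<close> at twice
  the rate of the parameter on the deformed hypersurface. The curvature term in the rate of the
  direction comes from the turning of the normal along this motion.\<close>

lemma reflected_curve:
  assumes s0: "s0 \<in> D" and f: "f \<in> smooth_functions"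
    and w: "w \<bullet> \<nu> s0 = 0" and R: "R > 0" and u0: "norm (w + R *\<^sub>R \<nu> s0) = 1"
    and L: "L = oline (\<phi> s0) (w + R *\<^sub>R \<nu> s0)" and b: "base_point L = \<phi> s0"
  obtains \<sigma> \<sigma>' u u' where "(\<sigma> has_vector_derivative \<sigma>') (at 0)" "(u has_vector_derivative u') (at 0)"
    "\<sigma> 0 = s0" "u 0 = w + R *\<^sub>R \<nu> s0"
    "d\<phi> s0 \<sigma>' = (- 2 * pull f s0 / R) *\<^sub>R w"
    "\<forall>a. u' \<bullet> d\<phi> s0 a = R * (d\<phi> s0 a \<bullet> frechet_derivative \<nu> (at s0) \<sigma>') - 2 * R * frechet_derivative (pull f) (at s0) a"
    "eventually (\<lambda>e. \<sigma> e \<in> D \<and> norm (u e) = 1 \<and> \<Delta>T f e L = oline (\<phi> (\<sigma> e)) (u e)) (nhds 0)"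
proof -
  let ?u0 = "w + R *\<^sub>R \<nu> s0" and ?u1 = "w - R *\<^sub>R \<nu> s0"
  have u0n: "?u0 \<bullet> \<nu> s0 = R" and u1n: "?u1 \<bullet> \<nu> s0 = - R"
    by (simp_all add: inner_add_left inner_diff_left w \<nu>_\<nu>[OF s0])
  have u1: "?u1 = mirror (\<nu> s0) ?u0"
    unfolding mirror_def u0n \<nu>_\<nu>[OF s0] by (simp add: scaleR_left_distrib[symmetric] algebra_simps)
  have nu1: "norm ?u1 = 1" unfolding u1 norm_mirror[OF \<nu>_nonzero[OF s0]] by (rule u0)
  have reflection_L: "reflection L = oline (\<phi> s0) ?u1"
    using reflection_eq[OF s0 b[unfolded L]] unfolding L u1 mirror_def by (simp add: \<nu>_\<nu>[OF s0])
  obtain s t s' t' where s: "(s has_vector_derivative s') (at 0)" "(t has_vector_derivative t') (at 0)" "s 0 = s0" "t 0 = 0"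
    and hit: "eventually (\<lambda>e. s e \<in> D \<and> deform f e (s e) = \<phi> s0 + t e *\<^sub>R ?u1 \<and>
       near_hit f e (\<phi> s0) (oline (\<phi> s0) ?u1) = s e) (nhds 0)"
    by (rule near_hit_curve[OF s0 f nu1]) (use u1n R in auto)
  obtain n n' where n: "(n has_vector_derivative n') (at 0)" "n 0 = \<nu> s0"
    "\<And>a. n' \<bullet> d\<phi> s0 a = d\<phi> s0 a \<bullet> frechet_derivative \<nu> (at s0) s' - frechet_derivative (pull f) (at s0) a"
    "n' \<bullet> \<nu> s0 = 0"
    and nev: "eventually (\<lambda>e. n e \<noteq> 0 \<and> inj (frechet_derivative (deform f e) (at (s e))) \<and>
       (\<forall>a. frechet_derivative (deform f e) (at (s e)) a \<bullet> n e = 0)) (nhds 0)"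
    using normal_curve[OF s(3) s0 f s(1)] by blast
  \<comment> \<open>Differentiate the equation of the intersection point and split it into its normal part, which
    gives \<open>t'\<close>, and its tangential part, which gives \<open>s'\<close>.\<close>
  have eq1: "d\<phi> s0 s' + disp f s0 = t' *\<^sub>R ?u1"
  proof -
    have p1: "((\<lambda>e. \<phi> (s e)) has_vector_derivative d\<phi> s0 s') (at 0)"
      using has_vector_derivative_compose_frechet[OF _ s(1), of \<phi>] smooth_on_differentiable[OF smooth_param s0] by (simp add: s(3))
    have p2: "((\<lambda>e. disp f (s e)) has_vector_derivative frechet_derivative (disp f) (at s0) s') (at 0)"
      using has_vector_derivative_compose_frechet[OF _ s(1), of "disp f"] smooth_on_differentiable[OF smooth_disp[OF f] s0] by (simp add: s(3))
    have "((\<lambda>e. deform f e (s e)) has_vector_derivative d\<phi> s0 s' + disp f s0) (at 0)"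
      unfolding deform_disp
      using has_vector_derivative_add[OF p1 has_vector_derivative_scaleR'[OF has_vector_derivative_id p2]] by (simp add: s(3))
    then have "((\<lambda>e. \<phi> s0 + t e *\<^sub>R ?u1) has_vector_derivative d\<phi> s0 s' + disp f s0) (at 0)"
      by (rule has_vector_derivative_cong_eventually) (use hit in \<open>auto elim: eventually_mono\<close>)
    moreover have "((\<lambda>e. \<phi> s0 + t e *\<^sub>R ?u1) has_vector_derivative t' *\<^sub>R ?u1) (at 0)"
      using has_vector_derivative_add[OF has_vector_derivative_const has_vector_derivative_scaleR'[OF s(2) has_vector_derivative_const]] by simp
    ultimately show ?thesis by (rule vector_derivative_unique_at)
  qed
  have t'_eq: "t' = - pull f s0 / R"
  proof -
    have "pull f s0 = - (t' * R)"
      using arg_cong[OF eq1, of "\<lambda>v. v \<bullet> \<nu> s0"] by (simp add: inner_add_left d\<phi>_\<nu>[OF s0] disp_def \<nu>_\<nu>[OF s0] u1n del: inner_diff_left)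
    then show ?thesis using R by simp
  qed
  have s'_eq: "d\<phi> s0 s' = t' *\<^sub>R w"
  proof -
    have "disp f s0 = - (t' * R) *\<^sub>R \<nu> s0" using R by (simp add: disp_def t'_eq)
    then show ?thesis using eq1 by (simp add: algebra_simps)
  qed
  \<comment> \<open>Only the tangential components of the rate of \<open>u\<close> matter, so the rate of the scalar \<open>k\<close> drops out.\<close>
  define u where "u e = mirror (n e) ?u1" for e
  define k where "k e = 2 * (?u1 \<bullet> n e) / (n e \<bullet> n e)" for e
  have u_k: "u e = ?u1 - k e *\<^sub>R n e" for e by (simp add: u_def mirror_def k_def)
  have "k differentiable (at 0)" unfolding k_def
  proof (rule differentiable_divide)
    have "n differentiable (at 0)" using n(1) unfolding has_vector_derivative_def differentiable_def by blast
    then show "(\<lambda>e. 2 * (?u1 \<bullet> n e)) differentiable (at 0)" "(\<lambda>e. n e \<bullet> n e) differentiable (at 0)"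
      by (intro differentiable_mult differentiable_inner differentiable_const; simp)+
    show "n 0 \<bullet> n 0 \<noteq> 0" by (simp add: n(2) \<nu>_\<nu>[OF s0])
  qed
  then obtain k' where k': "(k has_vector_derivative k') (at 0)" using vector_derivative_works by blast
  have k0: "k 0 = - 2 * R" unfolding k_def n(2) \<nu>_\<nu>[OF s0] u1n by simp
  have u': "(u has_vector_derivative - (k 0 *\<^sub>R n' + k' *\<^sub>R n 0)) (at 0)"
    unfolding u_k
    using has_vector_derivative_diff[OF has_vector_derivative_const has_vector_derivative_scaleR'[OF k' n(1)]] by simp
  have u_0: "u 0 = ?u0" unfolding u_k k0 n(2) by (simp add: scaleR_add_left[symmetric] algebra_simps)
  have u'_d: "- (k 0 *\<^sub>R n' + k' *\<^sub>R n 0) \<bullet> d\<phi> s0 a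
      = 2 * R * (d\<phi> s0 a \<bullet> frechet_derivative \<nu> (at s0) s' - frechet_derivative (pull f) (at s0) a)" for a
    unfolding k0 n(2) by (simp add: inner_add_left inner_diff_left n(3) inner_commute[of "\<nu> s0"] d\<phi>_\<nu>[OF s0] algebra_simps)
  \<comment> \<open>The lemma on intersections is used again, now without deformation and with a moving line.\<close>
  define p where "p e = \<phi> s0 + t e *\<^sub>R ?u1" for e
  have p': "(p has_vector_derivative t' *\<^sub>R ?u1) (at 0)" unfolding p_def
    using has_vector_derivative_add[OF has_vector_derivative_const has_vector_derivative_scaleR'[OF s(2) has_vector_derivative_const]] by simp
  have p_0: "p 0 = \<phi> s0" by (simp add: p_def s(4))
  obtain U' V g where U': "U' \<subseteq> D \<times> UNIV" and V: "open V" "(\<phi> s0, 0, ?u0) \<in> V"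
    and hom: "homeomorphism U' V (\<lambda>(s, t, e, w). (deform f e s - t *\<^sub>R w, e, w)) g"
    and g: "g differentiable (at (\<phi> s0, 0, ?u0))" "g (\<phi> s0, 0, ?u0) = (s0, 0, 0, ?u0)"
    by (rule deform_hit[OF s0 _ f, of ?u0]) (use u0n R in auto)
  have q: "((\<lambda>e. (p e, 0::real, u e)) has_vector_derivative (t' *\<^sub>R ?u1, 0, - (k 0 *\<^sub>R n' + k' *\<^sub>R n 0))) (at 0)"
    by (intro has_vector_derivative_Pair' has_vector_derivative_const p' u')
  define G where "G e = g (p e, 0, u e)" for e
  define \<sigma> where "\<sigma> e = fst (G e)" for e
  define r where "r e = fst (snd (G e))" for e
  obtain d where d: "(G has_vector_derivative d) (at 0)"
    using differentiable_at_curve[OF _ q, of g] g(1) unfolding G_def by (auto simp: p_0 u_0)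
  have \<sigma>': "(\<sigma> has_vector_derivative fst d) (at 0)" unfolding \<sigma>_def
    by (rule has_vector_derivative_bounded_linear[OF bounded_linear_fst d])
  have r': "(r has_vector_derivative fst (snd d)) (at 0)" unfolding r_def
    by (intro has_vector_derivative_bounded_linear[OF bounded_linear_fst] has_vector_derivative_bounded_linear[OF bounded_linear_snd] d)
  have G0: "G 0 = (s0, 0, 0, ?u0)" by (simp add: G_def p_0 u_0 g(2))
  have \<sigma>_0: "\<sigma> 0 = s0" and r_0: "r 0 = 0" by (simp_all add: \<sigma>_def r_def G0)
  have sol: "\<sigma> e \<in> D \<and> \<phi> (\<sigma> e) = p e + r e *\<^sub>R u e" if "(p e, 0, u e) \<in> V" for e
  proof -
    have "(\<lambda>(s, t, e, w). (deform f e s - t *\<^sub>R w, e, w)) (G e) = (p e, 0, u e)"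
      unfolding G_def by (rule homeomorphism_apply2[OF hom that])
    moreover have "G e \<in> U'" unfolding G_def using homeomorphism_image2[OF hom] that by blast
    ultimately show ?thesis using U' unfolding \<sigma>_def r_def by (auto simp: split_beta deform_disp algebra_simps)
  qed
  have evV: "eventually (\<lambda>e. (p e, 0, u e) \<in> V) (nhds 0)"
    by (rule isCont_eventually_open[OF has_vector_derivative_continuous[OF q] V(1)]) (simp add: p_0 u_0 V(2))
  have eq2: "d\<phi> s0 (fst d) = t' *\<^sub>R ?u1 + fst (snd d) *\<^sub>R ?u0"
  proof -
    have "((\<lambda>e. \<phi> (\<sigma> e)) has_vector_derivative d\<phi> s0 (fst d)) (at 0)"
      using has_vector_derivative_compose_frechet[OF _ \<sigma>', of \<phi>] smooth_on_differentiable[OF smooth_param s0] by (simp add: \<sigma>_0)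
    then have "((\<lambda>e. p e + r e *\<^sub>R u e) has_vector_derivative d\<phi> s0 (fst d)) (at 0)"
      by (rule has_vector_derivative_cong_eventually) (use evV sol in \<open>auto elim: eventually_mono\<close>)
    moreover have "((\<lambda>e. p e + r e *\<^sub>R u e) has_vector_derivative t' *\<^sub>R ?u1 + fst (snd d) *\<^sub>R ?u0) (at 0)"
      using has_vector_derivative_add[OF p' has_vector_derivative_scaleR'[OF r' u']] by (simp add: r_0 u_0)
    ultimately show ?thesis by (rule vector_derivative_unique_at)
  qed
  have r'_eq: "fst (snd d) = t'"
  proof -
    have "0 = (t' *\<^sub>R ?u1 + fst (snd d) *\<^sub>R ?u0) \<bullet> \<nu> s0" unfolding eq2[symmetric] by (simp add: d\<phi>_\<nu>[OF s0])
    also have "\<dots> = (fst (snd d) - t') * R"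
      by (simp only: inner_add_left[of "_ *\<^sub>R _"] inner_scaleR_left u1n u0n) (simp add: algebra_simps)
    finally show ?thesis using R by simp
  qed
  have \<sigma>'_w: "d\<phi> s0 (fst d) = (2 * t') *\<^sub>R w"
  proof -
    have "t' *\<^sub>R ?u1 + t' *\<^sub>R ?u0 = t' *\<^sub>R (2 *\<^sub>R w)" by (simp only: scaleR_add_right[symmetric] scaleR_2) simp
    then show ?thesis unfolding eq2 r'_eq by (simp add: mult.commute)
  qed
  have "d\<phi> s0 (fst d) = d\<phi> s0 (2 *\<^sub>R s')"
    unfolding \<sigma>'_w linear_scale[OF linear_d\<phi>[OF s0]] s'_eq by simp
  then have \<sigma>'_s': "fst d = 2 *\<^sub>R s'" using immersion[OF s0] by (simp add: inj_def)
  have d\<nu>: "frechet_derivative \<nu> (at s0) (fst d) = 2 *\<^sub>R frechet_derivative \<nu> (at s0) s'"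
    unfolding \<sigma>'_s' by (rule linear_scale[OF linear_frechet_derivative[OF smooth_on_differentiable[OF smooth_\<nu> s0]]])
  show thesis
  proof (rule that[OF \<sigma>' u' \<sigma>_0 u_0])
    show "d\<phi> s0 (fst d) = (- 2 * pull f s0 / R) *\<^sub>R w" unfolding \<sigma>'_w t'_eq by simp
    show "\<forall>a. - (k 0 *\<^sub>R n' + k' *\<^sub>R n 0) \<bullet> d\<phi> s0 a
      = R * (d\<phi> s0 a \<bullet> frechet_derivative \<nu> (at s0) (fst d)) - 2 * R * frechet_derivative (pull f) (at s0) a"
      unfolding u'_d d\<nu> by (simp add: algebra_simps)
    show "eventually (\<lambda>e. \<sigma> e \<in> D \<and> norm (u e) = 1 \<and> \<Delta>T f e L = oline (\<phi> (\<sigma> e)) (u e)) (nhds 0)"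
      using hit nev evV
    proof eventually_elim
      case (elim e)
      have se: "s e \<in> D" "deform f e (s e) = p e" "near_hit f e (\<phi> s0) (oline (\<phi> s0) ?u1) = s e"
        using elim(1) by (simp_all add: p_def)
      have pe: "deform f e (s e) \<in> fst (oline (\<phi> s0) ?u1)" unfolding se(2) p_def fst_oline by blast
      have "\<Delta>T f e L = oline (deform f e (s e)) (mirror (n e) ?u1)"
        unfolding \<Delta>T_def Let_def reflection_L b se(3)
        by (rule inverse_reflection_eq[OF f se(1) _ _ _ nu1 pe]) (use elim(2) in auto)
      also have "\<dots> = oline (p e) (u e)" by (simp add: se(2) u_def)
      also have "\<dots> = oline (\<phi> (\<sigma> e)) (u e)" using oline_shift[of "\<phi> (\<sigma> e)" "p e" "r e" "u e"] sol[OF elim(3)] by simp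
      finally have "\<Delta>T f e L = oline (\<phi> (\<sigma> e)) (u e)" .
      moreover have "norm (u e) = 1" unfolding u_def using norm_mirror elim(2) nu1 by metis
      ultimately show ?case using sol[OF elim(3)] by simp
    qed
  qed
qed

end

section \<open>The chart on the space of lines\<close>

lemma frechet_derivative_fst:
  fixes h :: "'a::euclidean_space \<Rightarrow> 'c::euclidean_space" and z :: "'a \<times> 'b::euclidean_space"
  assumes "h differentiable (at (fst z))"
  shows "frechet_derivative (\<lambda>z. h (fst z)) (at z) \<xi> = frechet_derivative h (at (fst z)) (fst \<xi>)"
proof -
  have "((\<lambda>z. h (fst z)) has_derivative (\<lambda>\<xi>. frechet_derivative h (at (fst z)) (fst \<xi>))) (at z)"
    using has_derivative_compose[OF has_derivative_fst[OF has_derivative_ident] differentiable_has_frechet, of h z UNIV] assms by simp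
  from frechet_derivative_eqI[OF this] show ?thesis by simp
qed

context line_domain
begin

abbreviation U :: "((real^'n) \<times> (real^'n)) set" where
  "U \<equiv> chart_image"

definition tang :: "(real^'n) \<times> (real^'n) \<Rightarrow> real^'m" where
  "tang z = lift (fst z) (snd z)"

definition direction :: "(real^'n) \<times> (real^'n) \<Rightarrow> real^'m" where
  "direction z = tang z + sqrt (1 - (norm (tang z))\<^sup>2) *\<^sub>R \<nu> (fst z)"

lemma open_U: "open U"
  using chart_domain by (simp add: contractible_domain_def chart_image_def)

text \<open>The normal component of the direction of a line of \<open>P\<close> is positive, so it is determined by the
  tangential part, and the line can be recovered from its coordinates.\<close>

lemma coords_line:
  assumes L: "L \<in> P"
  shows "fst (coords L) \<in> D" "base_point L = \<phi> (fst (coords L))" "tangential_part L = tang (coords L)"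
    "norm (tang (coords L)) < 1" "L = oline (\<phi> (fst (coords L))) (direction (coords L))"
proof -
  let ?x = "base_point L"
  have x: "?x \<in> \<gamma> \<inter> fst L" unfolding base_point_def by (rule theI'[OF one_point[OF L]])
  then obtain s where s: "s \<in> D" "?x = \<phi> s" unfolding \<gamma>_def by blast
  obtain p u where pu: "L = oline p u" "norm u = 1" using lines L by blast
  let ?T = "tangential_part L"
  have c: "coords L = (s, proj ?T)" unfolding coords_def proj_def s(2) param_\<phi>[OF s(1)] ..
  show D: "fst (coords L) \<in> D" using s by (simp add: c)
  show b: "?x = \<phi> (fst (coords L))" using s by (simp add: c)
  have T: "?T = u - (u \<bullet> \<nu> s) *\<^sub>R \<nu> s" by (simp add: tangential_part_def \<nu>_def s(2)) (simp add: pu(1))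
  then have "?T \<bullet> \<nu> s = 0" by (simp add: inner_diff_left \<nu>_\<nu>[OF s(1)])
  then show T': "?T = tang (coords L)" unfolding tang_def c using lift_proj[OF s(1)] by simp
  have pos: "u \<bullet> \<nu> s > 0" using transversal[OF L] by (simp add: \<nu>_def s(2)) (simp add: pu(1))
  have n2: "(norm ?T)\<^sup>2 = 1 - (u \<bullet> \<nu> s)\<^sup>2"
    unfolding power2_norm_eq_inner T using pu(2) \<nu>_\<nu>[OF s(1)]
    by (simp add: inner_diff_left inner_diff_right norm_eq_1 inner_commute power2_eq_square)
  then have "(norm ?T)\<^sup>2 < 1" using pos by simp
  then show "norm (tang (coords L)) < 1" by (simp add: T' abs_square_less_1)
  have "sqrt (1 - (norm ?T)\<^sup>2) = u \<bullet> \<nu> s" unfolding n2 using pos by simp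
  then have "u = direction (coords L)" unfolding direction_def T'[symmetric] by (simp add: c T)
  moreover have "L = oline ?x u" using x oline_point[of ?x p u] by (simp add: pu(1))
  ultimately show "L = oline (\<phi> (fst (coords L))) (direction (coords L))" by (simp add: b)
qed

lemma line_of_coords: "L \<in> P \<Longrightarrow> line_of (coords L) = L"
  unfolding line_of_def
proof (rule the_inv_into_f_f)
  show "inj_on coords P" by (rule inj_onI) (metis coords_line(5))
qed

lemma line_of:
  assumes "z \<in> U"
  shows "line_of z \<in> P" "coords (line_of z) = z" "line_of z = oline (\<phi> (fst z)) (direction z)"
    "base_point (line_of z) = \<phi> (fst z)" "tangential_part (line_of z) = tang z" "fst z \<in> D" "norm (tang z) < 1"
proof -
  obtain L where L: "L \<in> P" "z = coords L" using assms unfolding chart_image_def by blast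
  note l = line_of_coords[OF L(1)] and c = coords_line[OF L(1)]
  show "line_of z \<in> P" "coords (line_of z) = z" "line_of z = oline (\<phi> (fst z)) (direction z)"
    "base_point (line_of z) = \<phi> (fst z)" "tangential_part (line_of z) = tang z" "fst z \<in> D" "norm (tang z) < 1"
    using L l c by simp_all
qed

text \<open>Since \<open>P\<close> is the full set of lines with coordinates in \<open>U\<close>, a line with admissible data belongs to
  \<open>P\<close>. For \<open>\<Delta>T f \<epsilon> L\<close> the data are admissible for small \<open>\<epsilon>\<close> because \<open>U\<close> is open.\<close>

lemma coords_oline:
  assumes s: "s \<in> D" and u: "norm u = 1" "u \<bullet> \<nu> s > 0"
    and U: "(s, proj (u - (u \<bullet> \<nu> s) *\<^sub>R \<nu> s)) \<in> U"
  shows "coords (oline (\<phi> s) u) = (s, proj (u - (u \<bullet> \<nu> s) *\<^sub>R \<nu> s))"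
proof -
  let ?T = "u - (u \<bullet> \<nu> s) *\<^sub>R \<nu> s" and ?z = "(s, proj (u - (u \<bullet> \<nu> s) *\<^sub>R \<nu> s))"
  have "?T \<bullet> \<nu> s = 0" by (simp add: inner_diff_left \<nu>_\<nu>[OF s])
  then have T: "tang ?z = ?T" unfolding tang_def using lift_proj[OF s] by simp
  have "(norm ?T)\<^sup>2 = 1 - (u \<bullet> \<nu> s)\<^sup>2"
    unfolding power2_norm_eq_inner using u(1) \<nu>_\<nu>[OF s]
    by (simp add: inner_diff_left inner_diff_right norm_eq_1 inner_commute power2_eq_square)
  then have "direction ?z = u" unfolding direction_def T using u(2) by simp
  then show ?thesis using line_of(2,3)[OF U] by simp
qed

lemma smooth_tang: "smooth_on U tang"
proof (rule smooth_on_cong[OF open_U])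
  have base: "fst ` U \<subseteq> D" using line_of(6) by blast
  show "smooth_on U (\<lambda>z. \<Sum>b\<in>Basis. (snd z \<bullet> b) *\<^sub>R lift (fst z) b)"
    by (intro smooth_on_sum smooth_on_scaleR open_U smooth_on_fst[OF open_U open_D smooth_lift base]
        smooth_on_bounded_linear bounded_linear_inner_left_comp bounded_linear_snd)
  show "z \<in> U \<Longrightarrow> (\<Sum>b\<in>Basis. (snd z \<bullet> b) *\<^sub>R lift (fst z) b) = tang z" for z
    unfolding tang_def using linear_basis_expansion[OF linear_lift[OF line_of(6)]] by metis
qed

lemma frechet_tang_fibre:
  assumes z: "z \<in> U" shows "frechet_derivative tang (at z) (0, j) = lift (fst z) j"
proof -
  have line: "((\<lambda>t. z + t *\<^sub>R (0, j)) has_vector_derivative (0, j)) (at 0)"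
    using has_vector_derivative_add[OF has_vector_derivative_const[of z] has_vector_derivative_scaleR'[OF has_vector_derivative_id has_vector_derivative_const[of "(0, j)"]]]
    by (simp del: scaleR_Pair)
  have 0: "z + 0 *\<^sub>R (0, j) = z" by (simp add: zero_prod_def[symmetric])
  have "((\<lambda>t. tang (z + t *\<^sub>R (0, j))) has_vector_derivative frechet_derivative tang (at z) (0, j)) (at 0)"
    using has_vector_derivative_compose_frechet[OF _ line, of tang] smooth_on_differentiable[OF smooth_tang z] unfolding 0 by simp
  moreover have "tang (z + t *\<^sub>R (0, j)) = tang z + t *\<^sub>R lift (fst z) j" for t
    unfolding tang_def by (simp add: linear_add[OF linear_lift[OF line_of(6)[OF z]]] linear_scale[OF linear_lift[OF line_of(6)[OF z]]])
  moreover have "((\<lambda>t. tang z + t *\<^sub>R lift (fst z) j) has_vector_derivative lift (fst z) j) (at 0)"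
    using has_vector_derivative_add[OF has_vector_derivative_const has_vector_derivative_scaleR'[OF has_vector_derivative_id has_vector_derivative_const]] by simp
  ultimately show ?thesis using vector_derivative_unique_at by simp
qed

lemma \<alpha>_eq: "z \<in> U \<Longrightarrow> \<alpha> z \<eta> = tang z \<bullet> d\<phi> (fst z) (fst \<eta>)"
  by (simp add: \<alpha>_def line_of(5))

lemma smooth_d\<phi>_fst: "smooth_on U (\<lambda>z. d\<phi> (fst z) a)"
  by (rule smooth_on_fst[OF open_U open_D smooth_d\<phi>]) (use line_of(6) in blast)

text \<open>\<open>\<omega>\<close> is \<open>dw \<and> d\<phi>\<close>: the second derivatives of \<open>\<phi>\<close> cancel by symmetry.\<close>

lemma ext_deriv_\<alpha>:
  assumes z: "z \<in> U"
  shows "ext_deriv \<alpha> z \<xi> \<eta> = frechet_derivative tang (at z) \<xi> \<bullet> d\<phi> (fst z) (fst \<eta>)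
    - frechet_derivative tang (at z) \<eta> \<bullet> d\<phi> (fst z) (fst \<xi>)"
proof -
  have 1: "frechet_derivative (\<lambda>y. \<alpha> y \<eta>) (at z) \<xi>
    = tang z \<bullet> frechet_derivative (\<lambda>s. d\<phi> s (fst \<eta>)) (at (fst z)) (fst \<xi>) + frechet_derivative tang (at z) \<xi> \<bullet> d\<phi> (fst z) (fst \<eta>)" for \<xi> \<eta>
  proof -
    have "frechet_derivative (\<lambda>y. \<alpha> y \<eta>) (at z) = frechet_derivative (\<lambda>y. tang y \<bullet> d\<phi> (fst y) (fst \<eta>)) (at z)"
      by (rule frechet_derivative_cong_open[OF open_U z]) (rule \<alpha>_eq)
    then show ?thesis
      by (simp add: smooth_on_frechet_bilinear[OF bounded_bilinear_inner smooth_tang smooth_d\<phi>_fst z]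
          frechet_derivative_fst[OF smooth_on_differentiable[OF smooth_d\<phi> line_of(6)[OF z]]])
  qed
  show ?thesis unfolding ext_deriv_def 1
    using smooth_on_second_derivative_symmetric[OF open_D smooth_param line_of(6)[OF z], of "fst \<eta>" "fst \<xi>"] by simp
qed

text \<open>Pairing with vertical vectors detects the base component, as the tangential parts of the
  directions fill the tangent space.\<close>

lemma horizontal_zero:
  assumes z: "z \<in> U" and 0: "\<And>j. ext_deriv \<alpha> z \<xi> (0, j) = 0" shows "fst \<xi> = 0"
proof -
  note s = line_of(6)[OF z]
  obtain w where w: "d\<phi> (fst z) (fst \<xi>) = lift (fst z) w" using lift_surj[OF s] by blast
  have "lift (fst z) w \<bullet> lift (fst z) w = 0"
    using 0[of w] by (simp add: ext_deriv_\<alpha>[OF z] frechet_tang_fibre[OF z] w linear_0[OF linear_d\<phi>[OF s]])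
  then have "d\<phi> (fst z) (fst \<xi>) = d\<phi> (fst z) 0" by (simp add: w linear_0[OF linear_d\<phi>[OF s]])
  then show ?thesis using immersion[OF s] by (simp add: inj_def)
qed

lemma exact_symplectic_chart: "exact_symplectic U \<alpha>"
proof (rule exact_symplectic.intro)
  show "open U" by (rule open_U)
  show "smooth_on U (\<lambda>z. \<alpha> z \<eta>)" for \<eta>
    by (rule smooth_on_cong[OF open_U \<alpha>_eq[symmetric]], assumption)
      (intro smooth_on_inner open_U smooth_tang smooth_d\<phi>_fst)
  fix z assume z: "z \<in> U"
  note s = line_of(6)[OF z]
  show "linear (\<alpha> z)"
    using linear_d\<phi>[OF s] by (intro linearI) (simp_all add: \<alpha>_eq[OF z] linear_add linear_scale inner_add_right)
  fix \<xi> assume 0: "\<And>\<eta>. ext_deriv \<alpha> z \<xi> \<eta> = 0"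
  have \<xi>: "\<xi> = (0, snd \<xi>)" using horizontal_zero[OF z 0] by (simp add: prod_eq_iff)
  obtain a where a: "lift (fst z) (snd \<xi>) = d\<phi> (fst z) a" using tangent_vector[OF s lift_\<nu>[OF s]] by blast
  have "lift (fst z) (snd \<xi>) \<bullet> lift (fst z) (snd \<xi>) = 0"
    using 0[of "(a, 0)"] frechet_tang_fibre[OF z, of "snd \<xi>"]
    by (subst (asm) \<xi>) (simp add: ext_deriv_\<alpha>[OF z] a linear_0[OF linear_d\<phi>[OF s]])
  then have "lift (fst z) (snd \<xi>) = lift (fst z) 0" by (simp add: linear_0[OF linear_lift[OF s]])
  then have "snd \<xi> = 0" using inj_lift[OF s] by (simp add: inj_def)
  then show "\<xi> = 0" using \<xi> by (simp add: zero_prod_def)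
qed

text \<open>\<open>- 2 f \<langle>u, N\<rangle>\<close> for the line with unit direction \<open>u\<close>.\<close>

definition hamiltonian :: "(real^'m \<Rightarrow> real) \<Rightarrow> (real^'n) \<times> (real^'n) \<Rightarrow> real" where
  "hamiltonian f z = (- 2 * pull f (fst z)) * (1 - (norm (tang z))\<^sup>2) powr (1/2)"

text \<open>The coordinates of \<open>\<Delta>T f \<epsilon> L\<close> come from the base point and the tangential projection of the
  direction. Differentiating the projection produces a curvature term that cancels the one in
  \<open>reflected_curve\<close>.\<close>

lemma v_derivatives:
  assumes f: "f \<in> smooth_functions" and z: "z \<in> U"
  shows "d\<phi> (fst z) (fst (v f z)) = (- 2 * pull f (fst z) / sqrt (1 - (norm (tang z))\<^sup>2)) *\<^sub>R tang z"
    and "frechet_derivative tang (at z) (v f z) \<bullet> d\<phi> (fst z) a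
      = - 2 * sqrt (1 - (norm (tang z))\<^sup>2) * frechet_derivative (pull f) (at (fst z)) a"
proof -
  note s = line_of(6)[OF z]
  define R where "R = sqrt (1 - (norm (tang z))\<^sup>2)"
  have R2: "1 - (norm (tang z))\<^sup>2 > 0" using line_of(7)[OF z] by (simp add: abs_square_less_1)
  then have R: "R > 0" by (simp add: R_def)
  have w: "tang z \<bullet> \<nu> (fst z) = 0" unfolding tang_def by (rule lift_\<nu>[OF s])
  have direction: "direction z = tang z + R *\<^sub>R \<nu> (fst z)" by (simp add: direction_def R_def)
  have "(tang z + R *\<^sub>R \<nu> (fst z)) \<bullet> (tang z + R *\<^sub>R \<nu> (fst z)) = (norm (tang z))\<^sup>2 + R\<^sup>2"
    unfolding power2_norm_eq_inner using w
    by (simp add: inner_add_left inner_add_right inner_commute \<nu>_\<nu>[OF s] power2_eq_square)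
  also have "\<dots> = 1" using R2 by (simp add: R_def)
  finally have u0: "norm (tang z + R *\<^sub>R \<nu> (fst z)) = 1" by (simp add: norm_eq_1)
  obtain \<sigma> \<sigma>' u u' where c: "(\<sigma> has_vector_derivative \<sigma>') (at 0)" "(u has_vector_derivative u') (at 0)"
    "\<sigma> 0 = fst z" "u 0 = tang z + R *\<^sub>R \<nu> (fst z)"
    "d\<phi> (fst z) \<sigma>' = (- 2 * pull f (fst z) / R) *\<^sub>R tang z"
    "\<forall>a. u' \<bullet> d\<phi> (fst z) a = R * (d\<phi> (fst z) a \<bullet> frechet_derivative \<nu> (at (fst z)) \<sigma>') - 2 * R * frechet_derivative (pull f) (at (fst z)) a"
    "eventually (\<lambda>e. \<sigma> e \<in> D \<and> norm (u e) = 1 \<and> \<Delta>T f e (line_of z) = oline (\<phi> (\<sigma> e)) (u e)) (nhds 0)"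
    by (rule reflected_curve[OF s f w R u0 line_of(3)[OF z, unfolded direction] line_of(4)[OF z]])
  let ?d\<nu> = "frechet_derivative \<nu> (at (fst z)) \<sigma>'"
  define k where "k e = u e \<bullet> \<nu> (\<sigma> e)" for e
  define T where "T e = u e - k e *\<^sub>R \<nu> (\<sigma> e)" for e
  have \<nu>': "((\<lambda>e. \<nu> (\<sigma> e)) has_vector_derivative ?d\<nu>) (at 0)"
    using has_vector_derivative_compose_frechet[OF _ c(1), of \<nu>] smooth_on_differentiable[OF smooth_\<nu> s] by (simp add: c(3))
  obtain k' where k': "(k has_vector_derivative k') (at 0)"
    using has_vector_derivative_inner[OF c(2) \<nu>'] unfolding k_def by blast
  have k0: "k 0 = R" by (simp add: k_def c(3,4) inner_add_left w \<nu>_\<nu>[OF s])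
  define T' where "T' = u' - (R *\<^sub>R ?d\<nu> + k' *\<^sub>R \<nu> (fst z))"
  have T': "(T has_vector_derivative T') (at 0)"
    using has_vector_derivative_diff[OF c(2) has_vector_derivative_scaleR'[OF k' \<nu>']]
    unfolding T_def[abs_def] T'_def k0 c(3) .
  have T0: "T 0 = tang z" by (simp add: T_def k0 c(3,4))
  define q where "q e = (\<sigma> e, proj (T e))" for e
  have q': "(q has_vector_derivative (\<sigma>', proj T')) (at 0)" unfolding q_def
    by (intro has_vector_derivative_Pair' c(1) has_vector_derivative_bounded_linear[OF bounded_linear_proj T'])
  have q0: "q 0 = z" by (simp add: q_def c(3) T0) (simp add: tang_def proj_lift[OF s])
  have evU: "eventually (\<lambda>e. q e \<in> U) (nhds 0)"
    by (rule isCont_eventually_open[OF has_vector_derivative_continuous[OF q'] open_U]) (simp add: q0 z)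
  have evk: "eventually (\<lambda>e. k e \<in> {0<..}) (nhds 0)"
    by (rule isCont_eventually_open[OF has_vector_derivative_continuous[OF k']]) (simp_all add: k0 R)
  have "eventually (\<lambda>e. q e = coords (\<Delta>T f e (line_of z))) (nhds 0)"
    using c(7) evU evk
  proof eventually_elim
    case (elim e)
    have "coords (oline (\<phi> (\<sigma> e)) (u e)) = (\<sigma> e, proj (u e - (u e \<bullet> \<nu> (\<sigma> e)) *\<^sub>R \<nu> (\<sigma> e)))"
      by (rule coords_oline) (use elim in \<open>auto simp: q_def T_def k_def\<close>)
    then show ?case using elim(1) by (simp add: q_def T_def k_def)
  qed
  then have "((\<lambda>e. coords (\<Delta>T f e (line_of z))) has_vector_derivative (\<sigma>', proj T')) (at 0)"
    by (rule has_vector_derivative_cong_eventually[OF q'])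
  then have v: "v f z = (\<sigma>', proj T')" unfolding v_def by (rule vector_derivative_at)
  show "d\<phi> (fst z) (fst (v f z)) = (- 2 * pull f (fst z) / sqrt (1 - (norm (tang z))\<^sup>2)) *\<^sub>R tang z"
    using c(5) by (simp add: v R_def)
  have "((\<lambda>e. tang (q e)) has_vector_derivative frechet_derivative tang (at z) (\<sigma>', proj T')) (at 0)"
    using has_vector_derivative_compose_frechet[OF _ q', of tang] smooth_on_differentiable[OF smooth_tang z] by (simp add: q0)
  moreover have "eventually (\<lambda>e. tang (q e) = T e) (nhds 0)"
    using c(7)
  proof eventually_elim
    case (elim e)
    then have "T e \<bullet> \<nu> (\<sigma> e) = 0" by (simp add: T_def k_def inner_diff_left \<nu>_\<nu>)
    then show ?case using lift_proj[of "\<sigma> e" "T e"] elim by (simp add: tang_def q_def)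
  qed
  ultimately have "(T has_vector_derivative frechet_derivative tang (at z) (\<sigma>', proj T')) (at 0)"
    by (rule has_vector_derivative_cong_eventually)
  then have "frechet_derivative tang (at z) (v f z) = T'" unfolding v using T' by (rule vector_derivative_unique_at)
  then show "frechet_derivative tang (at z) (v f z) \<bullet> d\<phi> (fst z) a
      = - 2 * sqrt (1 - (norm (tang z))\<^sup>2) * frechet_derivative (pull f) (at (fst z)) a"
    by (simp add: T'_def inner_diff_left inner_add_left c(6)[rule_format] inner_commute[of "\<nu> (fst z)"] d\<phi>_\<nu>[OF s]
        inner_commute[of "?d\<nu>"] R_def[symmetric])
qed

lemma smooth_hamiltonian: "f \<in> smooth_functions \<Longrightarrow> smooth_on U (hamiltonian f)"
  and v_hamiltonian: "f \<in> smooth_functions \<Longrightarrow> z \<in> U \<Longrightarrow>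
    ext_deriv \<alpha> z (v f z) \<eta> = frechet_derivative (hamiltonian f) (at z) \<eta>"
proof -
  assume f: "f \<in> smooth_functions"
  define Q where "Q z = 1 - tang z \<bullet> tang z" for z
  have Q_norm: "Q z = 1 - (norm (tang z))\<^sup>2" for z by (simp add: Q_def power2_norm_eq_inner)
  have Qpos: "Q z > 0" if "z \<in> U" for z unfolding Q_norm using line_of(7)[OF that] by (simp add: abs_square_less_1)
  have sQ: "smooth_on U Q" unfolding Q_def[abs_def]
    by (intro smooth_on_diff smooth_on_inner open_U smooth_tang smooth_on_const)
  have sQp: "smooth_on U (\<lambda>z. Q z powr (1/2))"
    by (rule smooth_on_compose[OF open_U _ smooth_on_powr sQ]) (auto simp: Qpos)
  have base: "fst ` U \<subseteq> D" using line_of(6) by blast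
  have sp: "smooth_on U (\<lambda>z. - 2 * pull f (fst z))"
    by (intro smooth_on_mult open_U smooth_on_const smooth_on_fst[OF open_U open_D smooth_pull[OF f] base])
  have H: "hamiltonian f = (\<lambda>z. (- 2 * pull f (fst z)) * Q z powr (1/2))"
    by (simp add: hamiltonian_def[abs_def] Q_norm)
  show "smooth_on U (hamiltonian f)" unfolding H by (rule smooth_on_mult[OF open_U sp sQp])
  assume z: "z \<in> U"
  note s = line_of(6)[OF z]
  define R where "R = sqrt (Q z)"
  have R: "R > 0" using Qpos[OF z] by (simp add: R_def)
  have Q_R: "Q z powr (1/2) = R" "Q z powr (1/2 - 1) = 1 / R"
  proof -
    show "Q z powr (1/2) = R" using Qpos[OF z] by (simp add: R_def powr_half_sqrt)
    have "Q z powr (1/2 - 1) = Q z powr (1/2) / Q z" using Qpos[OF z] by (subst powr_diff) simp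
    also have "\<dots> = R / (R * R)" using \<open>Q z powr (1/2) = R\<close> Qpos[OF z] by (simp add: R_def)
    finally show "Q z powr (1/2 - 1) = 1 / R" using R by simp
  qed
  let ?dt = "frechet_derivative tang (at z)"
  have dQ: "frechet_derivative Q (at z) \<eta> = - 2 * (?dt \<eta> \<bullet> tang z)"
  proof -
    have "(Q has_derivative (\<lambda>\<eta>. 0 - (tang z \<bullet> ?dt \<eta> + ?dt \<eta> \<bullet> tang z))) (at z)" unfolding Q_def[abs_def]
      by (intro has_derivative_diff has_derivative_const has_derivative_inner smooth_on_has_derivative[OF smooth_tang z])
    from frechet_derivative_eqI[OF this] show ?thesis by (simp add: inner_commute)
  qed
  have dQp: "frechet_derivative (\<lambda>z. Q z powr (1/2)) (at z) \<eta> = - (?dt \<eta> \<bullet> tang z) / R"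
  proof -
    have "((\<lambda>u. u powr (1/2)) has_real_derivative (1/2) * Q z powr (1/2 - 1)) (at (Q z))"
      using Qpos[OF z] by (auto intro!: derivative_eq_intros)
    then have "((\<lambda>z. Q z powr (1/2)) has_derivative (\<lambda>\<eta>. (1/2) * Q z powr (1/2 - 1) * frechet_derivative Q (at z) \<eta>)) (at z)"
      unfolding has_field_derivative_def
      by (rule has_derivative_compose[OF smooth_on_has_derivative[OF sQ z]])
    from frechet_derivative_eqI[OF this] show ?thesis using Q_R(2) by (simp add: dQ)
  qed
  have dp: "frechet_derivative (\<lambda>z. - 2 * pull f (fst z)) (at z) \<eta> = - 2 * frechet_derivative (pull f) (at (fst z)) (fst \<eta>)"
    using smooth_on_frechet_mult[OF smooth_on_const smooth_on_fst[OF open_U open_D smooth_pull[OF f] base] z, of "-2" \<eta>]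
      frechet_derivative_fst[OF smooth_on_differentiable[OF smooth_pull[OF f] s], of \<eta>] by simp
  have "frechet_derivative (hamiltonian f) (at z) \<eta>
    = 2 * pull f (fst z) * (?dt \<eta> \<bullet> tang z) / R - 2 * R * frechet_derivative (pull f) (at (fst z)) (fst \<eta>)"
    unfolding H smooth_on_frechet_mult[OF sp sQp z] dQp dp Q_R by simp
  moreover have "ext_deriv \<alpha> z (v f z) \<eta>
    = 2 * pull f (fst z) * (?dt \<eta> \<bullet> tang z) / R - 2 * R * frechet_derivative (pull f) (at (fst z)) (fst \<eta>)"
    unfolding ext_deriv_\<alpha>[OF z] v_derivatives[OF f z] Q_norm[symmetric] R_def[symmetric] by simp
  ultimately show "ext_deriv \<alpha> z (v f z) \<eta> = frechet_derivative (hamiltonian f) (at z) \<eta>" by simp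
qed

text \<open>The factor \<open>- 1/2\<close> in the choice of \<open>f\<close> below compensates the factor \<open>- 2\<close> of the Hamiltonians,
  so the generators are exactly the functions \<open>b R\<close>.\<close>

lemma reflection_fields_dense:
  "C_infinity_dense U (lie_algebra_generated (v ` smooth_functions)) (hamiltonian_fields U \<omega>)"
proof -
  interpret ES: exact_symplectic U \<alpha> by (rule exact_symplectic_chart)
  have \<omega>_eq: "ES.\<omega> = \<omega>" by (simp add: ES.\<omega>_def \<omega>_def)
  have base: "fst ` U \<subseteq> D" using line_of(6) by blast
  have v_ham: "v f z = ES.ham (hamiltonian f) z" if "f \<in> smooth_functions" "z \<in> U" for f z
    by (rule ES.ham_unique[OF that(2) smooth_on_differentiable[OF smooth_hamiltonian[OF that(1)] that(2)]])
      (simp add: ES.\<omega>_def v_hamiltonian[OF that])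
  have v_smooth: "smooth_on U (v f)" if "f \<in> smooth_functions" for f
    by (rule smooth_on_cong[OF open_U v_ham[OF that, symmetric] ES.smooth_ham[OF smooth_hamiltonian[OF that]]])
  let ?L = "ES.hamiltonians (lie_algebra_generated (v ` smooth_functions))"
  have "v ` smooth_functions \<subseteq> hamiltonian_fields U ES.\<omega>"
  proof (rule image_subsetI)
    fix f assume f: "f \<in> smooth_functions"
    show "v f \<in> hamiltonian_fields U ES.\<omega>" unfolding hamiltonian_fields_def
      using v_smooth[OF f] smooth_hamiltonian[OF f] v_hamiltonian[OF f] by (auto simp: ES.\<omega>_def)
  qed
  moreover have "H \<in> smooth_closure U K ?L" if K: "compact K" "K \<subseteq> U" and H: "smooth_on U H" for K H
  proof -
    have vert: "fst (ES.ham (\<lambda>z. b (fst z)) z) = 0" if b: "smooth_on D b" and z: "z \<in> U" for b :: "real^'n \<Rightarrow> real" and z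
    proof (rule horizontal_zero[OF z])
      note s = line_of(6)[OF z]
      show "ext_deriv \<alpha> z (ES.ham (\<lambda>z. b (fst z)) z) (0, j) = 0" for j
        using ES.\<omega>_ham[OF z smooth_on_differentiable[OF smooth_on_fst[OF open_U open_D b base] z], of "(0, j)"]
          frechet_derivative_fst[OF smooth_on_differentiable[OF b s], of "(0, j)"]
          linear_0[OF linear_frechet_derivative[OF smooth_on_differentiable[OF b s]]]
        by (simp add: ES.\<omega>_def)
    qed
    have span: "(0, j) = (\<Sum>i\<in>Basis. (lift (fst z) j \<bullet> d\<phi> (fst z) i) *\<^sub>R ES.ham (\<lambda>z. fst z \<bullet> i) z)" if z: "z \<in> U" for j z
    proof -
      note s = line_of(6)[OF z]
      let ?X = "\<Sum>i\<in>Basis. (lift (fst z) j \<bullet> d\<phi> (fst z) i) *\<^sub>R ES.ham (\<lambda>z. fst z \<bullet> i) z"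
      have "ES.\<omega> z ((0, j) - ?X) \<eta> = 0" for \<eta>
      proof -
        have co: "ES.\<omega> z (ES.ham (\<lambda>z. fst z \<bullet> i) z) \<eta> = fst \<eta> \<bullet> i" for i
        proof -
          have bl: "bounded_linear (\<lambda>z::(real^'n) \<times> (real^'n). fst z \<bullet> i)"
            by (intro bounded_linear_inner_left_comp bounded_linear_fst)
          show ?thesis
            using ES.\<omega>_ham[OF z bounded_linear_imp_differentiable[OF bl], of \<eta>]
              frechet_derivative_eqI[OF bounded_linear_imp_has_derivative[OF bl]] by simp
        qed
        have "ES.\<omega> z ?X \<eta> = (\<Sum>i\<in>Basis. (lift (fst z) j \<bullet> d\<phi> (fst z) i) * (fst \<eta> \<bullet> i))"
          by (simp add: linear_sum[OF ES.linear_\<omega>_left[OF z]] linear_scale[OF ES.linear_\<omega>_left[OF z]] co)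
        also have "\<dots> = lift (fst z) j \<bullet> d\<phi> (fst z) (fst \<eta>)"
          using linear_basis_expansion[OF linear_d\<phi>[OF s], of "fst \<eta>"] by (simp add: inner_sum_right mult.commute)
        also have "\<dots> = ES.\<omega> z (0, j) \<eta>"
          by (simp add: ES.\<omega>_def ext_deriv_\<alpha>[OF z] frechet_tang_fibre[OF z] linear_0[OF linear_d\<phi>[OF s]])
        finally show ?thesis by (simp add: linear_diff[OF ES.linear_\<omega>_left[OF z]])
      qed
      then have "(0, j) - ?X = 0" using ES.nondegenerate[OF z] unfolding ES.\<omega>_def by blast
      then show ?thesis by simp
    qed
    have gen: "(\<lambda>z. b (fst z) * (1 - (norm (lift (fst z) (snd z)))\<^sup>2) powr (1/2)) \<in> ?L"
      if b: "smooth_on D b" for b :: "real^'n \<Rightarrow> real"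
    proof -
      define f where "f x = (- 1/2) * b (param x)" for x
      have pf: "pull f s = (- 1/2) * b s" if "s \<in> D" for s using param_\<phi>[OF that] by (simp add: pull_def f_def)
      have "smooth_on D (pull f)"
        by (rule smooth_on_cong[OF open_D pf[symmetric]], assumption) (intro smooth_on_mult open_D smooth_on_const b)
      then have f: "f \<in> smooth_functions" by (simp add: smooth_functions_def pull_def[abs_def])
      have eq: "hamiltonian f z = b (fst z) * (1 - (norm (lift (fst z) (snd z)))\<^sup>2) powr (1/2)" if "z \<in> U" for z
        using pf[OF line_of(6)[OF that]] by (simp add: hamiltonian_def tang_def)
      show ?thesis
      proof (rule ES.hamiltoniansI[of _ "v f"])
        show "smooth_on U (\<lambda>z. b (fst z) * (1 - (norm (lift (fst z) (snd z)))\<^sup>2) powr (1/2))"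
          by (rule smooth_on_cong[OF open_U eq smooth_hamiltonian[OF f]])
        show "v f \<in> lie_algebra_generated (v ` smooth_functions)" by (intro lie_algebra_generated.gen imageI f)
        show "v f z = ES.ham (\<lambda>z. b (fst z) * (1 - (norm (lift (fst z) (snd z)))\<^sup>2) powr (1/2)) z" if "z \<in> U" for z
          unfolding v_ham[OF f that] ES.ham_def using frechet_derivative_cong_open[OF open_U that eq] by simp
      qed
    qed
    interpret FG: fibrewise_generation U \<alpha> D lift "\<lambda>j i s. lift s j \<bullet> d\<phi> s i" ?L K
    proof (rule fibrewise_generation.intro[OF exact_symplectic_chart fibrewise_generation_axioms.intro])
      show "norm (lift (fst z) (snd z)) < 1" if "z \<in> U" for z using line_of(7)[OF that] by (simp add: tang_def)
      show "smooth_on D (\<lambda>s. lift s j \<bullet> d\<phi> s i)" for i j by (intro smooth_on_inner open_D smooth_lift smooth_d\<phi>)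
      show "F \<in> ?L \<Longrightarrow> smooth_on U F" for F by (simp add: ES.hamiltonians_def)
    qed (assumption | rule open_D base K smooth_lift linear_lift inj_lift vert span ES.hamiltonians_add ES.hamiltonians_scale ES.hamiltonians_poisson gen)+
    show ?thesis by (rule FG.smooth_in_closure[OF H])
  qed
  ultimately show ?thesis using ES.C_infinity_dense_hamiltonian[of "v ` smooth_functions"] unfolding \<omega>_eq by blast
qed

end

theorem theorem1p8:
  fixes D :: "(real^'n) set"
    and \<phi> :: "real^'n \<Rightarrow> real^'m"
    and N :: "real^'m \<Rightarrow> real^'m"
    and \<iota> :: "'n \<Rightarrow> 'm"
    and P :: "(real^'m) oriented_line set"
  assumes "line_domain D \<phi> N \<iota> P"
  shows "C_infinity_dense (line_domain.chart_image D \<phi> N \<iota> P)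
           (lie_algebra_generated
             (line_domain.v D \<phi> N \<iota> P ` parametrized_hypersurface.smooth_functions D \<phi>))
           (hamiltonian_fields (line_domain.chart_image D \<phi> N \<iota> P)
             (line_domain.\<omega> D \<phi> N \<iota> P))"
  by (rule line_domain.reflection_fields_dense[OF assms])

end
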